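(* Let $\rho_1,\rho_2$ be strongly cuspidal representations of $\mathrm{GL}_3(\mathfrak o_2)$ and $\chi_1,\chi_2$ characters of $\mathfrak o_2^\times$. For $i=1,2$ let $\pi_i=\mathrm{Ind}_Q^{\mathrm{GL}_4(\mathfrak o_2)}(\rho_i\otimes\chi_i)$, where $\rho_i\otimes\chi_i$ is regarded as a representation of $Q$ via $Q\twoheadrightarrow Q/U\cong\mathrm{GL}_3(\mathfrak o_2)\times\mathrm{GL}_1(\mathfrak o_2)$. If the central characters of $\pi_1$ and $\pi_2$ (the characters by which the centre of $\mathrm{GL}_4(\mathfrak o_2)$ acts) are the same, then $(\pi_1)_{N,\psi}\cong(\pi_2)_{N,\psi}$ as representations of $\mathrm{GL}_2(\mathfrak o_2)$.
   Context: Let $F$ be a finite unramified extension of $\mathbb Q_p$ or of $\mathbb F_p((t))$, with $p$ odd, $\mathfrak o$ its ring of integers, $\varpi$ a uniformizer, $\mathfrak o/(\varpi)\cong\mathbb F_q$, and $\mathfrak o_2=\mathfrak o/(\varpi^2)$. All representations are finite-dimensional and complex. Fix an additive character $\psi_0:\mathfrak o_2\to\mathbb C^\times$ that is nontrivial on $\varpi\mathfrak o_2$; for $x\in\mathbb F_q$ write $\psi_0(x):=\psi_0(\varpi\tilde x)$ for any lift $\tilde x\in\mathfrak o_2$ of $x$. $Q\subset\mathrm{GL}_4(\mathfrak o_2)$ is the subgroup of matrices $\begin{pmatrix}h_1&Y\\0&h_2\end{pmatrix}$ with $h_1\in\mathrm{GL}_3(\mathfrak o_2)$, $h_2\in\mathrm{GL}_1(\mathfrak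 o_2)$, $Y\in M_{3\times1}(\mathfrak o_2)$, and $U$ is its subgroup $h_1=I_3,h_2=1$. $N\cong M_2(\mathfrak o_2)$ is the group of matrices $\begin{pmatrix}I_2&X\\0&I_2\end{pmatrix}$, and $\psi(X)=\psi_0(\mathrm{tr}\,X)$. The degenerate Whittaker space of a representation $(\pi,V)$ of $\mathrm{GL}_4(\mathfrak o_2)$ is $\pi_{N,\psi}=\{v\in V:\pi(n)v=\psi(n)v\ \forall n\in N\}$, a representation of $\mathrm{GL}_2(\mathfrak o_2)$ via $g\mapsto\mathrm{diag}(g,g)$. For $C\in M_3(\mathbb F_q)$, $\phi_C(I_3+\varpi X)=\psi_0(\mathrm{tr}(C\bar X))$ ($\bar X$ the reduction mod $\varpi$) is a character of $I_3+\varpi M_3(\mathfrak o_2)$, and $I(\phi_C)$ is its stabilizer in $\mathrm{GL}_3(\mathfrak o_2)$ under conjugation. A strongly cuspidal representation of $\mathrm{GL}_3(\mathfrak o_2)$ is an (irreducible) representation $\mathrm{Ind}_{I(\phi_C)}^{\mathrm{GL}_3(\mathfrak o_2)}\tilde\phi_C$ where the characteristic polynomial of $C$ is irreducible over $\mathbb F_q$ and $\tilde\phi_C$ is a one-dimensional character of $I(\phi_C)$ extending $\phi_C$. *)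

theory Defs
  imports
    "HOL-Algebra.Embedded_Algebras"
    "Jordan_Normal_Form.Char_Poly"
    "Jordan_Normal_Form.VS_Connect"
begin

hide_const (open) Multiset.mult Polynomial.smult Modules.module

section \<open>Unramified local fields and the ring of length two\<close>

text \<open>The \<open>p\<close>-adic integers as the inverse limit of the rings \<open>\<int> / p\<^sup>n\<close>, the residue class at
  level \<open>n\<close> being represented by an integer in \<open>{0..<p\<^sup>n}\<close>.\<close>

definition padic_int_ring :: "nat \<Rightarrow> (nat \<Rightarrow> int) ring" where
  "padic_int_ring p =
    \<lparr>carrier = {a. \<forall>n. a n \<in> {0..<int p ^ n} \<and> a (Suc n) mod int p ^ n = a n},
     mult = (\<lambda>a b n. (a n * b n) mod int p ^ n),
     one = (\<lambda>n. 1 mod int p ^ n),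
     zero = (\<lambda>n. 0),
     add = (\<lambda>a b n. (a n + b n) mod int p ^ n)\<rparr>"

text \<open>The power series ring over \<open>\<int> / p\<close>, a series being given by its coefficients.\<close>

definition power_series_ring_mod :: "nat \<Rightarrow> (nat \<Rightarrow> int) ring" where
  "power_series_ring_mod p =
    \<lparr>carrier = {a. \<forall>n. a n \<in> {0..<int p}},
     mult = (\<lambda>a b n. (\<Sum>i\<le>n. a i * b (n - i)) mod int p),
     one = (\<lambda>n. if n = 0 then 1 else 0),
     zero = (\<lambda>n. 0),
     add = (\<lambda>a b n. (a n + b n) mod int p)\<rparr>"

definition fractions :: "'f::field set \<Rightarrow> 'f set" where
  "fractions A = {a / b | a b. a \<in> A \<and> b \<in> A \<and> b \<noteq> 0}"

definition integral_closure :: "'f::field set \<Rightarrow> 'f ring" where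
  "integral_closure A =
    class_ring\<lparr>carrier :=
      {x. \<exists>P :: 'f poly. lead_coeff P = 1 \<and> (\<forall>i. coeff P i \<in> A) \<and> poly P x = 0}\<rparr>"

text \<open>To be used for discrete valuation rings only.\<close>

definition uniformizer :: "('r, 'm) ring_scheme \<Rightarrow> 'r \<Rightarrow> bool" where
  "uniformizer R x \<longleftrightarrow> x \<in> carrier R \<and> maximalideal (PIdl\<^bsub>R\<^esub> x) R"

text \<open>The field is the whole type \<open>'f\<close>. The map \<open>\<iota>\<close> embeds \<open>A\<close>, which is \<open>\<int>\<^sub>p\<close> or the power series
  ring over \<open>\<int> / p\<close>, so that the fractions of its image form a copy of \<open>\<rat>\<^sub>p\<close> or of the field of
  Laurent series. Unramified means ramification index one; separability of the residue field
  extension is automatic, because the residue fields are finite.\<close>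

locale unramified_extension =
  fixes p :: nat and A :: "(nat \<Rightarrow> int) ring" and \<iota> :: "(nat \<Rightarrow> int) \<Rightarrow> 'f::field"
  assumes prime: "prime p"
    and base: "A = padic_int_ring p \<or> A = power_series_ring_mod p"
    and hom: "\<iota> \<in> Ring.ring_hom A class_ring"
    and inj: "inj_on \<iota> (carrier A)"
    and finite_extension:
      "ring.finite_dimension class_ring (fractions (\<iota> ` carrier A)) (UNIV :: 'f set)"
    and unramified:
      "\<And>x. uniformizer (class_ring\<lparr>carrier := \<iota> ` carrier A\<rparr>) x \<Longrightarrow>
            uniformizer (integral_closure (\<iota> ` carrier A)) x"

text \<open>The map \<open>h\<close> presents \<open>S\<close> as the quotient of \<open>R\<close> by the ideal \<open>I\<close>.\<close>

definition quotient_map ::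
    "('r, 'm) ring_scheme \<Rightarrow> 'r set \<Rightarrow> ('s, 'n) ring_scheme \<Rightarrow> ('r \<Rightarrow> 's) \<Rightarrow> bool" where
  "quotient_map R I S h \<longleftrightarrow>
    h \<in> Ring.ring_hom R S \<and> h ` carrier R = carrier S \<and> a_kernel R S h = I"


section \<open>Representations\<close>

text \<open>The scalars of \<open>rep_space\<close> are always \<open>class_ring :: complex ring\<close>; only the restriction of
  \<open>rep_act \<pi> g\<close> to the carrier of \<open>rep_space \<pi>\<close>, for \<open>g\<close> in the group, is meaningful.\<close>

record ('g, 'v) repr =
  rep_space :: "(complex, 'v) module"
  rep_act :: "'g \<Rightarrow> 'v \<Rightarrow> 'v"

definition is_representation :: "('g, 'm) monoid_scheme \<Rightarrow> ('g, 'v) repr \<Rightarrow> bool" where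
  "is_representation G \<pi> \<longleftrightarrow>
    vectorspace class_ring (rep_space \<pi>) \<and> vectorspace.fin_dim class_ring (rep_space \<pi>) \<and>
    (\<forall>g\<in>carrier G. rep_act \<pi> g \<in> module_hom class_ring (rep_space \<pi>) (rep_space \<pi>)) \<and>
    (\<forall>v\<in>carrier (rep_space \<pi>). rep_act \<pi> \<one>\<^bsub>G\<^esub> v = v) \<and>
    (\<forall>g\<in>carrier G. \<forall>h\<in>carrier G. \<forall>v\<in>carrier (rep_space \<pi>).
      rep_act \<pi> (g \<otimes>\<^bsub>G\<^esub> h) v = rep_act \<pi> g (rep_act \<pi> h v))"

definition equivalent_reps ::
    "('g, 'm) monoid_scheme \<Rightarrow> ('g, 'v) repr \<Rightarrow> ('g, 'w) repr \<Rightarrow> bool" where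
  "equivalent_reps G \<pi> \<sigma> \<longleftrightarrow>
    (\<exists>T \<in> module_hom class_ring (rep_space \<pi>) (rep_space \<sigma>).
      bij_betw T (carrier (rep_space \<pi>)) (carrier (rep_space \<sigma>)) \<and>
      (\<forall>g\<in>carrier G. \<forall>v\<in>carrier (rep_space \<pi>). T (rep_act \<pi> g v) = rep_act \<sigma> g (T v)))"

definition linear_character :: "('g, 'm) monoid_scheme \<Rightarrow> ('g \<Rightarrow> complex) \<Rightarrow> bool" where
  "linear_character G \<chi> \<longleftrightarrow> \<chi> \<in> hom G (units_of class_ring)"

definition character_rep :: "('g \<Rightarrow> complex) \<Rightarrow> ('g, complex) repr" where
  "character_rep \<chi> =
    \<lparr>rep_space = \<lparr>carrier = UNIV, mult = (*), one = 1, zero = 0, add = (+), smult = (*)\<rparr>,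
     rep_act = (\<lambda>g z. \<chi> g * z)\<rparr>"

text \<open>Functions with \<open>f (h g) = \<sigma>(h) (f g)\<close> for \<open>h \<in> H\<close>, on which \<open>G\<close> acts by right translation.
  The fields \<open>mult\<close> and \<open>one\<close> of the module record play no role.\<close>

definition induced_rep :: "('g, 'm) monoid_scheme \<Rightarrow> 'g set \<Rightarrow> ('g, 'v) repr \<Rightarrow> ('g, 'g \<Rightarrow> 'v) repr" where
  "induced_rep G H \<sigma> =
    \<lparr>rep_space =
      \<lparr>carrier = {f \<in> carrier G \<rightarrow>\<^sub>E carrier (rep_space \<sigma>).
                   \<forall>h\<in>H. \<forall>g\<in>carrier G. f (h \<otimes>\<^bsub>G\<^esub> g) = rep_act \<sigma> h (f g)},
       mult = (\<lambda>f f'. \<lambda>x\<in>carrier G. \<zero>\<^bsub>rep_space \<sigma>\<^esub>),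
       one = (\<lambda>x\<in>carrier G. \<zero>\<^bsub>rep_space \<sigma>\<^esub>),
       zero = (\<lambda>x\<in>carrier G. \<zero>\<^bsub>rep_space \<sigma>\<^esub>),
       add = (\<lambda>f f'. \<lambda>x\<in>carrier G. f x \<oplus>\<^bsub>rep_space \<sigma>\<^esub> f' x),
       smult = (\<lambda>c f. \<lambda>x\<in>carrier G. c \<odot>\<^bsub>rep_space \<sigma>\<^esub> f x)\<rparr>,
     rep_act = (\<lambda>g f. \<lambda>x\<in>carrier G. f (x \<otimes>\<^bsub>G\<^esub> g))\<rparr>"

definition group_center :: "('g, 'm) monoid_scheme \<Rightarrow> 'g set" where
  "group_center G = {z \<in> carrier G. \<forall>g\<in>carrier G. z \<otimes>\<^bsub>G\<^esub> g = g \<otimes>\<^bsub>G\<^esub> z}"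

definition central_character ::
    "('g, 'm) monoid_scheme \<Rightarrow> ('g, 'v) repr \<Rightarrow> ('g \<Rightarrow> complex) \<Rightarrow> bool" where
  "central_character G \<pi> \<omega> \<longleftrightarrow>
    linear_character (G\<lparr>carrier := group_center G\<rparr>) \<omega> \<and>
    (\<forall>z\<in>group_center G. \<forall>v\<in>carrier (rep_space \<pi>). rep_act \<pi> z v = \<omega> z \<odot>\<^bsub>rep_space \<pi>\<^esub> v)"


section \<open>Strongly cuspidal representations\<close>

definition GL :: "nat \<Rightarrow> 'a::comm_ring_1 mat monoid" where
  "GL n = units_of (ring_mat TYPE('a) n ())"

definition mat_trace :: "'a::comm_monoid_add mat \<Rightarrow> 'a" where
  "mat_trace M = (\<Sum>i<dim_row M. M $$ (i, i))"

definition additive_character :: "('a::comm_ring_1 \<Rightarrow> complex) \<Rightarrow> bool" where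
  "additive_character \<psi> \<longleftrightarrow> linear_character (add_monoid class_ring) \<psi>"

text \<open>In what follows \<open>'a\<close> is the ring of length two, \<open>\<pi>\<close> its uniformizer, and \<open>r\<close> the reduction to
  the residue field \<open>'k\<close>. The choices below do not matter: two lifts of an element of \<open>'k\<close> differ by
  a multiple of \<open>\<pi>\<close>, the matrix \<open>X\<close> in \<open>1 + \<pi> X\<close> is determined up to multiples of \<open>\<pi>\<close>, and
  \<open>\<pi>\<^sup>2 = 0\<close>.\<close>

definition residue_character ::
    "'a \<Rightarrow> ('a::comm_ring_1 \<Rightarrow> 'k::field) \<Rightarrow> ('a \<Rightarrow> complex) \<Rightarrow> 'k \<Rightarrow> complex" where
  "residue_character \<pi> r \<psi> x = \<psi> (\<pi> * (SOME y. r y = x))"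

definition congruence_subgroup :: "nat \<Rightarrow> 'a::comm_ring_1 \<Rightarrow> 'a mat set" where
  "congruence_subgroup n \<pi> = {1\<^sub>m n + \<pi> \<cdot>\<^sub>m X | X. X \<in> carrier_mat n n}"

definition congruence_character ::
    "nat \<Rightarrow> 'a \<Rightarrow> ('a::comm_ring_1 \<Rightarrow> 'k::field) \<Rightarrow> ('a \<Rightarrow> complex) \<Rightarrow> 'k mat \<Rightarrow> 'a mat \<Rightarrow> complex" where
  "congruence_character n \<pi> r \<psi> C M =
    residue_character \<pi> r \<psi>
      (mat_trace (C * map_mat r (SOME X. X \<in> carrier_mat n n \<and> M = 1\<^sub>m n + \<pi> \<cdot>\<^sub>m X)))"

definition inertia_group ::
    "nat \<Rightarrow> 'a \<Rightarrow> ('a::comm_ring_1 \<Rightarrow> 'k::field) \<Rightarrow> ('a \<Rightarrow> complex) \<Rightarrow> 'k mat \<Rightarrow> 'a mat set" where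
  "inertia_group n \<pi> r \<psi> C =
    {g \<in> carrier (GL n). \<forall>k\<in>congruence_subgroup n \<pi>.
      congruence_character n \<pi> r \<psi> C (g \<otimes>\<^bsub>GL n\<^esub> k \<otimes>\<^bsub>GL n\<^esub> inv\<^bsub>GL n\<^esub> g) =
      congruence_character n \<pi> r \<psi> C k}"

text \<open>Irreducibility is a consequence, by Clifford theory, and is not demanded separately.\<close>

definition strongly_cuspidal ::
    "nat \<Rightarrow> 'a \<Rightarrow> ('a::comm_ring_1 \<Rightarrow> 'k::field) \<Rightarrow> ('a \<Rightarrow> complex) \<Rightarrow> ('a mat, 'v) repr \<Rightarrow> bool" where
  "strongly_cuspidal n \<pi> r \<psi> \<rho> \<longleftrightarrow>
    is_representation (GL n) \<rho> \<and>
    (\<exists>C \<in> carrier_mat n n. \<exists>\<phi>.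
      irreducible (char_poly C) \<and>
      linear_character ((GL n)\<lparr>carrier := inertia_group n \<pi> r \<psi> C\<rparr>) \<phi> \<and>
      (\<forall>k\<in>congruence_subgroup n \<pi>. \<phi> k = congruence_character n \<pi> r \<psi> C k) \<and>
      equivalent_reps (GL n) \<rho>
        (induced_rep (GL n) (inertia_group n \<pi> r \<psi> C) (character_rep \<phi>)))"


section \<open>Parabolic induction and the degenerate Whittaker space\<close>

definition parabolic_31 :: "'a::comm_ring_1 mat set" where
  "parabolic_31 =
    {four_block_mat h\<^sub>1 Y (0\<^sub>m 1 3) h\<^sub>2 | h\<^sub>1 Y h\<^sub>2.
      h\<^sub>1 \<in> carrier (GL 3) \<and> Y \<in> carrier_mat 3 1 \<and> h\<^sub>2 \<in> carrier (GL 1)}"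

text \<open>The representation \<open>\<rho> \<otimes> \<chi>\<close> of the Levi quotient, inflated to the parabolic subgroup; its space,
  the tensor product with a line, is identified with the space of \<open>\<rho>\<close>.\<close>

definition inflated_rep ::
    "('a::comm_ring_1 mat, 'v) repr \<Rightarrow> ('a \<Rightarrow> complex) \<Rightarrow> ('a mat, 'v) repr" where
  "inflated_rep \<rho> \<chi> =
    \<lparr>rep_space = rep_space \<rho>,
     rep_act = (\<lambda>q v. \<chi> (q $$ (3, 3)) \<odot>\<^bsub>rep_space \<rho>\<^esub> rep_act \<rho> (mat 3 3 (\<lambda>(i, j). q $$ (i, j))) v)\<rparr>"

definition parabolic_induction ::
    "('a::comm_ring_1 mat, 'v) repr \<Rightarrow> ('a \<Rightarrow> complex) \<Rightarrow> ('a mat, 'a mat \<Rightarrow> 'v) repr" where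
  "parabolic_induction \<rho> \<chi> = induced_rep (GL 4) parabolic_31 (inflated_rep \<rho> \<chi>)"

definition whittaker_rep ::
    "('a::comm_ring_1 \<Rightarrow> complex) \<Rightarrow> ('a mat, 'v) repr \<Rightarrow> ('a mat, 'v) repr" where
  "whittaker_rep \<psi> \<pi> =
    \<lparr>rep_space = (rep_space \<pi>)\<lparr>carrier :=
       {v \<in> carrier (rep_space \<pi>). \<forall>X\<in>carrier_mat 2 2.
         rep_act \<pi> (four_block_mat (1\<^sub>m 2) X (0\<^sub>m 2 2) (1\<^sub>m 2)) v = \<psi> (mat_trace X) \<odot>\<^bsub>rep_space \<pi>\<^esub> v}\<rparr>,
     rep_act = (\<lambda>g. rep_act \<pi> (four_block_mat g (0\<^sub>m 2 2) (0\<^sub>m 2 2) g))\<rparr>"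

end

theory Submission
  imports Defs
begin

text \<open>Write \<open>R\<close> for the ring of length two, \<open>w\<close> for its uniformizer, \<open>k\<close> for its residue field and \<open>\<pi>\<close> for the
representation induced from \<open>\<rho> \<otimes> \<chi>\<close>. The degenerate Whittaker space of \<open>\<pi>\<close> is identified with a
representation of \<open>GL\<^sub>2(R)\<close> that is visibly determined by the central character \<open>\<omega>\<close> of \<open>\<pi>\<close>: it is
induced from the group \<open>S\<close> of lower triangular matrices \<open>s = (a, 0; c, d)\<close> whose reduction is scalar,
by the character \<open>\<theta>(s) = \<omega>(d) \<psi>\<^sub>0(c / d)\<close>. Two representations \<open>\<pi>\<close> with the same \<open>\<omega>\<close> then have
equivalent Whittaker spaces.

A strongly cuspidal \<open>\<rho>\<close> is induced from a character \<open>\<phi>\<close> of the group \<open>J\<close> of matrices whose reduction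
commutes with \<open>C\<close>. Hence, by induction in stages, \<open>\<pi>\<close> is induced from the group \<open>L\<close> of block matrices
\<open>(h, Y; 0, x)\<close> with \<open>h \<in> J\<close>, by the character \<open>\<alpha> = \<phi>(h) \<chi>(x)\<close>, and its Whittaker space
consists of the functions on \<open>GL\<^sub>4(R)\<close> that transform by \<open>\<alpha>\<close> under \<open>L\<close> on the left and by \<open>\<psi>\<close> under
\<open>N\<close> on the right. Such a function is supported on the single double coset \<open>L \<gamma> GL\<^sub>2 N\<close>, where \<open>\<gamma>\<close> is the
cyclic permutation matrix: every other double coset of \<open>L\<close> and \<open>GL\<^sub>2 N\<close> has a representative \<open>g\<close> for
which there are \<open>l \<in> L\<close> and \<open>n \<in> N\<close>, trivial modulo \<open>w\<close>, with \<open>l g = g n\<close> and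
\<open>\<alpha>(l) \<noteq> \<psi>(n)\<close> (lemma \<open>supported_all\<close>). Mackey's argument
(\<open>mackey_single_double_coset\<close>) then shows that restriction to \<open>\<gamma> GL\<^sub>2\<close> is an isomorphism onto the space
induced from the stabilizer of the double coset, which is \<open>S\<close> (\<open>open_stabilizer_character\<close>).

The stabilizer acts by a character that involves \<open>\<phi>\<close> and \<open>\<chi>\<close> on scalars, that is \<open>\<omega>\<close>, but also on
matrices congruent to one modulo \<open>w\<close>. The latter contribution is made to disappear by a good choice of
\<open>C\<close> in its conjugacy class. As the characteristic polynomial of \<open>C\<close> is irreducible, every nonzero vector is cyclic for
\<open>C\<close>. In a basis \<open>e\<^sub>0, C\<^sup>2 e\<^sub>0 - t C e\<^sub>0, C e\<^sub>0\<close> the matrix \<open>C\<close> takes a shape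
(\<open>whittaker_form\<close>) in which \<open>\<phi>\<close> restricted to the relevant congruence matrices is \<open>\<psi>\<^sub>0\<close> of one entry, up
to a term governed by the middle diagonal entry; the free parameter \<open>t\<close> gives that entry any prescribed
value. On the other hand \<open>\<chi>(1 + w x)\<close> is \<open>\<psi>\<^sub>0(w \<kappa> x)\<close> for some \<open>\<kappa>\<close>, by the self-duality of the finite
field \<open>k\<close>. Taking \<open>- \<kappa>\<close> as the middle diagonal entry cancels the two terms.

The field \<open>k\<close> is finite because \<open>\<rho>\<close> has finite dimension: the unipotent matrices
\<open>1 + x E\<^sub>0\<^sub>1\<close> with different reductions lie in different cosets of \<open>J\<close>.\<close>


section \<open>Equivalence of representations\<close>

text \<open>Closure under the operations is what makes the inverse of an equivalence linear and equivariant;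
it is weaker than being a representation and also easily checked for Whittaker spaces.\<close>

definition rep_closed :: "('g, 'm) monoid_scheme \<Rightarrow> ('g, 'v) repr \<Rightarrow> bool" where
  "rep_closed G \<pi> \<longleftrightarrow>
    (\<forall>u\<in>carrier (rep_space \<pi>). \<forall>v\<in>carrier (rep_space \<pi>). u \<oplus>\<^bsub>rep_space \<pi>\<^esub> v \<in> carrier (rep_space \<pi>)) \<and>
    (\<forall>c. \<forall>v\<in>carrier (rep_space \<pi>). c \<odot>\<^bsub>rep_space \<pi>\<^esub> v \<in> carrier (rep_space \<pi>)) \<and>
    (\<forall>g\<in>carrier G. \<forall>v\<in>carrier (rep_space \<pi>). rep_act \<pi> g v \<in> carrier (rep_space \<pi>))"

lemma equivalent_repsI:
  assumes "bij_betw T (carrier (rep_space \<pi>)) (carrier (rep_space \<sigma>))"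
    and "\<And>u v. u \<in> carrier (rep_space \<pi>) \<Longrightarrow> v \<in> carrier (rep_space \<pi>) \<Longrightarrow>
           T (u \<oplus>\<^bsub>rep_space \<pi>\<^esub> v) = T u \<oplus>\<^bsub>rep_space \<sigma>\<^esub> T v"
    and "\<And>c v. v \<in> carrier (rep_space \<pi>) \<Longrightarrow> T (c \<odot>\<^bsub>rep_space \<pi>\<^esub> v) = c \<odot>\<^bsub>rep_space \<sigma>\<^esub> T v"
    and "\<And>g v. g \<in> carrier G \<Longrightarrow> v \<in> carrier (rep_space \<pi>) \<Longrightarrow> T (rep_act \<pi> g v) = rep_act \<sigma> g (T v)"
  shows "equivalent_reps G \<pi> \<sigma>"
  unfolding equivalent_reps_def module_hom_def
  using assms by (intro bexI[of _ T]) (auto dest: bij_betwE)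

definition is_equivalence ::
    "('g, 'm) monoid_scheme \<Rightarrow> ('g, 'v) repr \<Rightarrow> ('g, 'w) repr \<Rightarrow> ('v \<Rightarrow> 'w) \<Rightarrow> bool" where
  "is_equivalence G \<pi> \<sigma> T \<longleftrightarrow>
    T \<in> module_hom class_ring (rep_space \<pi>) (rep_space \<sigma>) \<and>
    bij_betw T (carrier (rep_space \<pi>)) (carrier (rep_space \<sigma>)) \<and>
    (\<forall>g\<in>carrier G. \<forall>v\<in>carrier (rep_space \<pi>). T (rep_act \<pi> g v) = rep_act \<sigma> g (T v))"

lemma equivalent_reps_iff: "equivalent_reps G \<pi> \<sigma> \<longleftrightarrow> (\<exists>T. is_equivalence G \<pi> \<sigma> T)"
  unfolding equivalent_reps_def is_equivalence_def by auto

lemma is_equivalenceD: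
  assumes "is_equivalence G \<pi> \<sigma> T"
  shows "bij_betw T (carrier (rep_space \<pi>)) (carrier (rep_space \<sigma>))"
    and "u \<in> carrier (rep_space \<pi>) \<Longrightarrow> v \<in> carrier (rep_space \<pi>) \<Longrightarrow>
           T (u \<oplus>\<^bsub>rep_space \<pi>\<^esub> v) = T u \<oplus>\<^bsub>rep_space \<sigma>\<^esub> T v"
    and "v \<in> carrier (rep_space \<pi>) \<Longrightarrow> T (c \<odot>\<^bsub>rep_space \<pi>\<^esub> v) = c \<odot>\<^bsub>rep_space \<sigma>\<^esub> T v"
    and "g \<in> carrier G \<Longrightarrow> v \<in> carrier (rep_space \<pi>) \<Longrightarrow> T (rep_act \<pi> g v) = rep_act \<sigma> g (T v)"
  using assms by (auto simp: is_equivalence_def module_hom_def)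

lemma equivalent_reps_trans:
  assumes "equivalent_reps G \<pi> \<sigma>" "equivalent_reps G \<sigma> \<tau>"
  shows "equivalent_reps G \<pi> \<tau>"
proof -
  obtain T where "is_equivalence G \<pi> \<sigma> T"
    using assms(1) unfolding equivalent_reps_iff ..
  note T = is_equivalenceD[OF this]
  obtain U where "is_equivalence G \<sigma> \<tau> U"
    using assms(2) unfolding equivalent_reps_iff ..
  note U = is_equivalenceD[OF this]
  have Tc: "T v \<in> carrier (rep_space \<sigma>)" if "v \<in> carrier (rep_space \<pi>)" for v
    using T(1) that bij_betwE by blast
  show ?thesis
    by (rule equivalent_repsI[where T = "U \<circ> T"]) (auto simp: T U Tc bij_betw_trans[OF T(1) U(1)])
qed

lemma equivalent_reps_sym:
  assumes "equivalent_reps G \<pi> \<sigma>" "rep_closed G \<pi>"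
  shows "equivalent_reps G \<sigma> \<pi>"
proof -
  obtain T where "is_equivalence G \<pi> \<sigma> T"
    using assms(1) unfolding equivalent_reps_iff ..
  note T = is_equivalenceD[OF this]
  define U where "U = inv_into (carrier (rep_space \<pi>)) T"
  have bij: "bij_betw U (carrier (rep_space \<sigma>)) (carrier (rep_space \<pi>))"
    unfolding U_def by (rule bij_betw_inv_into[OF T(1)])
  have Uc: "U v \<in> carrier (rep_space \<pi>)" if "v \<in> carrier (rep_space \<sigma>)" for v
    using bij that bij_betwE by blast
  have TU: "T (U v) = v" if "v \<in> carrier (rep_space \<sigma>)" for v
    unfolding U_def using bij_betw_inv_into_right[OF T(1) that] .
  have UT: "U (T v) = v" if "v \<in> carrier (rep_space \<pi>)" for v
    unfolding U_def using bij_betw_inv_into_left[OF T(1) that] .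
  note cl = assms(2)[unfolded rep_closed_def]
  show ?thesis
  proof (rule equivalent_repsI[OF bij])
    fix u v assume uv: "u \<in> carrier (rep_space \<sigma>)" "v \<in> carrier (rep_space \<sigma>)"
    have "T (U u \<oplus>\<^bsub>rep_space \<pi>\<^esub> U v) = u \<oplus>\<^bsub>rep_space \<sigma>\<^esub> v"
      using uv by (simp add: T Uc TU)
    then show "U (u \<oplus>\<^bsub>rep_space \<sigma>\<^esub> v) = U u \<oplus>\<^bsub>rep_space \<pi>\<^esub> U v"
      using UT cl Uc uv by metis
  next
    fix c v assume v: "v \<in> carrier (rep_space \<sigma>)"
    have "T (c \<odot>\<^bsub>rep_space \<pi>\<^esub> U v) = c \<odot>\<^bsub>rep_space \<sigma>\<^esub> v"
      using v by (simp add: T Uc TU)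
    then show "U (c \<odot>\<^bsub>rep_space \<sigma>\<^esub> v) = c \<odot>\<^bsub>rep_space \<pi>\<^esub> U v"
      using UT cl Uc v by metis
  next
    fix g v assume v: "g \<in> carrier G" "v \<in> carrier (rep_space \<sigma>)"
    have "T (rep_act \<pi> g (U v)) = rep_act \<sigma> g v"
      using v by (simp add: T Uc TU)
    then show "U (rep_act \<sigma> g v) = rep_act \<pi> g (U v)"
      using UT cl Uc v by metis
  qed
qed

lemma is_representation_closed:
  assumes "is_representation G \<rho>" shows "rep_closed G \<rho>"
proof -
  interpret V: vectorspace class_ring "rep_space \<rho>" using assms by (simp add: is_representation_def)
  show ?thesis
    using assms unfolding rep_closed_def is_representation_def by (auto dest!: bspec module_hom_closed)
qed

lemma whittaker_rep_equivalent:
  fixes \<pi> :: "('a::comm_ring_1 mat, 'v) repr" and \<sigma> :: "('a mat, 'w) repr"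
  assumes "equivalent_reps (GL 4) \<pi> \<sigma>" "rep_closed (GL 4) \<pi>"
    and unip: "\<And>X :: 'a mat. X \<in> carrier_mat 2 2 \<Longrightarrow> four_block_mat (1\<^sub>m 2) X (0\<^sub>m 2 2) (1\<^sub>m 2) \<in> carrier (GL 4)"
    and diag: "\<And>g :: 'a mat. g \<in> carrier (GL 2) \<Longrightarrow> four_block_mat g (0\<^sub>m 2 2) (0\<^sub>m 2 2) g \<in> carrier (GL 4)"
  shows "equivalent_reps (GL 2) (whittaker_rep \<psi> \<pi>) (whittaker_rep \<psi> \<sigma>)"
proof -
  obtain T where "is_equivalence (GL 4) \<pi> \<sigma> T"
    using assms(1) unfolding equivalent_reps_iff ..
  note T = is_equivalenceD[OF this]
  note cl = assms(2)[unfolded rep_closed_def]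
  have inj: "inj_on T (carrier (rep_space \<pi>))" using T(1) by (rule bij_betw_imp_inj_on)
  have eq: "rep_act \<pi> (four_block_mat (1\<^sub>m 2) X (0\<^sub>m 2 2) (1\<^sub>m 2)) v = c \<odot>\<^bsub>rep_space \<pi>\<^esub> v \<longleftrightarrow>
       rep_act \<sigma> (four_block_mat (1\<^sub>m 2) X (0\<^sub>m 2 2) (1\<^sub>m 2)) (T v) = c \<odot>\<^bsub>rep_space \<sigma>\<^esub> T v"
    if "X \<in> carrier_mat 2 2" "v \<in> carrier (rep_space \<pi>)" for X v c
    using inj_on_eq_iff[OF inj, of "rep_act \<pi> (four_block_mat (1\<^sub>m 2) X (0\<^sub>m 2 2) (1\<^sub>m 2)) v" "c \<odot>\<^bsub>rep_space \<pi>\<^esub> v"]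
      that T unip[OF that(1)] cl by simp
  show ?thesis
  proof (rule equivalent_repsI[where T = T])
    show "bij_betw T (carrier (rep_space (whittaker_rep \<psi> \<pi>))) (carrier (rep_space (whittaker_rep \<psi> \<sigma>)))"
    proof (rule bij_betw_subset[OF T(1)])
      show "carrier (rep_space (whittaker_rep \<psi> \<pi>)) \<subseteq> carrier (rep_space \<pi>)"
        by (auto simp: whittaker_rep_def)
      show "T ` carrier (rep_space (whittaker_rep \<psi> \<pi>)) = carrier (rep_space (whittaker_rep \<psi> \<sigma>))"
      proof (intro equalityI subsetI)
        fix y assume "y \<in> T ` carrier (rep_space (whittaker_rep \<psi> \<pi>))"
        then show "y \<in> carrier (rep_space (whittaker_rep \<psi> \<sigma>))"
          using bij_betw_imp_surj_on[OF T(1)] eq by (auto simp: whittaker_rep_def)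
      next
        fix y assume y: "y \<in> carrier (rep_space (whittaker_rep \<psi> \<sigma>))"
        then obtain v where "v \<in> carrier (rep_space \<pi>)" "y = T v"
          using bij_betw_imp_surj_on[OF T(1)] by (auto simp: whittaker_rep_def)
        then show "y \<in> T ` carrier (rep_space (whittaker_rep \<psi> \<pi>))"
          using y eq by (auto simp: whittaker_rep_def)
      qed
    qed
  qed (auto simp: whittaker_rep_def T diag)
qed

section \<open>Induced representations\<close>

lemma induced_rep_character_simps:
  "carrier (rep_space (induced_rep G H (character_rep \<phi>))) =
    {f \<in> carrier G \<rightarrow>\<^sub>E UNIV. \<forall>h\<in>H. \<forall>g\<in>carrier G. f (h \<otimes>\<^bsub>G\<^esub> g) = \<phi> h * f g}"
  "f \<oplus>\<^bsub>rep_space (induced_rep G H (character_rep \<phi>))\<^esub> f' = (\<lambda>x\<in>carrier G. f x + f' x)"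
  "c \<odot>\<^bsub>rep_space (induced_rep G H (character_rep \<phi>))\<^esub> f = (\<lambda>x\<in>carrier G. c * f x)"
  "rep_act (induced_rep G H (character_rep \<phi>)) g f = (\<lambda>x\<in>carrier G. f (x \<otimes>\<^bsub>G\<^esub> g))"
  by (simp_all add: induced_rep_def character_rep_def)

lemma (in group) rep_closed_induced_character:
  assumes "H \<subseteq> carrier G"
  shows "rep_closed G (induced_rep G H (character_rep \<phi>))"
  unfolding rep_closed_def induced_rep_character_simps
  using assms by (auto simp: subset_iff algebra_simps m_assoc)

lemma (in group) rep_closed_induced:
  assumes H: "H \<subseteq> carrier G"
    and add: "\<And>u v. u \<in> carrier (rep_space \<sigma>) \<Longrightarrow> v \<in> carrier (rep_space \<sigma>) \<Longrightarrow> u \<oplus>\<^bsub>rep_space \<sigma>\<^esub> v \<in> carrier (rep_space \<sigma>)"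
    and smult: "\<And>c v. v \<in> carrier (rep_space \<sigma>) \<Longrightarrow> c \<odot>\<^bsub>rep_space \<sigma>\<^esub> v \<in> carrier (rep_space \<sigma>)"
    and act: "\<And>h. h \<in> H \<Longrightarrow> rep_act \<sigma> h \<in> module_hom class_ring (rep_space \<sigma>) (rep_space \<sigma>)"
  shows "rep_closed G (induced_rep G H \<sigma>)"
  unfolding rep_closed_def induced_rep_def
  using H by (auto simp: subset_iff m_assoc PiE_iff add smult module_hom_add[OF act] module_hom_smult[OF act])

text \<open>Left translation by \<open>x\<close> carries functions equivariant under \<open>H\<close> to functions equivariant under
the conjugate of \<open>H\<close>.\<close>

lemma (in group) conjugate_induced_character:
  assumes x: "x \<in> carrier G" and H: "H \<subseteq> carrier G"
  shows "equivalent_reps G (induced_rep G H (character_rep \<phi>))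
    (induced_rep G {h \<in> carrier G. x \<otimes> h \<otimes> inv x \<in> H} (character_rep (\<lambda>h. \<phi> (x \<otimes> h \<otimes> inv x))))"
    (is "equivalent_reps G ?A ?B")
proof (rule equivalent_repsI[where T = "\<lambda>f. \<lambda>g\<in>carrier G. f (x \<otimes> g)"])
  let ?X = "{f \<in> carrier G \<rightarrow>\<^sub>E UNIV. \<forall>h\<in>H. \<forall>g\<in>carrier G. f (h \<otimes> g) = \<phi> h * f g}"
  let ?Y = "{f \<in> carrier G \<rightarrow>\<^sub>E UNIV. \<forall>h\<in>{h \<in> carrier G. x \<otimes> h \<otimes> inv x \<in> H}. \<forall>g\<in>carrier G.
      f (h \<otimes> g) = \<phi> (x \<otimes> h \<otimes> inv x) * f g}"
  show "bij_betw (\<lambda>f. \<lambda>g\<in>carrier G. f (x \<otimes> g)) (carrier (rep_space ?A)) (carrier (rep_space ?B))"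
    unfolding induced_rep_character_simps
  proof (rule bij_betw_byWitness[where f' = "\<lambda>f. \<lambda>g\<in>carrier G. f (inv x \<otimes> g)"])
    show "\<forall>f\<in>?X. (\<lambda>g\<in>carrier G. (\<lambda>g\<in>carrier G. f (x \<otimes> g)) (inv x \<otimes> g)) = f"
      using x by (auto simp: m_assoc[symmetric] PiE_iff extensional_def fun_eq_iff)
    show "\<forall>f\<in>?Y. (\<lambda>g\<in>carrier G. (\<lambda>g\<in>carrier G. f (inv x \<otimes> g)) (x \<otimes> g)) = f"
      using x by (auto simp: m_assoc[symmetric] PiE_iff extensional_def fun_eq_iff)
    show "(\<lambda>f. \<lambda>g\<in>carrier G. f (x \<otimes> g)) ` ?X \<subseteq> ?Y"
    proof clarsimp
      fix f h g assume f: "\<forall>h\<in>H. \<forall>g\<in>carrier G. f (h \<otimes> g) = \<phi> h * f g"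
        and h: "h \<in> carrier G" "x \<otimes> h \<otimes> inv x \<in> H" and g: "g \<in> carrier G"
      have "x \<otimes> (h \<otimes> g) = (x \<otimes> h \<otimes> inv x) \<otimes> (x \<otimes> g)"
        using x h g by (simp add: m_assoc) (simp add: m_assoc[symmetric])
      then show "f (x \<otimes> (h \<otimes> g)) = \<phi> (x \<otimes> h \<otimes> inv x) * f (x \<otimes> g)"
        using f h g x by simp
    qed
    show "(\<lambda>f. \<lambda>g\<in>carrier G. f (inv x \<otimes> g)) ` ?Y \<subseteq> ?X"
    proof (clarsimp simp: subsetD[OF H])
      fix f h g assume f: "\<forall>h. h \<in> carrier G \<and> x \<otimes> h \<otimes> inv x \<in> H \<longrightarrow>
            (\<forall>g\<in>carrier G. f (h \<otimes> g) = \<phi> (x \<otimes> h \<otimes> inv x) * f g)"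
        and h: "h \<in> H" and g: "g \<in> carrier G"
      have hc: "h \<in> carrier G" using h H by auto
      let ?k = "inv x \<otimes> h \<otimes> x"
      have 1: "x \<otimes> ?k \<otimes> inv x = h"
        using x hc by (simp add: m_assoc) (simp add: m_assoc[symmetric])
      have 2: "inv x \<otimes> (h \<otimes> g) = ?k \<otimes> (inv x \<otimes> g)"
        using x hc g by (simp add: m_assoc) (simp add: m_assoc[symmetric])
      show "f (inv x \<otimes> (h \<otimes> g)) = \<phi> h * f (inv x \<otimes> g)"
        using f[rule_format, of ?k "inv x \<otimes> g"] 1 2 h x hc g by auto
    qed
  qed
qed (use x in \<open>auto simp: induced_rep_character_simps m_assoc fun_eq_iff\<close>)

text \<open>Here \<open>Q\<close> is a semidirect product of the kernel of \<open>p\<close> with \<open>M\<close>, embedded by \<open>e\<close>. If the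
elements of \<open>\<rho>\<close> are themselves functions \<open>T v\<close> on \<open>M\<close>, an element \<open>f\<close> of the representation induced from
\<open>Q\<close> is a function of two variables, and equivariance under \<open>e\<close> makes the first variable redundant:
\<open>T (f g) y = T (f (e(y) g)) 1\<close>. Hence evaluation of \<open>T (f g)\<close> at \<open>1\<close> is the equivalence, with the inverse
read off from this formula.\<close>

lemma induction_in_stages:
  fixes G :: "('g, 'm) monoid_scheme" and M :: "('h, 'n) monoid_scheme" and \<rho> :: "('h, 'v) repr"
    and \<chi> :: "'g \<Rightarrow> complex" and \<phi> :: "'h \<Rightarrow> complex"
  assumes G: "group G" and M: "group M" and Q: "subgroup Q G"
    and p: "\<And>q q'. q \<in> Q \<Longrightarrow> q' \<in> Q \<Longrightarrow> p (q \<otimes>\<^bsub>G\<^esub> q') = p q \<otimes>\<^bsub>M\<^esub> p q'"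
           "\<And>q. q \<in> Q \<Longrightarrow> p q \<in> carrier M"
    and e: "\<And>m m'. m \<in> carrier M \<Longrightarrow> m' \<in> carrier M \<Longrightarrow> e (m \<otimes>\<^bsub>M\<^esub> m') = e m \<otimes>\<^bsub>G\<^esub> e m'"
           "\<And>m. m \<in> carrier M \<Longrightarrow> e m \<in> Q" "\<And>m. m \<in> carrier M \<Longrightarrow> p (e m) = m"
    and \<chi>: "\<And>q q'. q \<in> Q \<Longrightarrow> q' \<in> Q \<Longrightarrow> \<chi> (q \<otimes>\<^bsub>G\<^esub> q') = \<chi> q * \<chi> q'"
           "\<And>m. m \<in> carrier M \<Longrightarrow> \<chi> (e m) = 1"
    and J: "J \<subseteq> carrier M" "\<one>\<^bsub>M\<^esub> \<in> J" "\<phi> \<one>\<^bsub>M\<^esub> = 1"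
    and \<sigma>: "rep_space \<sigma> = rep_space \<rho>"
           "\<And>q v. q \<in> Q \<Longrightarrow> v \<in> carrier (rep_space \<rho>) \<Longrightarrow>
              rep_act \<sigma> q v = \<chi> q \<odot>\<^bsub>rep_space \<rho>\<^esub> rep_act \<rho> (p q) v"
    and \<rho>: "equivalent_reps M \<rho> (induced_rep M J (character_rep \<phi>))" "rep_closed M \<rho>"
  shows "equivalent_reps G (induced_rep G Q \<sigma>)
     (induced_rep G {q \<in> Q. p q \<in> J} (character_rep (\<lambda>q. \<chi> q * \<phi> (p q))))"
    (is "equivalent_reps G ?X ?Y")
proof -
  interpret G: group G by fact
  interpret M: group M by fact
  interpret Q: subgroup Q G by fact
  let ?V = "carrier (rep_space \<rho>)"
  let ?I = "{f \<in> carrier M \<rightarrow>\<^sub>E UNIV. \<forall>h\<in>J. \<forall>g\<in>carrier M. f (h \<otimes>\<^bsub>M\<^esub> g) = \<phi> h * f g}"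
  obtain T where "is_equivalence M \<rho> (induced_rep M J (character_rep \<phi>)) T"
    using \<rho>(1) unfolding equivalent_reps_iff ..
  note T0 = is_equivalenceD[OF this]
  have T: "bij_betw T ?V ?I"
    "\<And>c v. v \<in> ?V \<Longrightarrow> T (c \<odot>\<^bsub>rep_space \<rho>\<^esub> v) = (\<lambda>x\<in>carrier M. c * T v x)"
    "\<And>u v. u \<in> ?V \<Longrightarrow> v \<in> ?V \<Longrightarrow> T (u \<oplus>\<^bsub>rep_space \<rho>\<^esub> v) = (\<lambda>x\<in>carrier M. T u x + T v x)"
    "\<And>g v. g \<in> carrier M \<Longrightarrow> v \<in> ?V \<Longrightarrow> T (rep_act \<rho> g v) = (\<lambda>x\<in>carrier M. T v (x \<otimes>\<^bsub>M\<^esub> g))"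
    using T0 by (simp_all add: induced_rep_character_simps)
  define U where "U = inv_into ?V T"
  have TV: "T v \<in> ?I" if "v \<in> ?V" for v by (rule bij_betw_apply[OF T(1) that])
  have UV: "U f \<in> ?V" if "f \<in> ?I" for f
    unfolding U_def by (rule bij_betw_apply[OF bij_betw_inv_into[OF T(1)] that])
  have TU: "T (U f) = f" if "f \<in> ?I" for f
    unfolding U_def using bij_betw_inv_into_right[OF T(1) that] .
  have UT: "U (T v) = v" if "v \<in> ?V" for v
    unfolding U_def using bij_betw_inv_into_left[OF T(1) that] .
  have Tinj: "u = v" if "u \<in> ?V" "v \<in> ?V" "T u = T v" for u v
    using UT that by metis
  have cl: "c \<odot>\<^bsub>rep_space \<rho>\<^esub> v \<in> ?V" "m \<in> carrier M \<Longrightarrow> rep_act \<rho> m v \<in> ?V" if "v \<in> ?V" for c m v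
    using \<rho>(2) that unfolding rep_closed_def by auto
  have T\<sigma>: "T (rep_act \<sigma> q v) y = \<chi> q * T v (y \<otimes>\<^bsub>M\<^esub> p q)" if "q \<in> Q" "v \<in> ?V" "y \<in> carrier M" for q v y
    using that by (simp add: \<sigma> T cl p)
  have e1: "e \<one>\<^bsub>M\<^esub> = \<one>\<^bsub>G\<^esub>"
  proof -
    have c: "e \<one>\<^bsub>M\<^esub> \<in> carrier G" using e(2)[of "\<one>\<^bsub>M\<^esub>"] by simp
    have "e \<one>\<^bsub>M\<^esub> \<otimes>\<^bsub>G\<^esub> e \<one>\<^bsub>M\<^esub> = e \<one>\<^bsub>M\<^esub>" using e(1)[of "\<one>\<^bsub>M\<^esub>" "\<one>\<^bsub>M\<^esub>"] by simp
    then show ?thesis using G.r_cancel_one[OF c c] by simp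
  qed
  have carX: "carrier (rep_space ?X) =
      {f \<in> carrier G \<rightarrow>\<^sub>E ?V. \<forall>h\<in>Q. \<forall>g\<in>carrier G. f (h \<otimes>\<^bsub>G\<^esub> g) = rep_act \<sigma> h (f g)}"
    by (simp add: induced_rep_def \<sigma>)
  let ?A = "\<lambda>f. \<lambda>g\<in>carrier G. T (f g) \<one>\<^bsub>M\<^esub>"
  let ?F = "\<lambda>W g. \<lambda>y\<in>carrier M. W (e y \<otimes>\<^bsub>G\<^esub> g)"
  let ?B = "\<lambda>W. \<lambda>g\<in>carrier G. U (?F W g)"
  have TA: "T (f g) = ?F (?A f) g" if f: "f \<in> carrier (rep_space ?X)" and g: "g \<in> carrier G" for f g
  proof
    fix y show "T (f g) y = ?F (?A f) g y"
    proof (cases "y \<in> carrier M")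
      case True
      have "f (e y \<otimes>\<^bsub>G\<^esub> g) = rep_act \<sigma> (e y) (f g)" "f g \<in> ?V"
        using f g e(2)[OF True] unfolding carX by auto
      then show ?thesis using T\<sigma>[of "e y" "f g" "\<one>\<^bsub>M\<^esub>"] True g by (simp add: e \<chi>)
    next
      case False
      have "f g \<in> ?V" using f g unfolding carX by auto
      then show ?thesis using TV[of "f g"] False by (auto simp: PiE_iff extensional_def)
    qed
  qed
  have FI: "?F W g \<in> ?I" if W: "W \<in> carrier (rep_space ?Y)" and g: "g \<in> carrier G" for W g
  proof -
    have "W (e (h \<otimes>\<^bsub>M\<^esub> y) \<otimes>\<^bsub>G\<^esub> g) = \<phi> h * W (e y \<otimes>\<^bsub>G\<^esub> g)" if "h \<in> J" "y \<in> carrier M" for h y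
    proof -
      have h: "h \<in> carrier M" using that J by auto
      have "W (e h \<otimes>\<^bsub>G\<^esub> (e y \<otimes>\<^bsub>G\<^esub> g)) = \<chi> (e h) * \<phi> (p (e h)) * W (e y \<otimes>\<^bsub>G\<^esub> g)"
        using W h that g by (simp add: induced_rep_character_simps e)
      then show ?thesis using h that g by (simp add: e \<chi> G.m_assoc)
    qed
    then show ?thesis using J by (auto simp: subset_iff)
  qed
  show ?thesis
  proof (rule equivalent_repsI[where T = ?A])
    show "bij_betw ?A (carrier (rep_space ?X)) (carrier (rep_space ?Y))"
    proof (rule bij_betw_byWitness[where f' = ?B])
      show "\<forall>f\<in>carrier (rep_space ?X). ?B (?A f) = f"
      proof (intro ballI ext)
        fix f g assume f: "f \<in> carrier (rep_space ?X)"
        show "?B (?A f) g = f g"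
          using TA[OF f, symmetric] UT f by (auto simp: carX PiE_iff extensional_def)
      qed
      show "\<forall>W\<in>carrier (rep_space ?Y). ?A (?B W) = W"
      proof (intro ballI ext)
        fix W g assume W: "W \<in> carrier (rep_space ?Y)"
        show "?A (?B W) g = W g"
        proof (cases "g \<in> carrier G")
          case True
          then show ?thesis using TU[OF FI[OF W True]] by (simp add: e1)
        next
          case False
          then show ?thesis using W by (auto simp: induced_rep_character_simps PiE_iff extensional_def)
        qed
      qed
      show "?A ` carrier (rep_space ?X) \<subseteq> carrier (rep_space ?Y)"
      proof (rule image_subsetI)
        fix f assume f: "f \<in> carrier (rep_space ?X)"
        have "T (f (q \<otimes>\<^bsub>G\<^esub> g)) \<one>\<^bsub>M\<^esub> = \<chi> q * \<phi> (p q) * T (f g) \<one>\<^bsub>M\<^esub>"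
          if q: "q \<in> Q" "p q \<in> J" and g: "g \<in> carrier G" for q g
        proof -
          have v: "f g \<in> ?V" using f g by (auto simp: carX)
          have "T (f g) (p q \<otimes>\<^bsub>M\<^esub> \<one>\<^bsub>M\<^esub>) = \<phi> (p q) * T (f g) \<one>\<^bsub>M\<^esub>"
            using TV[OF v] q by simp
          then show ?thesis
            using f q g v T\<sigma>[OF q(1) v, of "\<one>\<^bsub>M\<^esub>"] p(2)[OF q(1)] by (simp add: carX)
        qed
        then show "?A f \<in> carrier (rep_space ?Y)"
          by (simp add: induced_rep_character_simps)
      qed
      show "?B ` carrier (rep_space ?Y) \<subseteq> carrier (rep_space ?X)"
      proof (rule image_subsetI)
        fix W assume W: "W \<in> carrier (rep_space ?Y)"
        have "U (?F W (q \<otimes>\<^bsub>G\<^esub> g)) = rep_act \<sigma> q (U (?F W g))"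
          if q: "q \<in> Q" and g: "g \<in> carrier G" for q g
        proof (rule Tinj)
          have qg: "q \<otimes>\<^bsub>G\<^esub> g \<in> carrier G" using q g by simp
          have v: "U (?F W g) \<in> ?V" using UV[OF FI[OF W g]] .
          show "U (?F W (q \<otimes>\<^bsub>G\<^esub> g)) \<in> ?V" using UV[OF FI[OF W qg]] .
          show sv: "rep_act \<sigma> q (U (?F W g)) \<in> ?V" using v q by (simp add: \<sigma> cl p)
          show "T (U (?F W (q \<otimes>\<^bsub>G\<^esub> g))) = T (rep_act \<sigma> q (U (?F W g)))"
          proof
            fix y show "T (U (?F W (q \<otimes>\<^bsub>G\<^esub> g))) y = T (rep_act \<sigma> q (U (?F W g))) y"
            proof (cases "y \<in> carrier M")
              case False
              then show ?thesis using TV[OF sv] TU[OF FI[OF W qg]] by (simp add: PiE_iff extensional_def)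
            next
              case y: True
              define z where "z = y \<otimes>\<^bsub>M\<^esub> p q"
              have z: "z \<in> carrier M" using y p(2)[OF q] by (simp add: z_def)
              \<comment> \<open>The elements \<open>e y q\<close> and \<open>e z\<close> agree up to this element of the kernel of \<open>p\<close>.\<close>
              define l where "l = e y \<otimes>\<^bsub>G\<^esub> q \<otimes>\<^bsub>G\<^esub> inv\<^bsub>G\<^esub> (e z)"
              have l: "l \<in> Q" using y z q e by (simp add: l_def)
              have lz: "l \<otimes>\<^bsub>G\<^esub> e z = e y \<otimes>\<^bsub>G\<^esub> q"
                using y z q e by (simp add: l_def G.m_assoc)
              have "p l \<otimes>\<^bsub>M\<^esub> z = z"
                using p(1)[OF l e(2)[OF z]] p(1)[OF e(2)[OF y] q] lz by (simp add: e y z) (simp add: z_def)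
              then have pl: "p l = \<one>\<^bsub>M\<^esub>" using z p(2)[OF l] by simp
              have "\<chi> l = \<chi> q"
                using \<chi>(1)[OF l e(2)[OF z]] \<chi>(1)[OF e(2)[OF y] q] lz by (simp add: \<chi>(2) y z)
              moreover have "W (l \<otimes>\<^bsub>G\<^esub> (e z \<otimes>\<^bsub>G\<^esub> g)) = \<chi> l * \<phi> (p l) * W (e z \<otimes>\<^bsub>G\<^esub> g)"
                using W l pl J e(2)[OF z] g by (simp add: induced_rep_character_simps)
              moreover have "l \<otimes>\<^bsub>G\<^esub> (e z \<otimes>\<^bsub>G\<^esub> g) = e y \<otimes>\<^bsub>G\<^esub> (q \<otimes>\<^bsub>G\<^esub> g)"
                using lz l e(2)[OF z] e(2)[OF y] q g by (simp add: G.m_assoc[symmetric])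
              ultimately have "W (e y \<otimes>\<^bsub>G\<^esub> (q \<otimes>\<^bsub>G\<^esub> g)) = \<chi> q * W (e z \<otimes>\<^bsub>G\<^esub> g)"
                using pl J by simp
              then show ?thesis
                using T\<sigma>[OF q v y] y z by (simp add: TU[OF FI[OF W g]] TU[OF FI[OF W qg]] z_def[symmetric])
            qed
          qed
        qed
        then show "?B W \<in> carrier (rep_space ?X)"
          using UV[OF FI[OF W]] by (auto simp: carX)
      qed
    qed
  qed (auto simp: carX induced_rep_character_simps, auto simp: induced_rep_def \<sigma> T PiE_iff fun_eq_iff)
qed

text \<open>Functions supported on a single coset \<open>H x\<close> supply vectors of an induced representation with
prescribed values.\<close>

lemma (in group) induced_rep_delta:
  assumes H: "subgroup H G" and x: "x \<in> carrier G"
    and v: "v \<in> carrier (rep_space \<sigma>)"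
    and act: "\<And>h w. h \<in> H \<Longrightarrow> w \<in> carrier (rep_space \<sigma>) \<Longrightarrow> rep_act \<sigma> h w \<in> carrier (rep_space \<sigma>)"
      "\<And>h k w. h \<in> H \<Longrightarrow> k \<in> H \<Longrightarrow> w \<in> carrier (rep_space \<sigma>) \<Longrightarrow>
         rep_act \<sigma> (h \<otimes> k) w = rep_act \<sigma> h (rep_act \<sigma> k w)"
    and zero: "z \<in> carrier (rep_space \<sigma>)" "\<And>h. h \<in> H \<Longrightarrow> rep_act \<sigma> h z = z"
  shows "(\<lambda>g\<in>carrier G. if g \<otimes> inv x \<in> H then rep_act \<sigma> (g \<otimes> inv x) v else z)
    \<in> carrier (rep_space (induced_rep G H \<sigma>))"
proof -
  interpret H: subgroup H G by fact
  have "h \<otimes> g \<otimes> inv x \<in> H \<longleftrightarrow> g \<otimes> inv x \<in> H" if "h \<in> H" "g \<in> carrier G" for h g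
  proof
    assume "h \<otimes> g \<otimes> inv x \<in> H"
    then have "inv h \<otimes> (h \<otimes> g \<otimes> inv x) \<in> H" using that by simp
    then show "g \<otimes> inv x \<in> H" using that x by (simp add: m_assoc[symmetric])
  qed (use that x in \<open>simp add: m_assoc\<close>)
  moreover have "rep_act \<sigma> (h \<otimes> g \<otimes> inv x) v = rep_act \<sigma> h (rep_act \<sigma> (g \<otimes> inv x) v)"
    if "h \<in> H" "g \<in> carrier G" "g \<otimes> inv x \<in> H" for h g
    using act(2)[of h "g \<otimes> inv x" v] that x v by (simp add: m_assoc)
  ultimately show ?thesis
    using act v zero by (auto simp: induced_rep_def)
qed

text \<open>Mackey's description of the functions on \<open>L \ G / N\<close> with prescribed characters, as a
representation of a group \<open>H\<close> that normalizes \<open>N\<close>. On the double coset \<open>L \<gamma> H N\<close> such a function is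
determined by \<open>w(h) = W(\<gamma> h)\<close>. An identity \<open>l x = x n\<close> with \<open>\<alpha> l \<noteq> \<psi> n\<close> forces \<open>W x = 0\<close>. As
the conditions on \<open>W\<close> are stable under right translation by \<open>H\<close>, it suffices to know one of the two
alternatives for representatives \<open>x\<close> of \<open>L \ G / H N\<close>, and the hypothesis \<open>support\<close> gives
injectivity. Conversely \<open>W(l \<gamma> h n) = \<alpha>(l) \<psi>(n) w(h)\<close> is well defined because the ambiguity of
\<open>(l, h, n)\<close> is measured by solutions of \<open>l \<gamma> = \<gamma> s n\<close>, to which the hypothesis \<open>stabilizer\<close> applies.\<close>

lemma (in group) mackey_single_double_coset:
  fixes H :: "('h, 'n) monoid_scheme" and \<delta> :: "'h \<Rightarrow> 'a" and \<alpha> \<psi> :: "'a \<Rightarrow> complex"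
  assumes H: "group H" and L: "subgroup L G" and N: "subgroup N G" and \<gamma>: "\<gamma> \<in> carrier G"
    and \<delta>: "\<delta> \<in> hom H G"
    and norm: "\<And>h n. h \<in> carrier H \<Longrightarrow> n \<in> N \<Longrightarrow>
        \<delta> h \<otimes> n \<otimes> inv (\<delta> h) \<in> N \<and> \<psi> (\<delta> h \<otimes> n \<otimes> inv (\<delta> h)) = \<psi> n"
    and \<alpha>: "\<And>l l'. l \<in> L \<Longrightarrow> l' \<in> L \<Longrightarrow> \<alpha> (l \<otimes> l') = \<alpha> l * \<alpha> l'" "\<alpha> \<one> = 1"
    and \<psi>: "\<And>n n'. n \<in> N \<Longrightarrow> n' \<in> N \<Longrightarrow> \<psi> (n \<otimes> n') = \<psi> n * \<psi> n'" "\<psi> \<one> = 1"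
    and S: "\<And>s. s \<in> S \<Longrightarrow> s \<in> carrier H \<and> (\<exists>l\<in>L. l \<otimes> \<gamma> = \<gamma> \<otimes> \<delta> s \<and> \<alpha> l = \<theta> s)"
    and stabilizer: "\<And>l s n. l \<in> L \<Longrightarrow> s \<in> carrier H \<Longrightarrow> n \<in> N \<Longrightarrow> l \<otimes> \<gamma> = \<gamma> \<otimes> \<delta> s \<otimes> n \<Longrightarrow>
        s \<in> S \<and> \<alpha> l = \<theta> s * \<psi> n"
    and support: "\<And>g. g \<in> carrier G \<Longrightarrow> \<exists>l\<in>L. \<exists>x\<in>carrier G. \<exists>h\<in>carrier H. \<exists>n\<in>N. g = l \<otimes> x \<otimes> \<delta> h \<otimes> n \<and>
        ((\<exists>l\<in>L. \<exists>h\<in>carrier H. \<exists>n\<in>N. x = l \<otimes> \<gamma> \<otimes> \<delta> h \<otimes> n) \<or>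
         (\<exists>l\<in>L. \<exists>n\<in>N. l \<otimes> x = x \<otimes> n \<and> \<alpha> l \<noteq> \<psi> n))"
  shows "bij_betw (\<lambda>W. \<lambda>h\<in>carrier H. W (\<gamma> \<otimes> \<delta> h))
    {W \<in> carrier G \<rightarrow>\<^sub>E UNIV. (\<forall>l\<in>L. \<forall>g\<in>carrier G. W (l \<otimes> g) = \<alpha> l * W g) \<and>
        (\<forall>g\<in>carrier G. \<forall>n\<in>N. W (g \<otimes> n) = \<psi> n * W g)}
    {w \<in> carrier H \<rightarrow>\<^sub>E UNIV. \<forall>s\<in>S. \<forall>h\<in>carrier H. w (s \<otimes>\<^bsub>H\<^esub> h) = \<theta> s * w h}"
    (is "bij_betw ?E ?A ?B")
proof -
  interpret H: group H by fact
  interpret \<delta>: group_hom H G \<delta> using \<delta> by unfold_locales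
  have Lc: "l \<in> carrier G" if "l \<in> L" for l using subgroup.mem_carrier[OF L that] .
  have Nc: "n \<in> carrier G" if "n \<in> N" for n using subgroup.mem_carrier[OF N that] .
  note closed = Lc Nc \<gamma> subgroup.m_closed[OF L] subgroup.m_closed[OF N]
    subgroup.m_inv_closed[OF L] subgroup.m_inv_closed[OF N] subgroup.one_closed[OF L] subgroup.one_closed[OF N]
  have factor: "V (l \<otimes> x \<otimes> \<delta> h \<otimes> n) = \<alpha> l * \<psi> n * V (x \<otimes> \<delta> h)"
    if "V \<in> ?A" "l \<in> L" "x \<in> carrier G" "h \<in> carrier H" "n \<in> N" for V l x h n
  proof -
    have c: "x \<otimes> \<delta> h \<in> carrier G" using that by simp
    have "V (l \<otimes> x \<otimes> \<delta> h \<otimes> n) = V (l \<otimes> (x \<otimes> \<delta> h) \<otimes> n)" using that closed by (simp add: m_assoc)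
    also have "\<dots> = \<psi> n * (\<alpha> l * V (x \<otimes> \<delta> h))" using that closed c by simp
    finally show ?thesis by simp
  qed
  have translate: "(\<lambda>g\<in>carrier G. V (g \<otimes> \<delta> h)) \<in> ?A" if V: "V \<in> ?A" and h: "h \<in> carrier H" for V h
  proof -
    have "V (g \<otimes> n \<otimes> \<delta> h) = \<psi> n * V (g \<otimes> \<delta> h)" if g: "g \<in> carrier G" and n: "n \<in> N" for g n
    proof -
      define m where "m = inv (\<delta> h) \<otimes> n \<otimes> \<delta> h"
      have m: "m \<in> N" "\<psi> m = \<psi> n" using norm[of "inv\<^bsub>H\<^esub> h" n] h n by (simp_all add: m_def)
      have "\<delta> h \<otimes> (inv (\<delta> h) \<otimes> y) = y" if "y \<in> carrier G" for y
        using that h by (simp add: m_assoc[symmetric])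
      then have "g \<otimes> n \<otimes> \<delta> h = g \<otimes> \<delta> h \<otimes> m"
        using g h n closed by (simp add: m_def m_assoc)
      then show ?thesis using V g h m by simp
    qed
    moreover have "V (l \<otimes> g \<otimes> \<delta> h) = \<alpha> l * V (g \<otimes> \<delta> h)" if "l \<in> L" "g \<in> carrier G" for l g
      using V that h closed by (simp add: m_assoc)
    ultimately show ?thesis using closed by simp
  qed
  have agree: "V x = V' x"
    if V: "V \<in> ?A" "V' \<in> ?A" "\<And>h. h \<in> carrier H \<Longrightarrow> V (\<gamma> \<otimes> \<delta> h) = V' (\<gamma> \<otimes> \<delta> h)" and x: "x \<in> carrier G"
      and sup: "(\<exists>l\<in>L. \<exists>h\<in>carrier H. \<exists>n\<in>N. x = l \<otimes> \<gamma> \<otimes> \<delta> h \<otimes> n) \<or>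
         (\<exists>l\<in>L. \<exists>n\<in>N. l \<otimes> x = x \<otimes> n \<and> \<alpha> l \<noteq> \<psi> n)" for V V' x
    using sup
  proof (elim disjE bexE conjE)
    fix l h n assume *: "l \<in> L" "h \<in> carrier H" "n \<in> N" "x = l \<otimes> \<gamma> \<otimes> \<delta> h \<otimes> n"
    show ?thesis
      unfolding *(4) factor[OF V(1) *(1) \<gamma> *(2,3)] factor[OF V(2) *(1) \<gamma> *(2,3)] V(3)[OF *(2)] ..
  next
    fix l n assume *: "l \<in> L" "n \<in> N" "l \<otimes> x = x \<otimes> n" "\<alpha> l \<noteq> \<psi> n"
    have zero: "U x = 0" if "U \<in> ?A" for U
    proof -
      have "\<alpha> l * U x = U (l \<otimes> x)" using that *(1) x by simp
      also have "\<dots> = \<psi> n * U x" unfolding *(3) using that *(2) x by simp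
      finally show ?thesis using *(4) by simp
    qed
    show ?thesis using zero[OF V(1)] zero[OF V(2)] by simp
  qed
  have inj: "inj_on ?E ?A"
  proof (rule inj_onI)
    fix W W' assume W: "W \<in> ?A" and W': "W' \<in> ?A" and eq: "?E W = ?E W'"
    have eq': "W (\<gamma> \<otimes> \<delta> h) = W' (\<gamma> \<otimes> \<delta> h)" if "h \<in> carrier H" for h
      using fun_cong[OF eq, of h] that by simp
    have "W g = W' g" if g: "g \<in> carrier G" for g
    proof -
      obtain l x h n where *: "l \<in> L" "x \<in> carrier G" "h \<in> carrier H" "n \<in> N" "g = l \<otimes> x \<otimes> \<delta> h \<otimes> n"
        and sup: "(\<exists>l\<in>L. \<exists>h\<in>carrier H. \<exists>n\<in>N. x = l \<otimes> \<gamma> \<otimes> \<delta> h \<otimes> n) \<or>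
          (\<exists>l\<in>L. \<exists>n\<in>N. l \<otimes> x = x \<otimes> n \<and> \<alpha> l \<noteq> \<psi> n)"
        using support[OF g] by blast
      have "W (\<gamma> \<otimes> \<delta> k \<otimes> \<delta> h) = W' (\<gamma> \<otimes> \<delta> k \<otimes> \<delta> h)" if "k \<in> carrier H" for k
        using eq'[of "k \<otimes>\<^bsub>H\<^esub> h"] that *(3) closed by (simp add: m_assoc)
      then have "W (x \<otimes> \<delta> h) = W' (x \<otimes> \<delta> h)"
        using agree[OF translate[OF W *(3)] translate[OF W' *(3)] _ *(2) sup] *(2,3) \<gamma> by simp
      then show ?thesis unfolding *(5) factor[OF W *(1-4)] factor[OF W' *(1-4)] by simp
    qed
    then show "W = W'" using W W' by (auto intro: PiE_ext)
  qed
  have E: "?E W \<in> ?B" if W: "W \<in> ?A" for W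
  proof -
    have "W (\<gamma> \<otimes> \<delta> (s \<otimes>\<^bsub>H\<^esub> h)) = \<theta> s * W (\<gamma> \<otimes> \<delta> h)" if s: "s \<in> S" and h: "h \<in> carrier H" for s h
    proof -
      obtain l where l: "l \<in> L" "l \<otimes> \<gamma> = \<gamma> \<otimes> \<delta> s" "\<alpha> l = \<theta> s" and sc: "s \<in> carrier H" using S[OF s] by auto
      have "\<gamma> \<otimes> \<delta> (s \<otimes>\<^bsub>H\<^esub> h) = l \<otimes> (\<gamma> \<otimes> \<delta> h)"
        using l sc h closed by (simp add: m_assoc[symmetric])
      then show ?thesis using W l closed h by simp
    qed
    moreover have "s \<otimes>\<^bsub>H\<^esub> h \<in> carrier H" if "s \<in> S" "h \<in> carrier H" for s h
      using S that by auto
    ultimately show ?thesis by simp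
  qed
  have surj: "w \<in> ?E ` ?A" if w: "w \<in> ?B" for w
  proof -
    define R where "R g c \<longleftrightarrow> (\<exists>l\<in>L. \<exists>h\<in>carrier H. \<exists>n\<in>N. g = l \<otimes> \<gamma> \<otimes> \<delta> h \<otimes> n \<and> c = \<alpha> l * \<psi> n * w h)" for g c
    have uniq: "c = c'" if "R g c" "R g c'" for g c c'
    proof -
      obtain l1 h1 n1 where 1: "l1 \<in> L" "h1 \<in> carrier H" "n1 \<in> N" "g = l1 \<otimes> \<gamma> \<otimes> \<delta> h1 \<otimes> n1" "c = \<alpha> l1 * \<psi> n1 * w h1"
        using \<open>R g c\<close> unfolding R_def by auto
      obtain l2 h2 n2 where 2: "l2 \<in> L" "h2 \<in> carrier H" "n2 \<in> N" "g = l2 \<otimes> \<gamma> \<otimes> \<delta> h2 \<otimes> n2" "c' = \<alpha> l2 * \<psi> n2 * w h2"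
        using \<open>R g c'\<close> unfolding R_def by auto
      define k where "k = inv l2 \<otimes> l1"
      define s where "s = h2 \<otimes>\<^bsub>H\<^esub> inv\<^bsub>H\<^esub> h1"
      define m where "m = n2 \<otimes> inv n1"
      define n where "n = \<delta> h1 \<otimes> m \<otimes> inv (\<delta> h1)"
      have k: "k \<in> L" and s: "s \<in> carrier H" and m: "m \<in> N" using 1 2 closed by (auto simp: k_def s_def m_def)
      have n: "n \<in> N" "\<psi> n = \<psi> m" using norm[OF 1(2) m] by (auto simp: n_def)
      have "l1 \<otimes> \<gamma> = l2 \<otimes> \<gamma> \<otimes> \<delta> h2 \<otimes> n2 \<otimes> inv n1 \<otimes> inv (\<delta> h1)"
        unfolding 2(4)[symmetric] 1(4) using 1 closed by (simp add: m_assoc)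
      then have "k \<otimes> \<gamma> = \<gamma> \<otimes> \<delta> h2 \<otimes> n2 \<otimes> inv n1 \<otimes> inv (\<delta> h1)"
        unfolding k_def using 1 2 closed by (simp add: m_assoc) (simp add: m_assoc[symmetric])
      also have "\<dots> = \<gamma> \<otimes> \<delta> s \<otimes> n"
        unfolding s_def n_def m_def using 1 2 closed by (simp add: m_assoc) (simp add: m_assoc[symmetric])
      finally have kB: "s \<in> S" "\<alpha> k = \<theta> s * \<psi> n" using stabilizer[OF k s n(1)] by auto
      have h2: "h2 = s \<otimes>\<^bsub>H\<^esub> h1" unfolding s_def using 1 2 by (simp add: H.m_assoc)
      have l1: "l1 = l2 \<otimes> k" unfolding k_def using 1 2 closed by (simp add: m_assoc[symmetric])
      have "\<psi> n2 = \<psi> m * \<psi> n1" unfolding m_def using 1 2 closed \<psi>(1)[symmetric] by (simp add: m_assoc)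
      moreover have "w h2 = \<theta> s * w h1" unfolding h2 using w kB 1 by simp
      moreover have "\<alpha> l1 = \<alpha> l2 * \<alpha> k" unfolding l1 using \<alpha>(1) 2 k by simp
      ultimately show ?thesis unfolding 1(5) 2(5) using kB n by simp
    qed
    have Rl: "R (l \<otimes> g) (\<alpha> l * c)" if g: "R g c" and l: "l \<in> L" for g c l
    proof -
      obtain l1 h1 n1 where 1: "l1 \<in> L" "h1 \<in> carrier H" "n1 \<in> N" "g = l1 \<otimes> \<gamma> \<otimes> \<delta> h1 \<otimes> n1" "c = \<alpha> l1 * \<psi> n1 * w h1"
        using g unfolding R_def by auto
      have "l \<otimes> g = (l \<otimes> l1) \<otimes> \<gamma> \<otimes> \<delta> h1 \<otimes> n1" using 1 l closed by (simp add: m_assoc)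
      then show ?thesis unfolding R_def using 1 l closed \<alpha> by (intro bexI[of _ "l \<otimes> l1"] bexI[of _ h1] bexI[of _ n1]) auto
    qed
    have Rn: "R (g \<otimes> n) (\<psi> n * c)" if g: "R g c" and n: "n \<in> N" for g c n
    proof -
      obtain l1 h1 n1 where 1: "l1 \<in> L" "h1 \<in> carrier H" "n1 \<in> N" "g = l1 \<otimes> \<gamma> \<otimes> \<delta> h1 \<otimes> n1" "c = \<alpha> l1 * \<psi> n1 * w h1"
        using g unfolding R_def by auto
      have "g \<otimes> n = l1 \<otimes> \<gamma> \<otimes> \<delta> h1 \<otimes> (n1 \<otimes> n)" using 1 n closed by (simp add: m_assoc)
      then show ?thesis unfolding R_def using 1 n closed \<psi> by (intro bexI[of _ "l1"] bexI[of _ h1] bexI[of _ "n1 \<otimes> n"]) auto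
    qed
    define W where "W = (\<lambda>g\<in>carrier G. if \<exists>c. R g c then THE c. R g c else 0)"
    have WR: "W g = c" if "R g c" "g \<in> carrier G" for g c
      using that uniq unfolding W_def by (auto intro!: the_equality)
    have W0: "W g = 0" if "\<And>c. \<not> R g c" "g \<in> carrier G" for g
      using that unfolding W_def by auto
    have "W (l \<otimes> g) = \<alpha> l * W g" if l: "l \<in> L" and g: "g \<in> carrier G" for l g
    proof (cases "\<exists>c. R g c")
      case True
      then show ?thesis using Rl[OF _ l] WR l g closed by auto
    next
      case False
      have "\<not> R (l \<otimes> g) c" for c
        using Rl[of "l \<otimes> g" c "inv l"] l g closed False by (auto simp: m_assoc[symmetric])
      then show ?thesis using False W0 l g closed by simp
    qed
    moreover have "W (g \<otimes> n) = \<psi> n * W g" if n: "n \<in> N" and g: "g \<in> carrier G" for n g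
    proof (cases "\<exists>c. R g c")
      case True
      then show ?thesis using Rn[OF _ n] WR n g closed by auto
    next
      case False
      have "\<not> R (g \<otimes> n) c" for c
        using Rn[of "g \<otimes> n" c "inv n"] n g closed False by (auto simp: m_assoc)
      then show ?thesis using False W0 n g closed by simp
    qed
    ultimately have "W \<in> ?A" by (simp add: W_def)
    moreover have "?E W = w"
    proof
      fix h show "?E W h = w h"
      proof (cases "h \<in> carrier H")
        case True
        have "R (\<gamma> \<otimes> \<delta> h) (w h)" unfolding R_def
          using True closed \<alpha>(2) \<psi>(2) by (intro bexI[of _ \<one>] bexI[of _ h]) auto
        then show ?thesis using True WR closed by simp
      next
        case False
        then show ?thesis using w by (auto simp: PiE_def extensional_def)
      qed
    qed
    ultimately show ?thesis by (metis (no_types, lifting) imageI)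
  qed
  show ?thesis
    by (rule bij_betw_imageI[OF inj]) (use E surj in blast)
qed

section \<open>Matrix groups\<close>

lemma carrier_GL:
  "M \<in> carrier (GL n) \<longleftrightarrow> M \<in> carrier_mat n n \<and> (\<exists>B\<in>carrier_mat n n. M * B = 1\<^sub>m n \<and> B * M = 1\<^sub>m n)"
  by (auto simp: GL_def units_of_def Units_def ring_mat_simps)

lemma mult_GL [simp]: "A \<otimes>\<^bsub>GL n\<^esub> B = A * B"
  by (simp add: GL_def units_of_def ring_mat_simps)

lemma one_GL [simp]: "\<one>\<^bsub>GL n\<^esub> = 1\<^sub>m n"
  by (simp add: GL_def units_of_def ring_mat_simps)

lemma group_GL: "group (GL n :: 'a::comm_ring_1 mat monoid)"
proof -
  interpret ring "ring_mat TYPE('a) n ()" by (rule ring_mat)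
  show ?thesis unfolding GL_def by (rule units_group)
qed

lemma inv_GL:
  assumes "M \<in> carrier_mat n n" "B \<in> carrier_mat n n" "M * B = 1\<^sub>m n" "B * M = 1\<^sub>m n"
  shows "M \<in> carrier (GL n)" "B \<in> carrier (GL n)" "inv\<^bsub>GL n\<^esub> M = B"
proof -
  interpret group "GL n :: 'a mat monoid" by (rule group_GL)
  show M: "M \<in> carrier (GL n)" and B: "B \<in> carrier (GL n)" using assms by (auto simp: carrier_GL)
  show "inv\<^bsub>GL n\<^esub> M = B" using inv_equality[of B M] M B assms by simp
qed

lemma GL_inverse:
  assumes "M \<in> carrier (GL n)"
  shows "M \<in> carrier_mat n n" "inv\<^bsub>GL n\<^esub> M \<in> carrier_mat n n"
    "M * inv\<^bsub>GL n\<^esub> M = 1\<^sub>m n" "inv\<^bsub>GL n\<^esub> M * M = 1\<^sub>m n"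
proof -
  interpret group "GL n :: 'a mat monoid" by (rule group_GL)
  show "M \<in> carrier_mat n n" using assms by (simp add: carrier_GL)
  show "inv\<^bsub>GL n\<^esub> M \<in> carrier_mat n n" using inv_closed[OF assms] by (simp add: carrier_GL)
  show "M * inv\<^bsub>GL n\<^esub> M = 1\<^sub>m n" "inv\<^bsub>GL n\<^esub> M * M = 1\<^sub>m n"
    using r_inv[OF assms] l_inv[OF assms] by simp_all
qed

lemma GL_cancel:
  assumes c: "c \<in> carrier (GL n)" and A: "A \<in> carrier_mat n n"
  shows "A * inv\<^bsub>GL n\<^esub> c * c = A" "A * c * inv\<^bsub>GL n\<^esub> c = A"
    "inv\<^bsub>GL n\<^esub> c * (c * A) = A" "c * (inv\<^bsub>GL n\<^esub> c * A) = A"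
proof -
  note c' = GL_inverse[OF c]
  show "A * inv\<^bsub>GL n\<^esub> c * c = A"
    unfolding assoc_mult_mat[OF A c'(2,1)] c'(4) by (rule right_mult_one_mat[OF A])
  show "A * c * inv\<^bsub>GL n\<^esub> c = A"
    unfolding assoc_mult_mat[OF A c'(1,2)] c'(3) by (rule right_mult_one_mat[OF A])
  show "inv\<^bsub>GL n\<^esub> c * (c * A) = A"
    unfolding assoc_mult_mat[OF c'(2,1) A, symmetric] c'(4) by (rule left_mult_one_mat[OF A])
  show "c * (inv\<^bsub>GL n\<^esub> c * A) = A"
    unfolding assoc_mult_mat[OF c'(1,2) A, symmetric] c'(3) by (rule left_mult_one_mat[OF A])
qed

lemma GL_det_unit:
  fixes M :: "'a::comm_ring_1 mat"
  assumes "M \<in> carrier_mat n n" "det M * u = 1"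
  shows "M \<in> carrier (GL n)"
proof (rule inv_GL(1)[of M n "u \<cdot>\<^sub>m adj_mat M"])
  note adj = adj_mat[OF assms(1)]
  have u: "u * det M = 1" using assms(2) by (simp add: mult.commute)
  show "M * (u \<cdot>\<^sub>m adj_mat M) = 1\<^sub>m n"
    using mult_smult_distrib[OF assms(1) adj(1)] adj(2) u by (auto intro!: eq_matI)
  show "u \<cdot>\<^sub>m adj_mat M * M = 1\<^sub>m n"
    using mult_smult_assoc_mat[OF adj(1) assms(1)] adj(3) u by (auto intro!: eq_matI)
qed (use assms adj_mat(1)[OF assms(1)] in auto)

lemma mat_trace_comm:
  fixes A B :: "'a::comm_semiring_0 mat"
  assumes "A \<in> carrier_mat n m" "B \<in> carrier_mat m n"
  shows "mat_trace (A * B) = mat_trace (B * A)"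
proof -
  have "mat_trace (A * B) = (\<Sum>i<n. \<Sum>j<m. A $$ (i, j) * B $$ (j, i))"
    using assms by (auto simp: mat_trace_def scalar_prod_def atLeast0LessThan intro!: sum.cong)
  also have "\<dots> = (\<Sum>j<m. \<Sum>i<n. B $$ (j, i) * A $$ (i, j))"
    by (subst sum.swap) (simp add: mult.commute)
  also have "\<dots> = mat_trace (B * A)"
    using assms by (auto simp: mat_trace_def scalar_prod_def atLeast0LessThan intro!: sum.cong)
  finally show ?thesis .
qed

lemma assoc_four_mat:
  assumes "A \<in> carrier_mat n n" "B \<in> carrier_mat n n" "C \<in> carrier_mat n n" "E \<in> carrier_mat n n"
  shows "A * (B * (C * E)) = A * B * C * (E :: 'b::comm_ring_1 mat)"
  using assms by (simp add: assoc_mult_mat[of _ n n _ n _ n] mult_carrier_mat[of _ n n _ n])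

lemma scalar_central:
  fixes x :: "'a::comm_ring_1"
  assumes "g \<in> carrier_mat n n"
  shows "x \<cdot>\<^sub>m 1\<^sub>m n * g = g * (x \<cdot>\<^sub>m 1\<^sub>m n)"
  using mult_smult_distrib[OF assms, of "1\<^sub>m n" n x] mult_smult_assoc_mat[OF _ assms, of "1\<^sub>m n" n x] assms by simp

section \<open>Additive characters of a finite field\<close>

lemma sum_nontrivial_character:
  fixes g :: "'k::ab_group_add \<Rightarrow> complex"
  assumes "finite (UNIV :: 'k set)" and "\<And>s t. g (s + t) = g s * g t" "g u \<noteq> 1"
  shows "(\<Sum>t\<in>UNIV. g t) = 0"
proof -
  have "(\<Sum>t\<in>UNIV. g t) = (\<Sum>t\<in>UNIV. g (u + t))"
    by (rule sum.reindex_bij_witness[of _ "\<lambda>t. u + t" "\<lambda>t. - u + t"]) auto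
  also have "\<dots> = g u * (\<Sum>t\<in>UNIV. g t)" by (simp add: assms sum_distrib_left)
  finally have "(1 - g u) * (\<Sum>t\<in>UNIV. g t) = 0" by (simp add: algebra_simps)
  then show ?thesis using assms(3) by simp
qed

text \<open>If \<open>f\<close> were different from all \<open>\<psi>(\<kappa> t)\<close>, it would be orthogonal to all of them. Summing these
relations over \<open>\<kappa>\<close> leaves only the term \<open>t = 0\<close>, which is the number of elements of the field.\<close>

lemma finite_field_character_duality:
  fixes f \<psi> :: "'k::field \<Rightarrow> complex"
  assumes fin: "finite (UNIV :: 'k set)"
    and f: "\<And>s t. f (s + t) = f s * f t" "f 0 = 1"
    and \<psi>: "\<And>s t. \<psi> (s + t) = \<psi> s * \<psi> t" "\<psi> 0 = 1" "\<psi> u \<noteq> 1"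
  shows "\<exists>\<kappa>. \<forall>t. f t = \<psi> (\<kappa> * t)"
proof (rule ccontr)
  assume "\<nexists>\<kappa>. \<forall>t. f t = \<psi> (\<kappa> * t)"
  then have ne: "\<exists>t. f t \<noteq> \<psi> (\<kappa> * t)" for \<kappa> by auto
  have \<psi>neg: "\<psi> (- s) * \<psi> s = 1" for s using \<psi>(1)[of "- s" s] \<psi>(2) by simp
  have "(\<Sum>t\<in>UNIV. f t * \<psi> (- (\<kappa> * t))) = 0" for \<kappa>
  proof -
    obtain t where "f t \<noteq> \<psi> (\<kappa> * t)" using ne by auto
    then have "f t * \<psi> (- (\<kappa> * t)) \<noteq> 1"
      using \<psi>neg[of "\<kappa> * t"] by (metis (no_types, lifting) mult.assoc mult.right_neutral mult_1)
    moreover have "f (s + t) * \<psi> (- (\<kappa> * (s + t))) = (f s * \<psi> (- (\<kappa> * s))) * (f t * \<psi> (- (\<kappa> * t)))" for s t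
      using f(1)[of s t] \<psi>(1)[of "- (\<kappa> * s)" "- (\<kappa> * t)"] by (simp add: algebra_simps)
    ultimately show ?thesis
      by (intro sum_nontrivial_character[OF fin]) auto
  qed
  then have "0 = (\<Sum>\<kappa>\<in>UNIV. \<Sum>t\<in>UNIV. f t * \<psi> (- (\<kappa> * t)))" by simp
  also have "\<dots> = (\<Sum>t\<in>UNIV. f t * (\<Sum>\<kappa>\<in>UNIV. \<psi> (- (\<kappa> * t))))"
    by (subst sum.swap) (simp add: sum_distrib_left)
  also have "\<dots> = (\<Sum>t\<in>(UNIV :: 'k set). if t = 0 then of_nat (card (UNIV :: 'k set)) else 0)"
  proof (rule sum.cong[OF refl])
    fix t :: 'k
    have "(\<Sum>\<kappa>\<in>UNIV. \<psi> (- (\<kappa> * t))) = 0" if "t \<noteq> 0"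
    proof (rule sum_nontrivial_character[OF fin])
      show "\<psi> (- ((\<kappa> + \<kappa>') * t)) = \<psi> (- (\<kappa> * t)) * \<psi> (- (\<kappa>' * t))" for \<kappa> \<kappa>'
        using \<psi>(1)[of "- (\<kappa> * t)" "- (\<kappa>' * t)"] by (simp add: algebra_simps)
      show "\<psi> (- ((- u / t) * t)) \<noteq> 1" using that \<psi>(3) by simp
    qed
    then show "f t * (\<Sum>\<kappa>\<in>UNIV. \<psi> (- (\<kappa> * t))) = (if t = 0 then of_nat (card (UNIV :: 'k set)) else 0)"
      using f(2) \<psi>(2) by simp
  qed
  also have "\<dots> = of_nat (card (UNIV :: 'k set))" using fin by simp
  finally show False using fin by simp
qed

section \<open>Rings of length two\<close>

text \<open>The properties of the ring of integers modulo the square of a uniformizer \<open>w\<close>, with its reduction \<open>r\<close> to the residue field that the argument uses: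
the ideal of \<open>w\<close> is the kernel of \<open>r\<close> and its own annihilator.\<close>

locale length_two_ring =
  fixes w :: "'a::comm_ring_1" and r :: "'a \<Rightarrow> 'k::field" and \<psi> :: "'a \<Rightarrow> complex"
  assumes r_hom: "comm_ring_hom r"
    and surj_r: "surj r"
    and kernel_r: "r x = 0 \<longleftrightarrow> w dvd x"
    and square_zero: "w * w = 0"
    and annihilator: "w * x = 0 \<Longrightarrow> r x = 0"
    and \<psi>_add: "\<psi> (x + y) = \<psi> x * \<psi> y"
    and \<psi>_zero: "\<psi> 0 = 1"
    and \<psi>_nontrivial: "\<exists>x. \<psi> (w * x) \<noteq> 1"
begin

sublocale r: comm_ring_hom r by (rule r_hom)

abbreviation red :: "'a mat \<Rightarrow> 'k mat" where "red \<equiv> map_mat r"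

lemma r_w_mult [simp]: "r (w * x) = 0"
  by (simp add: kernel_r)

lemma w_mult_eq_iff: "w * x = w * y \<longleftrightarrow> r x = r y"
proof
  assume "w * x = w * y"
  then show "r x = r y" using annihilator[of "x - y"] by (simp add: algebra_simps r.hom_minus)
next
  assume "r x = r y"
  then have "r (x - y) = 0" by (simp add: r.hom_minus)
  then obtain z where "x - y = w * z" unfolding kernel_r by auto
  then have "w * (x - y) = w * w * z" by (simp add: mult.assoc)
  then show "w * x = w * y" using square_zero by (simp add: algebra_simps)
qed

lemma r_eqE:
  assumes "r x = r y" obtains z where "x = y + w * z"
proof -
  have "r (x - y) = 0" using assms by (simp add: r.hom_minus)
  then obtain z where "x - y = w * z" unfolding kernel_r by auto
  then show ?thesis by (intro that[of z]) (simp add: algebra_simps)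
qed

lemma unit_iff: "(\<exists>y. x * y = 1) \<longleftrightarrow> r x \<noteq> 0"
proof
  assume "\<exists>y. x * y = 1"
  then show "r x \<noteq> 0" by (metis r.hom_mult r.hom_one mult_zero_left zero_neq_one)
next
  assume x: "r x \<noteq> 0"
  obtain y where "r y = inverse (r x)" using surj_r by (metis surjD)
  then have "r (x * y) = r 1" using x by (simp add: r.hom_mult)
  then obtain z where z: "x * y = 1 + w * z" by (rule r_eqE)
  have "(1 + w * z) * (1 - w * z) = 1 - w * w * (z * z)" by (simp add: algebra_simps)
  then have "x * (y * (1 - w * z)) = 1" by (simp only: mult.assoc[symmetric] z) (simp add: square_zero)
  then show "\<exists>y. x * y = 1" ..
qed

lemma lift: obtains x where "r x = t"
  using surj_r by (metis surjD)

lemma carrier_GL_iff: "M \<in> carrier (GL n) \<longleftrightarrow> M \<in> carrier_mat n n \<and> det (red M) \<noteq> 0"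
proof
  assume "M \<in> carrier (GL n)"
  then obtain B where *: "M \<in> carrier_mat n n" "B \<in> carrier_mat n n" "M * B = 1\<^sub>m n"
    by (auto simp: carrier_GL)
  then have "det M * det B = 1" using det_mult[of M n B] by simp
  then show "M \<in> carrier_mat n n \<and> det (red M) \<noteq> 0" using unit_iff[of "det M"] * by (auto simp: r.hom_det)
next
  assume *: "M \<in> carrier_mat n n \<and> det (red M) \<noteq> 0"
  then obtain u where "det M * u = 1" using unit_iff[of "det M"] by (auto simp: r.hom_det)
  then show "M \<in> carrier (GL n)" using * GL_det_unit by blast
qed

lemma lift_mat: 
  assumes "M \<in> carrier_mat n m" obtains M' where "M' \<in> carrier_mat n m" "red M' = M"
proof
  show "mat n m (\<lambda>ij. SOME x. r x = M $$ ij) \<in> carrier_mat n m" by simp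
  have "r (SOME x. r x = t) = t" for t by (rule someI_ex) (metis lift)
  then show "red (mat n m (\<lambda>ij. SOME x. r x = M $$ ij)) = M" using assms by (intro eq_matI) auto
qed

definition \<psi>\<^sub>k :: "'k \<Rightarrow> complex" where "\<psi>\<^sub>k = residue_character w r \<psi>"

lemma \<psi>\<^sub>k_r: "\<psi>\<^sub>k (r x) = \<psi> (w * x)"
proof -
  have "r (SOME y. r y = r x) = r x" by (rule someI[of _ x]) simp
  then show ?thesis by (simp add: \<psi>\<^sub>k_def residue_character_def w_mult_eq_iff[symmetric])
qed

lemma \<psi>\<^sub>k_add: "\<psi>\<^sub>k (s + t) = \<psi>\<^sub>k s * \<psi>\<^sub>k t"
proof -
  obtain x y where "r x = s" "r y = t" using lift by metis
  then show ?thesis using \<psi>\<^sub>k_r[of "x + y"] by (auto simp: \<psi>\<^sub>k_r r.hom_add \<psi>_add distrib_left)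
qed

lemma \<psi>\<^sub>k_zero [simp]: "\<psi>\<^sub>k 0 = 1"
  using \<psi>\<^sub>k_r[of 0] \<psi>_zero by simp

lemma \<psi>\<^sub>k_nondegenerate:
  assumes "\<And>t. \<psi>\<^sub>k (a * t) = \<psi>\<^sub>k (b * t)"
  shows "a = b"
proof (rule ccontr)
  assume "a \<noteq> b"
  have "\<psi>\<^sub>k t = 1" for t
  proof -
    have "\<psi>\<^sub>k (a * s) = \<psi>\<^sub>k ((a - b) * s) * \<psi>\<^sub>k (b * s)" for s
      using \<psi>\<^sub>k_add[of "(a - b) * s" "b * s"] by (simp add: algebra_simps)
    moreover have "\<psi>\<^sub>k s \<noteq> 0" for s using \<psi>\<^sub>k_add[of s "- s"] by auto
    ultimately have "\<psi>\<^sub>k ((a - b) * s) = 1" for s using assms by (metis mult_cancel_right1)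
    from this[of "t / (a - b)"] show ?thesis using \<open>a \<noteq> b\<close> by simp
  qed
  then show False using \<psi>_nontrivial \<psi>\<^sub>k_r by metis
qed

lemma units_character_duality:
  assumes "finite (UNIV :: 'k set)" "linear_character (units_of class_ring) \<chi>"
  shows "\<exists>\<kappa>. \<forall>x. \<chi> (1 + w * x) = \<psi>\<^sub>k (\<kappa> * r x)"
proof -
  have unit: "1 + w * x \<in> carrier (units_of class_ring)" for x
  proof -
    have "(1 + w * x) * (1 - w * x) = 1 - w * w * (x * x)" by (simp add: algebra_simps)
    then have "(1 + w * x) * (1 - w * x) = 1" by (simp add: square_zero)
    then show ?thesis unfolding units_of_def Units_def by (auto simp: mult.commute)
  qed
  have \<chi>_mult: "\<chi> (a * b) = \<chi> a * \<chi> b" and \<chi>_nz: "\<chi> a \<noteq> 0"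
    if "a \<in> carrier (units_of class_ring)" "b \<in> carrier (units_of class_ring)" for a b
    using assms(2) that unfolding linear_character_def hom_def
    by (auto simp: units_of_def Units_def Pi_iff) 
  define f where "f = (\<lambda>t. \<chi> (1 + w * (SOME y. r y = t)))"
  have f: "f (r x) = \<chi> (1 + w * x)" for x
  proof -
    have "r (SOME y. r y = r x) = r x" by (rule someI[of _ x]) simp
    then show ?thesis by (simp add: f_def w_mult_eq_iff[symmetric])
  qed
  have "f (s + t) = f s * f t" for s t
  proof -
    obtain x y where xy: "r x = s" "r y = t" using lift by metis
    have "(1 + w * x) * (1 + w * y) = 1 + w * (x + y) + w * w * (x * y)" by (simp add: algebra_simps)
    then have "(1 + w * x) * (1 + w * y) = 1 + w * (x + y)" by (simp add: square_zero)
    then show ?thesis using \<chi>_mult[OF unit unit, of x y] f[of "x + y"] f[of x] f[of y] xy by (simp add: r.hom_add)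
  qed
  moreover have "f 0 = 1"
    using \<chi>_mult[OF unit unit, of 0 0] \<chi>_nz[OF unit unit, of 0] f[of 0] by simp
  moreover obtain u where "\<psi>\<^sub>k u \<noteq> 1" using \<psi>_nontrivial \<psi>\<^sub>k_r by metis
  ultimately obtain \<kappa> where "\<forall>t. f t = \<psi>\<^sub>k (\<kappa> * t)"
    using finite_field_character_duality[OF assms(1), of f \<psi>\<^sub>k u] \<psi>\<^sub>k_add by auto
  then show ?thesis using f by (intro exI[of _ \<kappa>]) metis
qed

lemma congruence_character_eq:
  assumes "X \<in> carrier_mat n n"
  shows "congruence_character n w r \<psi> C (1\<^sub>m n + w \<cdot>\<^sub>m X) = \<psi>\<^sub>k (mat_trace (C * red X))"
proof -
  let ?P = "\<lambda>Y. Y \<in> carrier_mat n n \<and> 1\<^sub>m n + w \<cdot>\<^sub>m X = 1\<^sub>m n + w \<cdot>\<^sub>m Y"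
  have Y: "?P (SOME Y. ?P Y)" by (rule someI[of ?P X]) (use assms in auto)
  define Y where "Y = (SOME Y. ?P Y)"
  have YP: "Y \<in> carrier_mat n n" "1\<^sub>m n + w \<cdot>\<^sub>m X = 1\<^sub>m n + w \<cdot>\<^sub>m Y" using Y unfolding Y_def by auto
  have "red Y = red X"
  proof (rule eq_matI)
    fix i j assume ij: "i < dim_row (red X)" "j < dim_col (red X)"
    have "(1\<^sub>m n + w \<cdot>\<^sub>m X) $$ (i, j) = (1\<^sub>m n + w \<cdot>\<^sub>m Y) $$ (i, j)" using YP by simp
    then have "w * X $$ (i, j) = w * Y $$ (i, j)" using ij YP(1) assms by simp
    then show "red Y $$ (i, j) = red X $$ (i, j)" using ij YP(1) assms by (simp add: w_mult_eq_iff)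
  qed (use YP assms in auto)
  then show ?thesis unfolding congruence_character_def \<psi>\<^sub>k_def Y_def[symmetric] by simp
qed

definition centralizer :: "'k mat \<Rightarrow> 'a mat set" where
  "centralizer C = {g \<in> carrier (GL (dim_row C)). red g * C = C * red g}"

lemma red_mult: "A \<in> carrier_mat n m \<Longrightarrow> B \<in> carrier_mat m l \<Longrightarrow> red (A * B) = red A * red B"
  by (rule r.mat_hom_mult)

lemma red_one: "red (1\<^sub>m n) = 1\<^sub>m n"
  by (rule r.mat_hom_one)

text \<open>Tested on multiples of elementary matrices, the trace form isolates single entries.\<close>

lemma trace_form_nondegenerate:
  assumes C: "C \<in> carrier_mat n n" and D: "D \<in> carrier_mat n n"
    and eq: "\<And>X. X \<in> carrier_mat n n \<Longrightarrow> \<psi>\<^sub>k (mat_trace (C * X)) = \<psi>\<^sub>k (mat_trace (D * X))"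
  shows "C = D"
proof (rule eq_matI)
  fix i j assume "i < dim_row D" "j < dim_col D"
  then have ij: "i < n" "j < n" using D by auto
  have tr: "mat_trace (M * mat n n (\<lambda>(a, b). if a = j \<and> b = i then t else 0)) = M $$ (i, j) * t"
    if M: "M \<in> carrier_mat n n" for M t
  proof -
    have "mat_trace (M * mat n n (\<lambda>(a, b). if a = j \<and> b = i then t else 0)) =
        (\<Sum>a<n. \<Sum>b<n. M $$ (a, b) * (if b = j \<and> a = i then t else 0))"
      using M by (auto simp: mat_trace_def scalar_prod_def atLeast0LessThan intro!: sum.cong)
    also have "\<dots> = (\<Sum>a<n. \<Sum>b<n. if b = j then (if a = i then M $$ (a, j) * t else 0) else 0)"
      by (intro sum.cong refl) auto
    also have "\<dots> = M $$ (i, j) * t" using ij by simp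
    finally show ?thesis .
  qed
  show "C $$ (i, j) = D $$ (i, j)"
    by (rule \<psi>\<^sub>k_nondegenerate) (use eq tr C D in \<open>metis mat_carrier\<close>)
qed (use C D in auto)

lemma conjugate_congruence:
  assumes g: "g \<in> carrier (GL n)" and X: "X \<in> carrier_mat n n"
  shows "g * (1\<^sub>m n + w \<cdot>\<^sub>m X) * inv\<^bsub>GL n\<^esub> g = 1\<^sub>m n + w \<cdot>\<^sub>m (g * X * inv\<^bsub>GL n\<^esub> g)"
proof -
  note g' = GL_inverse[OF g]
  have 1: "g * X \<in> carrier_mat n n" using g' X by simp
  have "g * (1\<^sub>m n + w \<cdot>\<^sub>m X) = g + w \<cdot>\<^sub>m (g * X)"
    using g' X mult_add_distrib_mat[OF g'(1), of "1\<^sub>m n" n "w \<cdot>\<^sub>m X"] mult_smult_distrib[OF g'(1) X] by simp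
  then show ?thesis
    using g' X 1 add_mult_distrib_mat[OF g'(1), of "w \<cdot>\<^sub>m (g * X)" "inv\<^bsub>GL n\<^esub> g" n]
      mult_smult_assoc_mat[OF 1 g'(2)] by simp
qed

text \<open>Conjugation by \<open>g\<close> turns the character attached to \<open>C\<close> into the one attached to the conjugate of
\<open>C\<close> by the reduction of \<open>g\<close>, and by nondegeneracy the character determines the matrix.\<close>

lemma inertia_group_eq_centralizer:
  assumes C: "C \<in> carrier_mat n n"
  shows "inertia_group n w r \<psi> C = centralizer C"
proof -
  have "(\<forall>k\<in>congruence_subgroup n w. congruence_character n w r \<psi> C (g \<otimes>\<^bsub>GL n\<^esub> k \<otimes>\<^bsub>GL n\<^esub> inv\<^bsub>GL n\<^esub> g) =
      congruence_character n w r \<psi> C k) \<longleftrightarrow> red g * C = C * red g" (is "?l \<longleftrightarrow> ?r")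
    if g: "g \<in> carrier (GL n)" for g
  proof -
    note g' = GL_inverse[OF g]
    define G where "G = red g" define G' where "G' = red (inv\<^bsub>GL n\<^esub> g)"
    have G: "G \<in> carrier_mat n n" "G' \<in> carrier_mat n n" using g' by (auto simp: G_def G'_def)
    have GG: "G * G' = 1\<^sub>m n" "G' * G = 1\<^sub>m n"
      using g' red_mult[of g n n "inv\<^bsub>GL n\<^esub> g" n] red_mult[of "inv\<^bsub>GL n\<^esub> g" n n g n]
      by (auto simp: G_def G'_def red_one)
    have eq: "congruence_character n w r \<psi> C (g * (1\<^sub>m n + w \<cdot>\<^sub>m X) * inv\<^bsub>GL n\<^esub> g) =
        \<psi>\<^sub>k (mat_trace (G' * C * G * red X))" if X: "X \<in> carrier_mat n n" for X
    proof -
      have rX: "red X \<in> carrier_mat n n" using X by simp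
      have "red (g * X * inv\<^bsub>GL n\<^esub> g) = G * red X * G'"
        using g' X red_mult[of "g * X" n n "inv\<^bsub>GL n\<^esub> g" n] red_mult[of g n n X n] by (simp add: G_def G'_def)
      moreover have "mat_trace (C * (G * red X * G')) = mat_trace (G' * C * G * red X)"
        using mat_trace_comm[of "C * G * red X" n n G'] C G rX
        by (simp add: assoc_mult_mat[of _ n n _ n _ n])
      moreover have "g * X * inv\<^bsub>GL n\<^esub> g \<in> carrier_mat n n" using g' X by simp
      ultimately show ?thesis
        using conjugate_congruence[OF g X] congruence_character_eq[of "g * X * inv\<^bsub>GL n\<^esub> g" n C] by simp
    qed
    have "?l \<longleftrightarrow> (\<forall>X\<in>carrier_mat n n. \<psi>\<^sub>k (mat_trace (G' * C * G * red X)) = \<psi>\<^sub>k (mat_trace (C * red X)))"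
      by (auto simp: congruence_subgroup_def eq congruence_character_eq)
    also have "\<dots> \<longleftrightarrow> (\<forall>X\<in>carrier_mat n n. \<psi>\<^sub>k (mat_trace (G' * C * G * X)) = \<psi>\<^sub>k (mat_trace (C * X)))"
      by (metis lift_mat map_carrier_mat)
    also have "\<dots> \<longleftrightarrow> G' * C * G = C"
      using trace_form_nondegenerate[of "G' * C * G" n C] C G by (metis mult_carrier_mat)
    also have "\<dots> \<longleftrightarrow> G * C = C * G"
    proof
      assume "G' * C * G = C"
      then have "G * C = G * (G' * C * G)" by simp
      also have "\<dots> = (G * G') * (C * G)" using C G by (simp add: assoc_mult_mat[of _ n n _ n _ n])
      finally show "G * C = C * G" using GG C G by simp
    next
      assume "G * C = C * G"
      then have "G' * C * G = G' * (G * C)" using C G by (simp add: assoc_mult_mat[of _ n n _ n _ n])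
      also have "\<dots> = (G' * G) * C" using C G by (simp add: assoc_mult_mat[of _ n n _ n _ n])
      finally show "G' * C * G = C" using GG C G by simp
    qed
    finally show ?thesis by (simp add: G_def)
  qed
  then show ?thesis using C unfolding inertia_group_def centralizer_def by auto
qed

end

section \<open>Cyclic vectors of three by three matrices\<close>

lemma scalar_prod_3: "v \<in> carrier_vec 3 \<Longrightarrow> w \<in> carrier_vec 3 \<Longrightarrow> v \<bullet> w = v $ 0 * w $ 0 + v $ 1 * w $ 1 + v $ 2 * w $ 2"
  by (auto simp: scalar_prod_def numeral_3_eq_3 numeral_2_eq_2)

lemma mult_mat_3_index:
  assumes "A \<in> carrier_mat n 3" "B \<in> carrier_mat 3 m" "i < n" "j < m"
  shows "(A * B) $$ (i, j) = A $$ (i, 0) * B $$ (0, j) + A $$ (i, 1) * B $$ (1, j) + A $$ (i, 2) * B $$ (2, j)"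
  using assms by (simp add: scalar_prod_3[of "row A i" "col B j"])

lemma mult_mat_vec_3_index:
  assumes "A \<in> carrier_mat n 3" "v \<in> carrier_vec 3" "i < n"
  shows "(A *\<^sub>v v) $ i = A $$ (i, 0) * v $ 0 + A $$ (i, 1) * v $ 1 + A $$ (i, 2) * v $ 2"
  using assms by (simp add: scalar_prod_3[of "row A i"])

lemma mat_trace_3: "A \<in> carrier_mat 3 3 \<Longrightarrow> mat_trace A = A $$ (0, 0) + A $$ (1, 1) + A $$ (2, 2)"
  by (auto simp: mat_trace_def numeral_3_eq_3 numeral_2_eq_2)

lemma smult_mat_mult_vec:
  "dim_col A = dim_vec v \<Longrightarrow> (c \<cdot>\<^sub>m A) *\<^sub>v v = c \<cdot>\<^sub>v (A *\<^sub>v (v :: 'k::comm_ring_1 vec))"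
  by (intro eq_vecI) auto

lemma less_3: "i < 3 \<longleftrightarrow> i = 0 \<or> i = 1 \<or> i = (2::nat)"
  by auto

lemma eq_vec_3: "v \<in> carrier_vec 3 \<Longrightarrow> w \<in> carrier_vec 3 \<Longrightarrow> v = w \<longleftrightarrow> v $ 0 = w $ 0 \<and> v $ 1 = w $ 1 \<and> v $ 2 = w $ 2"
  by (auto intro!: eq_vecI simp: less_3)

lemma irreducible_no_eigenvector:
  fixes C :: "'k::field mat"
  assumes C: "C \<in> carrier_mat n n" and n: "n > 1" and irr: "irreducible (char_poly C)"
    and v: "v \<in> carrier_vec n" "v \<noteq> 0\<^sub>v n"
  shows "C *\<^sub>v v \<noteq> l \<cdot>\<^sub>v v"
proof
  assume "C *\<^sub>v v = l \<cdot>\<^sub>v v"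
  then have "eigenvalue C l" using C v unfolding eigenvalue_def eigenvector_def by auto
  then have "poly (char_poly C) l = 0" using eigenvalue_root_char_poly[OF C] by simp
  then obtain q where q: "char_poly C = [:-l, 1:] * q" by (auto simp: poly_eq_0_iff_dvd)
  then have "[:-l, 1:] dvd 1 \<or> q dvd 1" using irr irreducibleD by blast
  then have "degree [:-l, 1:] = 0 \<or> degree q = 0" by (auto simp: poly_dvd_1)
  moreover have "degree (char_poly C) = n" using degree_monic_char_poly[OF C] by simp
  moreover have "q \<noteq> 0" using q irr by auto
  ultimately show False using n q degree_mult_eq[of "[:-l, 1:]" q] by simp
qed

text \<open>The vector product of three-dimensional geometry, over any ring.\<close>

definition cross :: "'k::comm_ring_1 vec \<Rightarrow> 'k vec \<Rightarrow> 'k vec" where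
  "cross v w = vec 3 (\<lambda>i. if i = 0 then v $ 1 * w $ 2 - v $ 2 * w $ 1
     else if i = 1 then v $ 2 * w $ 0 - v $ 0 * w $ 2 else v $ 0 * w $ 1 - v $ 1 * w $ 0)"

lemma cross_index:
  "cross v w $ 0 = v $ 1 * w $ 2 - v $ 2 * w $ 1"
  "cross v w $ Suc 0 = v $ 2 * w $ 0 - v $ 0 * w $ 2"
  "cross v w $ 2 = v $ 0 * w $ 1 - v $ 1 * w $ 0"
  "cross v w \<in> carrier_vec 3"
  by (auto simp: cross_def)

lemma cross_zero_parallel:
  fixes v w :: "'k::field vec"
  assumes vw: "v \<in> carrier_vec 3" "w \<in> carrier_vec 3" and v: "v \<noteq> 0\<^sub>v 3" and "cross v w = 0\<^sub>v 3"
  shows "\<exists>l. w = l \<cdot>\<^sub>v v"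
proof -
  have eqs: "v $ 1 * w $ 2 = v $ 2 * w $ 1" "v $ 2 * w $ 0 = v $ 0 * w $ 2" "v $ 0 * w $ 1 = v $ 1 * w $ 0"
    using assms(4) by (auto simp: eq_vec_3 cross_index)
  consider "v $ 0 \<noteq> 0" | "v $ 1 \<noteq> 0" | "v $ 2 \<noteq> 0" using v vw(1) by (auto simp: eq_vec_3)
  then show ?thesis
  proof cases
    case 1 then show ?thesis using eqs vw by (intro exI[of _ "w $ 0 / v $ 0"]) (auto simp: eq_vec_3 field_simps)
  next
    case 2 then show ?thesis using eqs vw by (intro exI[of _ "w $ 1 / v $ 1"]) (auto simp: eq_vec_3 field_simps)
  next
    case 3 then show ?thesis using eqs vw by (intro exI[of _ "w $ 2 / v $ 2"]) (auto simp: eq_vec_3 field_simps)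
  qed
qed

text \<open>Otherwise \<open>v\<close> is an eigenvector or \<open>v\<close> and \<open>C v\<close> span an invariant plane. In the second case the
covector \<open>n = v \<times> C v\<close> orthogonal to that plane is an eigenvector of the transpose of \<open>C\<close>, which has the
same characteristic polynomial. Either way the irreducible cubic polynomial would have a root.\<close>

lemma irreducible_cyclic:
  fixes C :: "'k::field mat"
  assumes C: "C \<in> carrier_mat 3 3" and irr: "irreducible (char_poly C)"
    and v: "v \<in> carrier_vec 3" "v \<noteq> 0\<^sub>v 3"
    and dep: "a \<cdot>\<^sub>v v + b \<cdot>\<^sub>v (C *\<^sub>v v) + c \<cdot>\<^sub>v (C *\<^sub>v (C *\<^sub>v v)) = 0\<^sub>v 3"
  shows "a = 0 \<and> b = 0 \<and> c = 0"
proof -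
  define u where "u = C *\<^sub>v v"
  define x where "x = C *\<^sub>v u"
  define n where "n = cross v u"
  have u: "u \<in> carrier_vec 3" and x: "x \<in> carrier_vec 3" and n: "n \<in> carrier_vec 3"
    using C v by (auto simp: u_def x_def n_def cross_index)
  have n0: "n \<noteq> 0\<^sub>v 3"
    using cross_zero_parallel[OF v(1) u v(2)] irreducible_no_eigenvector[OF C _ irr v] by (auto simp: n_def u_def)
  have dep': "a * v $ i + b * u $ i + c * x $ i = 0" if "i < 3" for i
  proof -
    have "(a \<cdot>\<^sub>v v + b \<cdot>\<^sub>v u + c \<cdot>\<^sub>v x) $ i = 0" using dep that by (simp add: u_def x_def)
    then show ?thesis using v u x that by (simp add: add.assoc)
  qed
  have "c = 0"
  proof (rule ccontr)
    assume c: "c \<noteq> 0"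
    define z where "z = C\<^sup>T *\<^sub>v n"
    have z: "z \<in> carrier_vec 3" using C n by (simp add: z_def)
    have adj: "z \<bullet> w = n \<bullet> (C *\<^sub>v w)" if "w \<in> carrier_vec 3" for w
      unfolding z_def using transpose_vec_mult_scalar[OF C that n] C n that by (simp add: comm_scalar_prod[of _ 3])
    have zv: "z \<bullet> v = 0" unfolding adj[OF v(1)] u_def[symmetric]
      using n u by (simp add: scalar_prod_3) (simp add: n_def cross_index algebra_simps)
    have "c * (z \<bullet> u) = 0"
    proof -
      have "c * (z \<bullet> u) = n $ 0 * (c * x $ 0) + n $ 1 * (c * x $ 1) + n $ 2 * (c * x $ 2)"
        unfolding adj[OF u] x_def[symmetric] using n x by (simp add: scalar_prod_3 algebra_simps)
      also have "\<dots> = n $ 0 * (- a * v $ 0 - b * u $ 0) + n $ 1 * (- a * v $ 1 - b * u $ 1) + n $ 2 * (- a * v $ 2 - b * u $ 2)"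
      proof -
        have "c * x $ i = - a * v $ i - b * u $ i" if "i < 3" for i
        proof -
          have "c * x $ i = (a * v $ i + b * u $ i + c * x $ i) - a * v $ i - b * u $ i" by simp
          then show ?thesis unfolding dep'[OF that] by simp
        qed
        then show ?thesis by simp
      qed
      also have "\<dots> = 0" by (simp add: n_def cross_index algebra_simps)
      finally show ?thesis .
    qed
    then have zu: "z \<bullet> u = 0" using c by simp
    have "cross n z = 0\<^sub>v 3"
    proof -
      have "cross n z $ 0 = v $ 0 * - (z \<bullet> u) + u $ 0 * (z \<bullet> v)" 
           "cross n z $ 1 = v $ 1 * - (z \<bullet> u) + u $ 1 * (z \<bullet> v)" 
           "cross n z $ 2 = v $ 2 * - (z \<bullet> u) + u $ 2 * (z \<bullet> v)"
        using z v u by (simp_all add: scalar_prod_3 cross_index n_def algebra_simps)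
      then show ?thesis using zv zu by (simp add: eq_vec_3 cross_index)
    qed
    then obtain l where "z = l \<cdot>\<^sub>v n" using cross_zero_parallel[OF n z n0] by auto
    moreover have "irreducible (char_poly C\<^sup>T)" using irr C by simp
    ultimately show False
      using irreducible_no_eigenvector[of "C\<^sup>T" 3 n l] C n n0 by (simp add: z_def)
  qed
  moreover have "b = 0"
  proof (rule ccontr)
    assume b: "b \<noteq> 0"
    have "C *\<^sub>v v = (- a / b) \<cdot>\<^sub>v v"
    proof (rule eq_vecI)
      fix i assume "i < dim_vec ((- a / b) \<cdot>\<^sub>v v)"
      then have i: "i < 3" using v by simp
      then have "b * u $ i = - a * v $ i" using dep'[OF i] \<open>c = 0\<close> by (simp add: eq_neg_iff_add_eq_0 add.commute)
      then show "(C *\<^sub>v v) $ i = ((- a / b) \<cdot>\<^sub>v v) $ i" using b i v by (simp add: u_def[symmetric] field_simps)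
    qed (use C v in auto)
    then show False using irreducible_no_eigenvector[OF C _ irr v] by simp
  qed
  moreover have "a = 0"
    using dep'[of 0] dep'[of 1] dep'[of 2] v \<open>b = 0\<close> \<open>c = 0\<close> by (auto simp: eq_vec_3)
  ultimately show ?thesis by simp
qed

text \<open>The normal form asks that \<open>D e\<^sub>0 = e\<^sub>2\<close> and \<open>D e\<^sub>2 = e\<^sub>1 + t e\<^sub>2\<close> for some \<open>t\<close>. The zeros make
\<open>D\<close> pair trivially, under the trace form, with the congruence matrices that should not matter; the
entries one put the character in general position; and \<open>d\<close> is adjusted to the character \<open>\<chi>\<close>.\<close>

definition whittaker_form :: "'k::field \<Rightarrow> 'k mat \<Rightarrow> bool" where
  "whittaker_form d D \<longleftrightarrow> D \<in> carrier_mat 3 3 \<and>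
     D $$ (0, 0) = 0 \<and> D $$ (1, 0) = 0 \<and> D $$ (2, 0) = 1 \<and>
     D $$ (0, 2) = 0 \<and> D $$ (1, 2) = 1 \<and> D $$ (1, 1) = d"

text \<open>In the basis \<open>e\<^sub>0, C\<^sup>2 e\<^sub>0 - t C e\<^sub>0, C e\<^sub>0\<close> only the middle column is not prescribed by
construction. Its diagonal entry is the trace minus \<open>t\<close>, so that \<open>t\<close> can be chosen to make it \<open>d\<close>.\<close>

lemma whittaker_form_exists:
  fixes C :: "'k::field mat"
  assumes C: "C \<in> carrier_mat 3 3" and irr: "irreducible (char_poly C)"
  obtains P D where "P \<in> carrier_mat 3 3" "det P \<noteq> 0" "whittaker_form d D" "P * D = C * P"
    "irreducible (char_poly D)"
proof -
  define t where "t = mat_trace C - d"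
  define e :: "'k vec" where "e = unit_vec 3 0"
  define u where "u = C *\<^sub>v e"
  define x where "x = C *\<^sub>v u"
  have e: "e \<in> carrier_vec 3" "e \<noteq> 0\<^sub>v 3" and u: "u \<in> carrier_vec 3" and x: "x \<in> carrier_vec 3"
    using C by (auto simp: e_def u_def x_def)
  define p where "p = x - t \<cdot>\<^sub>v u"
  have p: "p \<in> carrier_vec 3" using x u by (simp add: p_def)
  define P where "P = mat_of_cols 3 [e, p, u]"
  have P: "P \<in> carrier_mat 3 3" using mat_of_cols_carrier(1)[of 3 "[e, p, u]"] by (simp add: P_def numeral_3_eq_3)
  have Pv: "P *\<^sub>v w = w $ 0 \<cdot>\<^sub>v e + w $ 1 \<cdot>\<^sub>v p + w $ 2 \<cdot>\<^sub>v u" if "w \<in> carrier_vec 3" for w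
    using that P e p u
    by (intro eq_vecI)
       (auto simp: mult_mat_vec_3_index[of P 3] simp del: index_mult_mat_vec, auto simp: P_def mat_of_cols_index mult.commute)
  have det: "det P \<noteq> 0"
  proof
    assume "det P = 0"
    then obtain w where w: "w \<in> carrier_vec 3" "w \<noteq> 0\<^sub>v 3" "P *\<^sub>v w = 0\<^sub>v 3"
      using det_0_iff_vec_prod_zero_field[OF P] by auto
    have "w $ 0 \<cdot>\<^sub>v e + (w $ 2 - t * w $ 1) \<cdot>\<^sub>v (C *\<^sub>v e) + w $ 1 \<cdot>\<^sub>v (C *\<^sub>v (C *\<^sub>v e)) = P *\<^sub>v w"
      unfolding Pv[OF w(1)] u_def[symmetric] x_def[symmetric] p_def using e u x
      by (intro eq_vecI) (auto simp: algebra_simps)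
    then have "w $ 0 = 0 \<and> w $ 2 - t * w $ 1 = 0 \<and> w $ 1 = 0"
      unfolding w(3) by (rule irreducible_cyclic[OF C irr e])
    then show False using w by (auto simp: eq_vec_3)
  qed
  then obtain Q where Q: "Q \<in> carrier_mat 3 3" "P * Q = 1\<^sub>m 3" "Q * P = 1\<^sub>m 3"
  proof -
    have "P \<in> carrier (GL 3)" by (rule GL_det_unit[OF P, of "inverse (det P)"]) (use det in simp)
    then show ?thesis using that by (auto simp: carrier_GL)
  qed
  define y where "y = Q *\<^sub>v (C *\<^sub>v p)"
  have y: "y \<in> carrier_vec 3" using Q C p by (simp add: y_def)
  define z where "z = vec 3 (\<lambda>i. if i = 0 then 0 else if i = 1 then 1 else t)"
  define D where "D = mat_of_cols 3 [unit_vec 3 2, y, z]"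
  have D: "D \<in> carrier_mat 3 3" using mat_of_cols_carrier(1)[of 3 "[unit_vec 3 2, y, z]"] by (simp add: D_def numeral_3_eq_3)
  have PD: "P * D = C * P"
  proof (rule mat_col_eqI)
    fix j assume "j < dim_col (C * P)"
    then have j: "j = 0 \<or> j = 1 \<or> j = 2" using P by auto
    have cols: "col D 0 = unit_vec 3 2" "col D (Suc 0) = y" "col D 2 = z" "col P 0 = e" "col P (Suc 0) = p" "col P 2 = u"
      using y e p u by (auto simp: D_def P_def col_mat_of_cols z_def)
    have "P *\<^sub>v y = C *\<^sub>v p"
      unfolding y_def using assoc_mult_mat_vec[OF P Q(1), of "C *\<^sub>v p"] C p Q by simp
    moreover have "P *\<^sub>v unit_vec 3 2 = u" using e p u by (simp add: Pv) (auto intro!: eq_vecI)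
    moreover have "P *\<^sub>v z = C *\<^sub>v u"
      using e u x by (simp add: Pv z_def) (auto intro!: eq_vecI simp: p_def x_def[symmetric])
    ultimately have "P *\<^sub>v col D j = C *\<^sub>v col P j" using j by (auto simp: cols u_def)
    moreover have "j < 3" using j by auto
    ultimately show "col (P * D) j = col (C * P) j"
      unfolding col_mult2[OF P D \<open>j < 3\<close>] col_mult2[OF C P \<open>j < 3\<close>] by simp
  qed (use P D C in auto)
  have sim: "D = Q * C * P"
  proof -
    have "D = (Q * P) * D" using Q D by simp
    also have "\<dots> = Q * (C * P)" unfolding PD[symmetric] by (rule assoc_mult_mat[OF Q(1) P D])
    also have "\<dots> = Q * C * P" by (rule assoc_mult_mat[OF Q(1) C P, symmetric])
    finally show ?thesis .
  qed
  have "similar_mat D C"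
    unfolding similar_mat_def similar_mat_wit_def using sim P Q C D by (intro exI[of _ Q] exI[of _ P]) auto
  then have irrD: "irreducible (char_poly D)" using char_poly_similar irr by metis
  have "mat_trace D = mat_trace C"
  proof -
    have "P * (Q * C) = (P * Q) * C" by (rule assoc_mult_mat[OF P Q(1) C, symmetric])
    also have "\<dots> = C" unfolding Q(2) by (rule left_mult_one_mat[OF C])
    finally show ?thesis unfolding sim using mat_trace_comm[of "Q * C" 3 3 P] Q(1) P C by (simp del: assoc_mult_mat)
  qed
  then have "y $ 1 = d"
    unfolding mat_trace_3[OF D] using y by (simp add: D_def mat_of_cols_index z_def t_def)
  then have "whittaker_form d D"
    unfolding whittaker_form_def using D y by (auto simp: D_def mat_of_cols_index z_def)
  then show ?thesis using that P det PD irrD by blast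
qed

text \<open>The commutant of \<open>D\<close> contains the field \<open>k[D]\<close>, over which \<open>k\<^sup>3\<close> is a line. A polynomial
in \<open>D\<close> of degree at most two is found that sends \<open>e\<^sub>0\<close> to \<open>v\<close>; it is injective by
\<open>irreducible_cyclic\<close>.\<close>

lemma whittaker_form_commutant_transitive:
  fixes D :: "'k::field mat"
  assumes form: "whittaker_form d D" and irr: "irreducible (char_poly D)"
    and v: "v \<in> carrier_vec 3" "v \<noteq> 0\<^sub>v 3"
  obtains h where "h \<in> carrier_mat 3 3" "det h \<noteq> 0" "h * D = D * h" "col h 0 = v"
proof -
  have D: "D \<in> carrier_mat 3 3" using form by (simp add: whittaker_form_def)
  define t where "t = D $$ (2, 2)"
  define h where "h = v $ 0 \<cdot>\<^sub>m 1\<^sub>m 3 + (v $ 2 - t * v $ 1) \<cdot>\<^sub>m D + v $ 1 \<cdot>\<^sub>m (D * D)"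
  have h: "h \<in> carrier_mat 3 3" using D by (simp add: h_def)
  have hv: "h *\<^sub>v w = v $ 0 \<cdot>\<^sub>v w + (v $ 2 - t * v $ 1) \<cdot>\<^sub>v (D *\<^sub>v w) + v $ 1 \<cdot>\<^sub>v (D *\<^sub>v (D *\<^sub>v w))"
    if "w \<in> carrier_vec 3" for w
  proof -
    have "v $ 0 \<cdot>\<^sub>m 1\<^sub>m 3 *\<^sub>v w = v $ 0 \<cdot>\<^sub>v w" using that by (intro eq_vecI) auto
    then show ?thesis unfolding h_def using D that
      by (simp add: add_mult_distrib_mat_vec[of _ 3 3] smult_mat_mult_vec)
  qed
  have "det h \<noteq> 0"
  proof
    assume "det h = 0"
    then obtain w where w: "w \<in> carrier_vec 3" "w \<noteq> 0\<^sub>v 3" "h *\<^sub>v w = 0\<^sub>v 3"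
      using det_0_iff_vec_prod_zero_field[OF h] by auto
    have "v $ 0 = 0 \<and> v $ 2 - t * v $ 1 = 0 \<and> v $ 1 = 0"
      by (rule irreducible_cyclic[OF D irr w(1,2)]) (use hv[OF w(1)] w(3) in simp)
    then show False using v by (auto simp: eq_vec_3)
  qed
  moreover have "h * D = D * h"
    unfolding h_def using D
    by (simp add: add_mult_distrib_mat[of _ 3 3] mult_add_distrib_mat[of _ 3 3 _ 3])
       (simp add: mult_smult_distrib[of _ 3 3 _ 3] mult_smult_assoc_mat[of _ 3 3 _ 3] assoc_mult_mat[of _ 3 3 _ 3 _ 3])
  moreover have "col h 0 = v"
    using form v D
    by (intro eq_vecI) (auto simp: less_3 whittaker_form_def h_def mult_mat_3_index[of D 3 D 3] t_def algebra_simps simp del: index_mult_mat(1))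
  ultimately show ?thesis using that h by blast
qed

text \<open>A matrix that commutes with \<open>D\<close> is determined by its value on the cyclic vector \<open>e\<^sub>0\<close>.\<close>

lemma whittaker_form_commutant_scalar:
  fixes D :: "'k::field mat"
  assumes form: "whittaker_form d D" and h: "h \<in> carrier_mat 3 3" and comm: "h * D = D * h"
    and col: "h $$ (1, 0) = 0" "h $$ (2, 0) = 0"
  shows "h = h $$ (0, 0) \<cdot>\<^sub>m 1\<^sub>m 3"
proof -
  have D: "D \<in> carrier_mat 3 3" using form by (simp add: whittaker_form_def)
  have eq: "h $$ (i, 0) * D $$ (0, j) + h $$ (i, 1) * D $$ (1, j) + h $$ (i, 2) * D $$ (2, j) =
      D $$ (i, 0) * h $$ (0, j) + D $$ (i, 1) * h $$ (1, j) + D $$ (i, 2) * h $$ (2, j)" if "i < 3" "j < 3" for i j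
    using comm mult_mat_3_index[OF h D that] mult_mat_3_index[OF D h that] by simp
  have c2: "h $$ (i, 2) = D $$ (i, 0) * h $$ (0, 0)" if "i < 3" for i
    using eq[OF that, of 0] form col by (simp add: whittaker_form_def)
  have h2: "h $$ (0, 2) = 0" "h $$ (1, 2) = 0" "h $$ (2, 2) = h $$ (0, 0)"
    using c2[of 0] c2[of 1] c2[of 2] form by (simp_all add: whittaker_form_def)
  have c1: "h $$ (i, 1) = D $$ (i, 2) * h $$ (0, 0) - h $$ (i, 2) * D $$ (2, 2)" if "i < 3" for i
    using eq[OF that, of 2] form h2 by (simp add: whittaker_form_def algebra_simps)
  have h1: "h $$ (0, 1) = 0" "h $$ (1, 1) = h $$ (0, 0)" "h $$ (2, 1) = 0"
    using c1[of 0] c1[of 1] c1[of 2] h2 form by (simp_all add: whittaker_form_def algebra_simps)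
  show ?thesis
  proof (rule eq_matI)
    fix i j assume "i < dim_row (h $$ (0, 0) \<cdot>\<^sub>m 1\<^sub>m 3)" "j < dim_col (h $$ (0, 0) \<cdot>\<^sub>m 1\<^sub>m 3)"
    then have "i < 3" "j < 3" by auto
    then show "h $$ (i, j) = (h $$ (0, 0) \<cdot>\<^sub>m 1\<^sub>m 3) $$ (i, j)"
      unfolding less_3 using col h1 h2 by auto
  qed (use h in auto)
qed

section \<open>The parabolic subgroup and the degenerate unipotent radical\<close>

lemma less_4: "i < 4 \<longleftrightarrow> i = 0 \<or> i = 1 \<or> i = 2 \<or> i = (3::nat)"
  by auto

lemma mult_mat_4_index:
  assumes "A \<in> carrier_mat n 4" "B \<in> carrier_mat 4 m" "i < n" "j < m"
  shows "(A * B) $$ (i, j) = A $$ (i, 0) * B $$ (0, j) + A $$ (i, 1) * B $$ (1, j) +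
    A $$ (i, 2) * B $$ (2, j) + A $$ (i, 3) * B $$ (3, j)"
  using assms by (simp add: scalar_prod_def eval_nat_numeral ac_simps)

lemma mult_mat_2_index:
  assumes "A \<in> carrier_mat n 2" "B \<in> carrier_mat 2 m" "i < n" "j < m"
  shows "(A * B) $$ (i, j) = A $$ (i, 0) * B $$ (0, j) + A $$ (i, 1) * B $$ (1, j)"
  using assms by (simp add: scalar_prod_def eval_nat_numeral)

lemma det_mat_2:
  assumes "A \<in> carrier_mat 2 2"
  shows "det A = A $$ (0, 0) * A $$ (1, 1) - A $$ (0, 1) * (A $$ (1, 0) :: 'a::comm_ring_1)"
proof -
  have "det A = (\<Sum>i<2. A $$ (i, 0) * cofactor A i 0)" 
    using laplace_expansion_column[OF assms, of 0] by simp
  also have "\<dots> = A $$ (0, 0) * cofactor A 0 0 + A $$ (1, 0) * cofactor A 1 0"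
    by (simp add: numeral_2_eq_2)
  finally show ?thesis using assms
    by (simp add: cofactor_def mat_delete_def det_single algebra_simps)
qed

definition levi :: "'a mat \<Rightarrow> 'a mat" where
  "levi q = mat 3 3 (\<lambda>(i, j). q $$ (i, j))"

definition levi_embed :: "'a::comm_ring_1 mat \<Rightarrow> 'a mat" where
  "levi_embed h = four_block_mat h (0\<^sub>m 3 1) (0\<^sub>m 1 3) (1\<^sub>m 1)"

definition diag_embed :: "'a::comm_ring_1 mat \<Rightarrow> 'a mat" where
  "diag_embed g = four_block_mat g (0\<^sub>m 2 2) (0\<^sub>m 2 2) g"

definition unip :: "'a::comm_ring_1 mat \<Rightarrow> 'a mat" where
  "unip X = four_block_mat (1\<^sub>m 2) X (0\<^sub>m 2 2) (1\<^sub>m 2)"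

text \<open>The representative \<open>\<gamma>\<close> of the open double coset. Its last row is the first unit vector, whereas the last row of a
matrix in the parabolic subgroup is a multiple of the last unit vector.\<close>

definition cycle_mat :: "'a::comm_ring_1 mat" where
  "cycle_mat = mat 4 4 (\<lambda>(i, j). if j = (i + 1) mod 4 then 1 else 0)"

text \<open>The conjugate \<open>\<gamma> M \<gamma>\<inverse>\<close>, by lemma \<open>rotate_mat_cycle\<close>.\<close>

definition rotate_mat :: "'a mat \<Rightarrow> 'a mat" where
  "rotate_mat M = mat 4 4 (\<lambda>(i, j). M $$ ((i + 1) mod 4, (j + 1) mod 4))"

lemma levi_carrier [simp]: "levi q \<in> carrier_mat 3 3" "i < 3 \<Longrightarrow> j < 3 \<Longrightarrow> levi q $$ (i, j) = q $$ (i, j)"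
  "dim_row (levi q) = 3" "dim_col (levi q) = 3"
  by (auto simp: levi_def)

lemma cycle_mat_carrier [simp]: "cycle_mat \<in> carrier_mat 4 4"
  by (simp add: cycle_mat_def)

lemma cycle_mat_index: "i < 4 \<Longrightarrow> j < 4 \<Longrightarrow> cycle_mat $$ (i, j) = (if j = (i + 1) mod 4 then 1 else 0)"
  by (simp add: cycle_mat_def)

lemma rotate_mat_carrier [simp]: "rotate_mat M \<in> carrier_mat 4 4"
  by (simp add: rotate_mat_def)

lemma diag_embed_carrier: "g \<in> carrier_mat 2 2 \<Longrightarrow> diag_embed g \<in> carrier_mat 4 4"
  unfolding diag_embed_def using four_block_carrier_mat[of g 2 2 g 2 2] by simp

lemma unip_carrier: "X \<in> carrier_mat 2 2 \<Longrightarrow> unip X \<in> carrier_mat 4 4"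
  unfolding unip_def using four_block_carrier_mat[of "1\<^sub>m 2" 2 2 "1\<^sub>m 2" 2 2] by simp

lemma levi_embed_carrier: "h \<in> carrier_mat 3 3 \<Longrightarrow> levi_embed h \<in> carrier_mat 4 4"
  unfolding levi_embed_def using four_block_carrier_mat[of h 3 3 "1\<^sub>m 1" 1 1] by simp

lemma diag_embed_mult:
  assumes "g \<in> carrier_mat 2 2" "h \<in> carrier_mat 2 2"
  shows "diag_embed g * diag_embed h = diag_embed (g * h)"
  unfolding diag_embed_def using assms
  by (subst mult_four_block_mat[of _ 2 2 _ 2 _ 2]) auto

lemma diag_embed_one: "diag_embed (1\<^sub>m 2) = 1\<^sub>m 4"
  by (simp add: diag_embed_def)

lemma unip_mult:
  assumes "X \<in> carrier_mat 2 2" "Y \<in> carrier_mat 2 2"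
  shows "unip X * unip Y = unip (X + Y)"
  unfolding unip_def using assms
  by (subst mult_four_block_mat[of _ 2 2 _ 2 _ 2]) (auto simp: comm_add_mat[of X 2 2])

lemma unip_zero: "unip (0\<^sub>m 2 2) = 1\<^sub>m 4"
  by (simp add: unip_def)

lemma diag_unip:
  assumes "g \<in> carrier_mat 2 2" "X \<in> carrier_mat 2 2"
  shows "diag_embed g * unip X = four_block_mat g (g * X) (0\<^sub>m 2 2) g"
  unfolding unip_def diag_embed_def using assms
  by (subst mult_four_block_mat[of _ 2 2 _ 2 _ 2]) auto

lemma unip_diag:
  assumes "g \<in> carrier_mat 2 2" "X \<in> carrier_mat 2 2"
  shows "unip X * diag_embed g = four_block_mat g (X * g) (0\<^sub>m 2 2) g"
  unfolding unip_def diag_embed_def using assms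
  by (subst mult_four_block_mat[of _ 2 2 _ 2 _ 2]) auto

lemma diag_embed_GL:
  assumes "g \<in> carrier (GL 2)"
  shows "diag_embed g \<in> carrier (GL 4)" "inv\<^bsub>GL 4\<^esub> (diag_embed g) = diag_embed (inv\<^bsub>GL 2\<^esub> g)"
  using inv_GL[of "diag_embed g" 4 "diag_embed (inv\<^bsub>GL 2\<^esub> g)"] GL_inverse[OF assms]
  by (auto simp: diag_embed_mult diag_embed_carrier diag_embed_one)

lemma unip_GL:
  fixes X :: "'a::comm_ring_1 mat"
  assumes "X \<in> carrier_mat 2 2"
  shows "unip X \<in> carrier (GL 4)" "inv\<^bsub>GL 4\<^esub> (unip X) = unip (- X)"
proof -
  have "X + - X = 0\<^sub>m 2 2" "- X + X = 0\<^sub>m 2 2" using assms by (auto intro!: eq_matI)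
  then show "unip X \<in> carrier (GL 4)" "inv\<^bsub>GL 4\<^esub> (unip X) = unip (- X)"
    using inv_GL[of "unip X" 4 "unip (- X)"] assms
    by (auto simp: unip_mult unip_carrier unip_zero)
qed

lemma conjugate_unip:
  assumes g: "g \<in> carrier (GL 2)" and X: "X \<in> carrier_mat 2 2"
  shows "diag_embed g * unip X * inv\<^bsub>GL 4\<^esub> (diag_embed g) = unip (g * X * inv\<^bsub>GL 2\<^esub> g)"
proof -
  note g' = GL_inverse[OF g]
  have Y: "g * X * inv\<^bsub>GL 2\<^esub> g \<in> carrier_mat 2 2" using g' X by simp
  have "unip (g * X * inv\<^bsub>GL 2\<^esub> g) * diag_embed g = diag_embed g * unip X"
    using g' X Y by (simp add: diag_unip unip_diag assoc_mult_mat[of _ 2 2 _ 2 _ 2])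
  then have "diag_embed g * unip X * diag_embed (inv\<^bsub>GL 2\<^esub> g) =
      unip (g * X * inv\<^bsub>GL 2\<^esub> g) * diag_embed g * diag_embed (inv\<^bsub>GL 2\<^esub> g)" by simp
  also have "\<dots> = unip (g * X * inv\<^bsub>GL 2\<^esub> g)"
    using g' Y by (simp add: assoc_mult_mat[of _ 4 4 _ 4 _ 4] unip_carrier diag_embed_carrier diag_embed_mult diag_embed_one
      right_mult_one_mat[of _ 4 4])
  finally show ?thesis using diag_embed_GL[OF g] by simp
qed

lemma levi_embed_mult:
  assumes "g \<in> carrier_mat 3 3" "h \<in> carrier_mat 3 3"
  shows "levi_embed g * levi_embed h = levi_embed (g * h)"
  unfolding levi_embed_def using assms
  by (subst mult_four_block_mat[of _ 3 3 _ 1 _ 1]) auto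

lemma levi_embed_one: "levi_embed (1\<^sub>m 3) = 1\<^sub>m 4"
  by (simp add: levi_embed_def)

lemma levi_embed_GL:
  assumes "h \<in> carrier (GL 3)"
  shows "levi_embed h \<in> carrier (GL 4)"
  using inv_GL[of "levi_embed h" 4 "levi_embed (inv\<^bsub>GL 3\<^esub> h)"] GL_inverse[OF assms]
  by (auto simp: levi_embed_mult levi_embed_carrier levi_embed_one)

lemma levi_embed_index:
  assumes "h \<in> carrier_mat 3 3"
  shows "levi (levi_embed h) = h" "levi_embed h $$ (3, 3) = 1"
    "j < 3 \<Longrightarrow> levi_embed h $$ (3, j) = 0"
  using assms by (auto simp: levi_embed_def levi_def intro!: eq_matI)

lemma cycle_mult_index:
  assumes "M \<in> carrier_mat 4 4" "i < 4" "j < 4"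
  shows "(cycle_mat * M) $$ (i, j) = M $$ ((i + 1) mod 4, j)"
  using assms(2) unfolding less_4
  by (elim disjE) (simp_all add: mult_mat_4_index[OF cycle_mat_carrier assms(1) _ assms(3)] cycle_mat_index numeral_2_eq_2[symmetric] del: index_mult_mat(1))

lemma mult_cycle_index:
  assumes "M \<in> carrier_mat 4 4" "i < 4" "j < 4"
  shows "(M * cycle_mat) $$ (i, (j + 1) mod 4) = M $$ (i, j)"
  using assms(3) unfolding less_4
  by (elim disjE) (simp_all add: mult_mat_4_index[OF assms(1) cycle_mat_carrier assms(2)] cycle_mat_index numeral_2_eq_2[symmetric] del: index_mult_mat(1))

lemma cycle_mat_GL: "cycle_mat \<in> carrier (GL 4)"
proof (rule inv_GL(1)[of _ 4 "mat 4 4 (\<lambda>(i, j). if i = (j + 1) mod 4 then 1 else 0)"])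
  let ?B = "mat 4 4 (\<lambda>(i, j). if i = (j + 1) mod 4 then 1 else 0) :: 'a mat"
  have B: "?B \<in> carrier_mat 4 4" by simp
  show "cycle_mat * ?B = 1\<^sub>m 4"
  proof (rule eq_matI)
    fix i j assume "i < dim_row (1\<^sub>m 4 :: 'a mat)" "j < dim_col (1\<^sub>m 4 :: 'a mat)"
    then have ij: "i < 4" "j < 4" by auto
    have "(i + 1) mod 4 = (j + 1) mod 4 \<longleftrightarrow> i = j"
      using ij unfolding less_4 by auto
    then show "(cycle_mat * ?B) $$ (i, j) = 1\<^sub>m 4 $$ (i, j)"
      unfolding cycle_mult_index[OF B ij] using ij by simp
  qed (auto simp: cycle_mat_def)
  show "?B * cycle_mat = 1\<^sub>m 4"
  proof (rule eq_matI)
    fix i j assume "i < dim_row (1\<^sub>m 4 :: 'a mat)" "j < dim_col (1\<^sub>m 4 :: 'a mat)"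
    then have ij: "i < 4" "j < 4" by auto
    have j: "j = ((j + 3) mod 4 + 1) mod 4" "(j + 3) mod 4 < 4" using ij unfolding less_4 by auto
    have "(?B * cycle_mat) $$ (i, j) = ?B $$ (i, (j + 3) mod 4)"
      using mult_cycle_index[OF B ij(1) j(2)] j(1) by simp
    then show "(?B * cycle_mat) $$ (i, j) = 1\<^sub>m 4 $$ (i, j)"
      using ij j by simp
  qed (auto simp: cycle_mat_def)
qed auto

lemma rotate_mat_cycle:
  assumes M: "M \<in> carrier_mat 4 4"
  shows "rotate_mat M * cycle_mat = cycle_mat * M"
proof (rule eq_matI)
  fix i j assume ij: "i < dim_row (cycle_mat * M)" "j < dim_col (cycle_mat * M)"
  then have ij: "i < 4" "j < 4" using M by (auto simp: cycle_mat_def)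
  have j: "j = ((j + 3) mod 4 + 1) mod 4" "(j + 3) mod 4 < 4" using ij unfolding less_4 by auto
  have "(rotate_mat M * cycle_mat) $$ (i, ((j + 3) mod 4 + 1) mod 4) = M $$ ((i + 1) mod 4, ((j + 3) mod 4 + 1) mod 4)"
    using mult_cycle_index[OF rotate_mat_carrier ij(1) j(2)] ij j by (simp add: rotate_mat_def)
  then show "(rotate_mat M * cycle_mat) $$ (i, j) = (cycle_mat * M) $$ (i, j)"
    unfolding j(1)[symmetric] cycle_mult_index[OF M ij] .
qed (use M in \<open>auto simp: rotate_mat_def cycle_mat_def\<close>)

lemma cycle_mult_cancel:
  assumes "A \<in> carrier_mat 4 4" "B \<in> carrier_mat 4 4" "A * cycle_mat = B * cycle_mat"
  shows "A = B"
proof (rule eq_matI)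
  fix i j assume "i < dim_row B" "j < dim_col B"
  then have ij: "i < 4" "j < 4" using assms by auto
  show "A $$ (i, j) = B $$ (i, j)"
    using mult_cycle_index[OF assms(1) ij] mult_cycle_index[OF assms(2) ij] assms(3) by simp
qed (use assms in auto)

lemma rotate_mat_GL:
  assumes "M \<in> carrier (GL 4)"
  shows "rotate_mat M \<in> carrier (GL 4)"
proof -
  interpret group "GL 4 :: 'a mat monoid" by (rule group_GL)
  have "cycle_mat * M * inv\<^bsub>GL 4\<^esub> cycle_mat \<in> carrier (GL 4)"
    using assms cycle_mat_GL m_closed inv_closed by (metis mult_GL)
  moreover have "rotate_mat M = cycle_mat * M * inv\<^bsub>GL 4\<^esub> cycle_mat"
  proof (rule cycle_mult_cancel)
    note c = GL_inverse[OF cycle_mat_GL] and M = GL_inverse(1)[OF assms]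
    show "cycle_mat * M * inv\<^bsub>GL 4\<^esub> cycle_mat \<in> carrier_mat 4 4"
      by (rule mult_carrier_mat[OF mult_carrier_mat[OF cycle_mat_carrier M] c(2)])
    show "rotate_mat M * cycle_mat = cycle_mat * M * inv\<^bsub>GL 4\<^esub> cycle_mat * cycle_mat"
      using GL_cancel(1)[OF cycle_mat_GL mult_carrier_mat[OF cycle_mat_carrier M]] rotate_mat_cycle[OF M] by simp
  qed simp
  ultimately show ?thesis by simp
qed

context length_two_ring
begin

lemma GL_2_det: 
  assumes "g \<in> carrier_mat 2 2"
  shows "g \<in> carrier (GL 2) \<longleftrightarrow> r (g $$ (0, 0) * g $$ (1, 1) - g $$ (0, 1) * g $$ (1, 0)) \<noteq> 0"
  using assms by (simp add: carrier_GL_iff det_mat_2[OF assms] r.hom_minus r.hom_mult)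

lemma parabolic_31_iff:
  "(q :: 'a mat) \<in> parabolic_31 \<longleftrightarrow> q \<in> carrier (GL 4) \<and> (\<forall>j<3. q $$ (3, j) = 0)"
proof
  assume "q \<in> parabolic_31"
  then obtain h Y c where q: "q = four_block_mat h Y (0\<^sub>m 1 3) c"
    and *: "h \<in> carrier (GL 3)" "Y \<in> carrier_mat 3 1" "c \<in> carrier (GL 1)"
    unfolding parabolic_31_def by auto
  have **: "h \<in> carrier_mat 3 3" "c \<in> carrier_mat 1 1" "det (red h) \<noteq> 0" "det (red c) \<noteq> 0"
    using * by (auto simp: carrier_GL_iff)
  have "red q = four_block_mat (red h) (red Y) (0\<^sub>m 1 3) (red c)"
    unfolding q using * ** by (intro eq_matI) auto
  then have "det (red q) \<noteq> 0"
    using det_four_block_mat_lower_left_zero[of "red h" 3 "red Y" 1 "0\<^sub>m 1 3" "red c"] * ** by simp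
  moreover have "q \<in> carrier_mat 4 4" unfolding q using four_block_carrier_mat[OF **(1,2)] by simp
  ultimately show "q \<in> carrier (GL 4) \<and> (\<forall>j<3. q $$ (3, j) = 0)"
    using * ** by (auto simp: carrier_GL_iff q)
next
  assume a: "q \<in> carrier (GL 4) \<and> (\<forall>j<3. q $$ (3, j) = 0)"
  then have qc: "q \<in> carrier_mat 4 4" by (simp add: carrier_GL_iff)
  define Y where "Y = mat 3 1 (\<lambda>(i, j). q $$ (i, 3))"
  define c where "c = mat 1 1 (\<lambda>(i, j). q $$ (3, 3))"
  have Y: "Y \<in> carrier_mat 3 1" and c: "c \<in> carrier_mat 1 1" by (auto simp: Y_def c_def)
  have q: "q = four_block_mat (levi q) Y (0\<^sub>m 1 3) c"
    using a qc by (intro eq_matI) (auto simp: levi_def Y_def c_def less_4)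
  have "red q = four_block_mat (red (levi q)) (red Y) (0\<^sub>m 1 3) (red c)"
    by (subst q) (use Y c in \<open>intro eq_matI; auto simp: levi_def\<close>)
  then have "det (red (levi q)) * det (red c) \<noteq> 0"
    using det_four_block_mat_lower_left_zero[of "red (levi q)" 3 "red Y" 1 "0\<^sub>m 1 3" "red c"] Y c a
    by (simp add: carrier_GL_iff)
  then have "levi q \<in> carrier (GL 3)" "c \<in> carrier (GL 1)"
    using c by (auto simp: carrier_GL_iff)
  then show "q \<in> parabolic_31"
    unfolding parabolic_31_def using q Y by blast
qed

lemma parabolicD:
  assumes q: "q \<in> parabolic_31"
  shows "q \<in> carrier (GL 4)" "q \<in> carrier_mat 4 4" "levi q \<in> carrier (GL 3)" "r (q $$ (3, 3)) \<noteq> 0"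
    "q $$ (3, 0) = 0" "q $$ (3, Suc 0) = 0" "q $$ (3, 2) = 0"
proof -
  show "q \<in> carrier (GL 4)" "q \<in> carrier_mat 4 4"
    "q $$ (3, 0) = 0" "q $$ (3, Suc 0) = 0" "q $$ (3, 2) = 0"
    using q unfolding parabolic_31_iff by (auto simp: carrier_GL_iff)
  obtain h Y c where qb: "q = four_block_mat h Y (0\<^sub>m 1 3) c"
    and *: "h \<in> carrier (GL 3)" "Y \<in> carrier_mat 3 1" "c \<in> carrier (GL 1)"
    using q unfolding parabolic_31_def by auto
  have "levi q = h" using * unfolding qb by (intro eq_matI) (auto simp: levi_def carrier_GL_iff)
  then show "levi q \<in> carrier (GL 3)" using * by simp
  have "det (red c) = r (c $$ (0, 0))" using * by (subst det_single) (auto simp: carrier_GL_iff)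
  moreover have "q $$ (3, 3) = c $$ (0, 0)" using * by (auto simp: qb carrier_GL_iff)
  ultimately show "r (q $$ (3, 3)) \<noteq> 0" using * by (auto simp: carrier_GL_iff)
qed

lemma parabolic_mult:
  assumes q: "(q :: 'a mat) \<in> parabolic_31" and p: "p \<in> parabolic_31"
  shows "q * p \<in> parabolic_31" "levi (q * p) = levi q * levi p" "(q * p) $$ (3, 3) = q $$ (3, 3) * p $$ (3, 3)"
proof -
  interpret group "GL 4 :: 'a mat monoid" by (rule group_GL)
  note q' = parabolicD[OF q] and p' = parabolicD[OF p]
  have "q * p \<in> carrier (GL 4)" using m_closed q' p' by (metis mult_GL)
  then show "q * p \<in> parabolic_31"
    unfolding parabolic_31_iff using q' p' by (auto simp: mult_mat_4_index[of _ 4 _ 4] less_3 simp del: index_mult_mat(1))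
  show "levi (q * p) = levi q * levi p"
    using q' p' by (intro eq_matI)
      (auto simp: levi_def less_3 mult_mat_4_index[of _ 4 _ 4] mult_mat_3_index[of _ 3 _ 3] simp del: index_mult_mat(1))
  show "(q * p) $$ (3, 3) = q $$ (3, 3) * p $$ (3, 3)"
    using q' p' by (simp add: mult_mat_4_index[of _ 4 _ 4] del: index_mult_mat(1))
qed

lemma subgroup_parabolic: "subgroup (parabolic_31 :: 'a mat set) (GL 4)"
proof
  interpret group "GL 4 :: 'a mat monoid" by (rule group_GL)
  show "(parabolic_31 :: 'a mat set) \<subseteq> carrier (GL 4)" using parabolicD by auto
  show "x \<otimes>\<^bsub>GL 4\<^esub> y \<in> parabolic_31" if "x \<in> parabolic_31" "y \<in> parabolic_31" for x y :: "'a mat"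
    using parabolic_mult[OF that] by simp
  show "\<one>\<^bsub>GL 4\<^esub> \<in> (parabolic_31 :: 'a mat set)" using one_closed by (simp add: parabolic_31_iff)
  fix q :: "'a mat" assume q: "q \<in> parabolic_31"
  note q' = parabolicD[OF q] and inv = GL_inverse[OF parabolicD(1)[OF q]]
  have "(inv\<^bsub>GL 4\<^esub> q) $$ (3, j) = 0" if j: "j < 3" for j
  proof -
    have "(q * inv\<^bsub>GL 4\<^esub> q) $$ (3, j) = 0" using inv j by simp
    then have *: "q $$ (3, 3) * (inv\<^bsub>GL 4\<^esub> q) $$ (3, j) = 0"
      using j q' inv(1,2) by (subst (asm) mult_mat_4_index[of _ 4 _ 4]) auto
    obtain y where y: "q $$ (3, 3) * y = 1" using q'(4) unit_iff by auto
    have "(inv\<^bsub>GL 4\<^esub> q) $$ (3, j) = (q $$ (3, 3) * (inv\<^bsub>GL 4\<^esub> q) $$ (3, j)) * y"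
      using y by (metis mult.assoc mult.commute mult_1)
    then show ?thesis using * by simp
  qed
  then show "inv\<^bsub>GL 4\<^esub> q \<in> parabolic_31"
    unfolding parabolic_31_iff using inv_closed[OF q'(1)] by simp
qed

lemma levi_embed_parabolic:
  assumes "(h :: 'a mat) \<in> carrier (GL 3)" shows "levi_embed h \<in> parabolic_31"
  unfolding parabolic_31_iff using levi_embed_GL[OF assms] levi_embed_index(3) assms by (auto simp: carrier_GL_iff)

end

section \<open>The stabilizer of the open double coset\<close>

context length_two_ring
begin

lemma red_congruence:
  assumes "X \<in> carrier_mat n n"
  shows "red (1\<^sub>m n + w \<cdot>\<^sub>m X) = 1\<^sub>m n"
  using assms r_w_mult[of 1] by (intro eq_matI) (auto simp: r.hom_add r.hom_mult)

lemma centralizerD: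
  assumes "C \<in> carrier_mat n n" "g \<in> centralizer C"
  shows "g \<in> carrier (GL n)" "g \<in> carrier_mat n n" "red g * C = C * red g"
  using assms by (auto simp: centralizer_def carrier_GL)

lemma congruence_in_centralizer:
  assumes "C \<in> carrier_mat n n" "X \<in> carrier_mat n n"
  shows "1\<^sub>m n + w \<cdot>\<^sub>m X \<in> centralizer C"
  using assms red_congruence[OF assms(2)] by (auto simp: centralizer_def carrier_GL_iff simp del: r.hom_det)

lemma subgroup_centralizer:
  assumes C: "C \<in> carrier_mat n n"
  shows "subgroup (centralizer C) (GL n)"
proof
  interpret group "GL n :: 'a mat monoid" by (rule group_GL)
  show "centralizer C \<subseteq> carrier (GL n)" using centralizerD[OF C] by auto
  show "\<one>\<^bsub>GL n\<^esub> \<in> centralizer C"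
    using C one_closed by (simp add: centralizer_def red_one)
  fix g assume g: "g \<in> centralizer C"
  note g' = centralizerD[OF C g]
  have rg: "red g \<in> carrier_mat n n" using g' by simp
  {
    fix h assume h: "h \<in> centralizer C"
    note h' = centralizerD[OF C h]
    have rh: "red h \<in> carrier_mat n n" using h' by simp
    have "red (g * h) * C = red g * (red h * C)" unfolding red_mult[OF g'(2) h'(2)] by (rule assoc_mult_mat[OF rg rh C])
    also have "\<dots> = red g * C * red h" unfolding h'(3) by (rule assoc_mult_mat[OF rg C rh, symmetric])
    also have "\<dots> = C * red (g * h)" unfolding g'(3) red_mult[OF g'(2) h'(2)] by (rule assoc_mult_mat[OF C rg rh])
    finally show "g \<otimes>\<^bsub>GL n\<^esub> h \<in> centralizer C"
      using m_closed[OF g'(1) h'(1)] C by (simp add: centralizer_def)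
  }
  note i = GL_inverse[OF g'(1)]
  define a where "a = red g"
  define b where "b = red (inv\<^bsub>GL n\<^esub> g)"
  have ab: "a \<in> carrier_mat n n" "b \<in> carrier_mat n n" using i by (auto simp: a_def b_def)
  have one: "a * b = 1\<^sub>m n" "b * a = 1\<^sub>m n"
    using red_mult[OF i(1,2)] red_mult[OF i(2,1)] i by (simp_all add: a_def b_def red_one)
  have "b * C = (b * C) * (a * b)" using one ab C by simp
  also have "\<dots> = b * (C * a) * b" using ab C by (simp add: assoc_mult_mat[of _ n n _ n _ n])
  also have "\<dots> = b * (a * C) * b" using g'(3) by (simp add: a_def)
  also have "\<dots> = (b * a) * C * b" using ab C by (simp add: assoc_mult_mat[of _ n n _ n _ n])
  also have "\<dots> = C * b" using one ab C by simp
  finally show "inv\<^bsub>GL n\<^esub> g \<in> centralizer C"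
    using inv_closed[OF g'(1)] C by (simp add: centralizer_def b_def)
qed

definition unit_inv :: "'a \<Rightarrow> 'a" where "unit_inv x = (SOME y. x * y = 1)"

lemma unit_inv: "r x \<noteq> 0 \<Longrightarrow> x * unit_inv x = 1"
  unfolding unit_inv_def by (rule someI_ex) (simp add: unit_iff)

lemma unit_cancel: "r x \<noteq> 0 \<Longrightarrow> x * y = 0 \<Longrightarrow> y = 0"
  using unit_inv[of x] by (metis mult.assoc mult.commute mult_1 mult_zero_left)

text \<open>The stabilizer \<open>S\<close> of the open double coset and its character \<open>\<theta>\<close>, as a function of the values on
scalars.\<close>

definition open_stabilizer :: "'a mat set" where
  "open_stabilizer = {s \<in> carrier (GL 2). s $$ (0, 1) = 0 \<and> r (s $$ (0, 0)) = r (s $$ (1, 1)) \<and> r (s $$ (1, 0)) = 0}"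

definition open_character :: "('a \<Rightarrow> complex) \<Rightarrow> 'a mat \<Rightarrow> complex" where
  "open_character \<omega> s = \<omega> (s $$ (1, 1)) * \<psi> (s $$ (1, 0) * unit_inv (s $$ (1, 1)))"

definition unipotents :: "'a mat set" where "unipotents = unip ` carrier_mat 2 2"

definition unip_character :: "'a mat \<Rightarrow> complex" where
  "unip_character n = \<psi> (n $$ (0, 2) + n $$ (1, 3))"

lemma unip_character_unip: "X \<in> carrier_mat 2 2 \<Longrightarrow> unip_character (unip X) = \<psi> (mat_trace X)"
  by (simp add: unip_character_def unip_def mat_trace_def numeral_2_eq_2 numeral_3_eq_3)

lemma subgroup_unipotents: "subgroup unipotents (GL 4)"
proof
  show "unipotents \<subseteq> carrier (GL 4)" by (auto simp: unipotents_def unip_GL)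
  show "\<one>\<^bsub>GL 4\<^esub> \<in> unipotents" unfolding unipotents_def by (auto simp: unip_zero intro!: image_eqI[of _ _ "0\<^sub>m 2 2"])
qed (auto simp: unipotents_def unip_mult unip_GL)

lemma unip_character_mult:
  assumes "n \<in> unipotents" "n' \<in> unipotents"
  shows "unip_character (n * n') = unip_character n * unip_character n'"
proof -
  obtain X Y where "X \<in> carrier_mat 2 2" "Y \<in> carrier_mat 2 2" "n = unip X" "n' = unip Y"
    using assms by (auto simp: unipotents_def)
  then show ?thesis
    by (simp add: unip_mult unip_character_unip \<psi>_add[symmetric]) (simp add: mat_trace_def sum.distrib)
qed

lemma unip_character_conjugate:
  assumes "h \<in> carrier (GL 2)" "n \<in> unipotents"
  shows "diag_embed h * n * inv\<^bsub>GL 4\<^esub> (diag_embed h) \<in> unipotents \<and>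
    unip_character (diag_embed h * n * inv\<^bsub>GL 4\<^esub> (diag_embed h)) = unip_character n"
proof -
  note h = GL_inverse[OF assms(1)]
  obtain X where X: "X \<in> carrier_mat 2 2" "n = unip X" using assms(2) by (auto simp: unipotents_def)
  have hX: "h * X \<in> carrier_mat 2 2" using h(1) X(1) by (rule mult_carrier_mat)
  have c: "h * X * inv\<^bsub>GL 2\<^esub> h \<in> carrier_mat 2 2" using hX h(2) by (rule mult_carrier_mat)
  have "mat_trace (h * X * inv\<^bsub>GL 2\<^esub> h) = mat_trace (inv\<^bsub>GL 2\<^esub> h * (h * X))"
    by (rule mat_trace_comm[OF hX h(2)])
  also have "\<dots> = mat_trace X" using GL_cancel(3)[OF assms(1) X(1)] by simp
  finally show ?thesis
    unfolding X(2) conjugate_unip[OF assms(1) X(1)] using c X(1) by (simp add: unip_character_unip unipotents_def)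
qed

end

text \<open>A strongly cuspidal representation brought into normal form relative to \<open>\<chi>\<close>: the sign in
\<open>- \<kappa>\<close> lets the contributions of \<open>\<phi>\<close> and \<open>\<chi>\<close> to \<open>\<alpha>\<close> cancel on the stabilizer.\<close>

locale cuspidal_datum = length_two_ring w r \<psi>
  for w :: "'a::comm_ring_1" and r :: "'a \<Rightarrow> 'k::field" and \<psi> :: "'a \<Rightarrow> complex" +
  fixes D :: "'k mat" and \<phi> :: "'a mat \<Rightarrow> complex" and \<chi> :: "'a \<Rightarrow> complex" and \<kappa> :: 'k
  assumes form: "whittaker_form (- \<kappa>) D" and irr: "irreducible (char_poly D)"
    and \<phi>_mult: "g \<in> centralizer D \<Longrightarrow> h \<in> centralizer D \<Longrightarrow> \<phi> (g * h) = \<phi> g * \<phi> h"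
    and \<phi>_congruence: "X \<in> carrier_mat 3 3 \<Longrightarrow> \<phi> (1\<^sub>m 3 + w \<cdot>\<^sub>m X) = \<psi>\<^sub>k (mat_trace (D * red X))"
    and \<chi>_mult: "r x \<noteq> 0 \<Longrightarrow> r y \<noteq> 0 \<Longrightarrow> \<chi> (x * y) = \<chi> x * \<chi> y"
    and \<chi>_congruence: "\<chi> (1 + w * x) = \<psi>\<^sub>k (\<kappa> * r x)"
begin

lemma D_carrier: "D \<in> carrier_mat 3 3"
  using form by (simp add: whittaker_form_def)

lemma D_entries [simp]: "D $$ (0, 0) = 0" "D $$ (Suc 0, 0) = 0" "D $$ (2, 0) = 1"
     "D $$ (0, 2) = 0" "D $$ (Suc 0, 2) = 1" "D $$ (Suc 0, Suc 0) = - \<kappa>"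
  using form by (auto simp: whittaker_form_def)

lemma trace_D:
  assumes "X \<in> carrier_mat 3 3"
  shows "mat_trace (D * X) = D $$ (0, 1) * X $$ (1, 0) - \<kappa> * X $$ (1, 1) + X $$ (2, 1) + X $$ (0, 2) +
    D $$ (2, 1) * X $$ (1, 2) + D $$ (2, 2) * X $$ (2, 2)"
proof -
  have "D * X \<in> carrier_mat 3 3" using D_carrier assms by (rule mult_carrier_mat)
  then show ?thesis
    using D_carrier assms by (simp add: mat_trace_3 mult_mat_3_index[of _ 3 _ 3] del: index_mult_mat(1))
qed

lemma \<phi>_one: "\<phi> (1\<^sub>m 3) = 1"
proof -
  have "1\<^sub>m 3 + w \<cdot>\<^sub>m 0\<^sub>m 3 3 = 1\<^sub>m 3" by (intro eq_matI) auto
  then show ?thesis using \<phi>_congruence[of "0\<^sub>m 3 3"] trace_D[of "red (0\<^sub>m 3 3)"] by simp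
qed

lemma \<chi>_one: "\<chi> 1 = 1"
  using \<chi>_congruence[of 0] by simp

lemmas centralizerD' = centralizerD[OF D_carrier]

definition L :: "'a mat set" where
  "L = {q \<in> parabolic_31. levi q \<in> centralizer D}"

definition \<alpha> :: "'a mat \<Rightarrow> complex" where
  "\<alpha> q = \<chi> (q $$ (3, 3)) * \<phi> (levi q)"

text \<open>The value of \<open>\<alpha>\<close> on scalar matrices. The value zero at nonunits makes this function depend on the
central character alone.\<close>

definition central :: "'a \<Rightarrow> complex" where
  "central x = (if r x = 0 then 0 else \<chi> x * \<phi> (x \<cdot>\<^sub>m 1\<^sub>m 3))"

lemma LD: "l \<in> L \<Longrightarrow> l \<in> parabolic_31" "l \<in> L \<Longrightarrow> levi l \<in> centralizer D"
  by (auto simp: L_def)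

lemma levi_one: "levi (1\<^sub>m 4) = 1\<^sub>m 3"
  by (auto simp: levi_def intro!: eq_matI)

lemma subgroup_L: "subgroup L (GL 4)"
proof
  interpret group "GL 4 :: 'a mat monoid" by (rule group_GL)
  interpret J: group "GL 3 :: 'a mat monoid" by (rule group_GL)
  note J = subgroup_centralizer[OF D_carrier] and Q = subgroup_parabolic
  show "L \<subseteq> carrier (GL 4)" using LD parabolicD by auto
  show "\<one>\<^bsub>GL 4\<^esub> \<in> L"
    using subgroup.one_closed[OF J] subgroup.one_closed[OF Q] by (simp add: L_def levi_one)
  fix g assume g: "g \<in> L"
  note gQ = LD(1)[OF g]
  show "g \<otimes>\<^bsub>GL 4\<^esub> h \<in> L" if h: "h \<in> L" for h
    using parabolic_mult[OF gQ LD(1)[OF h]] subgroup.m_closed[OF J LD(2)[OF g] LD(2)[OF h]] by (simp add: L_def)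
  have iQ: "inv\<^bsub>GL 4\<^esub> g \<in> parabolic_31" using subgroup.m_inv_closed[OF Q gQ] .
  have "levi (inv\<^bsub>GL 4\<^esub> g) * levi g = 1\<^sub>m 3"
    using parabolic_mult(2)[OF iQ gQ] GL_inverse[OF parabolicD(1)[OF gQ]] by (simp add: levi_one)
  then have "inv\<^bsub>GL 3\<^esub> (levi g) = levi (inv\<^bsub>GL 4\<^esub> g)"
    using J.inv_equality[of "levi (inv\<^bsub>GL 4\<^esub> g)" "levi g"] parabolicD(3)[OF iQ] parabolicD(3)[OF gQ] by simp
  then show "inv\<^bsub>GL 4\<^esub> g \<in> L"
    using iQ subgroup.m_inv_closed[OF J LD(2)[OF g]] by (simp add: L_def)
qed

lemma \<alpha>_mult:
  assumes "l \<in> L" "l' \<in> L" shows "\<alpha> (l * l') = \<alpha> l * \<alpha> l'"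
  using parabolic_mult[OF LD(1)[OF assms(1)] LD(1)[OF assms(2)]] \<phi>_mult[OF LD(2)[OF assms(1)] LD(2)[OF assms(2)]]
    \<chi>_mult[OF parabolicD(4)[OF LD(1)[OF assms(1)]] parabolicD(4)[OF LD(1)[OF assms(2)]]]
  by (simp add: \<alpha>_def)

lemma \<alpha>_one: "\<alpha> (1\<^sub>m 4) = 1"
  by (simp add: \<alpha>_def levi_one \<phi>_one \<chi>_one)

lemma scalar_in_centralizer:
  assumes "r x \<noteq> 0" shows "x \<cdot>\<^sub>m 1\<^sub>m 3 \<in> centralizer D"
proof -
  have "red (x \<cdot>\<^sub>m 1\<^sub>m 3) = r x \<cdot>\<^sub>m 1\<^sub>m 3" by (intro eq_matI) auto
  moreover have "(r x \<cdot>\<^sub>m 1\<^sub>m 3) * D = D * (r x \<cdot>\<^sub>m 1\<^sub>m 3)"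
    using D_carrier mult_smult_distrib[OF D_carrier, of "1\<^sub>m 3" 3 "r x"]
      mult_smult_assoc_mat[OF _ D_carrier, of "1\<^sub>m 3" 3 "r x"] by simp
  moreover have "x \<cdot>\<^sub>m 1\<^sub>m 3 \<in> carrier (GL 3)"
  proof (rule inv_GL(1)[of "x \<cdot>\<^sub>m 1\<^sub>m 3" 3 "unit_inv x \<cdot>\<^sub>m 1\<^sub>m 3"])
    have "a \<cdot>\<^sub>m 1\<^sub>m 3 * (b \<cdot>\<^sub>m 1\<^sub>m 3) = (a * b) \<cdot>\<^sub>m (1\<^sub>m 3 :: 'a mat)" for a b
      using mult_smult_assoc_mat[of "1\<^sub>m 3" 3 3 "b \<cdot>\<^sub>m 1\<^sub>m 3" 3 a] by (auto intro!: eq_matI)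
    then show "x \<cdot>\<^sub>m 1\<^sub>m 3 * (unit_inv x \<cdot>\<^sub>m 1\<^sub>m 3) = 1\<^sub>m 3" "unit_inv x \<cdot>\<^sub>m 1\<^sub>m 3 * (x \<cdot>\<^sub>m 1\<^sub>m 3) = 1\<^sub>m 3"
      using unit_inv[OF assms] by (auto simp: mult.commute intro!: eq_matI)
  qed auto
  ultimately show ?thesis using D_carrier by (auto simp: centralizer_def)
qed

text \<open>Conjugation by \<open>\<gamma>\<close> puts the matrix with rows \<open>(s, s X)\<close> and \<open>(0, s)\<close> into the shape in which membership in the
parabolic subgroup and the Levi component can be read off.\<close>

lemma rotate_diag_unip_entries:
  assumes s: "s \<in> carrier_mat 2 2" and X: "X \<in> carrier_mat 2 2"
  defines "l \<equiv> rotate_mat (diag_embed s * unip X)" and "Z \<equiv> s * X"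
  shows "levi l = mat 3 3 (\<lambda>(i, j). if i = 0 then (if j = 0 then s $$ (1, 1) else if j = 1 then Z $$ (1, 0) else Z $$ (1, 1))
      else if i = 1 then (if j = 0 then 0 else if j = 1 then s $$ (0, 0) else s $$ (0, 1))
      else (if j = 0 then 0 else if j = 1 then s $$ (1, 0) else s $$ (1, 1)))"
    and "l $$ (3, 0) = s $$ (0, 1)" "l $$ (3, 1) = Z $$ (0, 0)" "l $$ (3, 2) = Z $$ (0, 1)" "l $$ (3, 3) = s $$ (0, 0)"
proof -
  have Z: "Z \<in> carrier_mat 2 2" unfolding Z_def using s X by (rule mult_carrier_mat)
  have l: "l = rotate_mat (four_block_mat s Z (0\<^sub>m 2 2) s)"
    unfolding l_def Z_def diag_unip[OF s X] ..
  show "l $$ (3, 0) = s $$ (0, 1)" "l $$ (3, 1) = Z $$ (0, 0)" "l $$ (3, 2) = Z $$ (0, 1)" "l $$ (3, 3) = s $$ (0, 0)"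
    unfolding l rotate_mat_def using s Z by simp_all
  show "levi l = mat 3 3 (\<lambda>(i, j). if i = 0 then (if j = 0 then s $$ (1, 1) else if j = 1 then Z $$ (1, 0) else Z $$ (1, 1))
      else if i = 1 then (if j = 0 then 0 else if j = 1 then s $$ (0, 0) else s $$ (0, 1))
      else (if j = 0 then 0 else if j = 1 then s $$ (1, 0) else s $$ (1, 1)))" (is "_ = ?R")
  proof (rule eq_matI)
    fix i j assume "i < dim_row ?R" "j < dim_col ?R"
    then have "i < 3" "j < 3" by auto
    then show "levi l $$ (i, j) = ?R $$ (i, j)"
      unfolding less_3 l rotate_mat_def levi_def using s Z by (elim disjE) simp_all
  qed (auto simp: levi_def)
qed

lemma open_stabilizer_entries:
  assumes "s \<in> carrier (GL 2)" "s $$ (0, 1) = 0"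
  shows "s \<in> carrier_mat 2 2" "r (s $$ (0, 0)) \<noteq> 0" "r (s $$ (1, 1)) \<noteq> 0"
proof -
  show s: "s \<in> carrier_mat 2 2" using assms by (simp add: carrier_GL)
  show "r (s $$ (0, 0)) \<noteq> 0" "r (s $$ (1, 1)) \<noteq> 0"
    using assms GL_2_det[OF s] by (auto simp: r.hom_mult)
qed

lemma \<phi>_scalar_congruence:
  assumes x: "r x \<noteq> 0" and X: "X \<in> carrier_mat 3 3"
    and M: "\<And>i j. i < 3 \<Longrightarrow> j < 3 \<Longrightarrow> M $$ (i, j) = x * ((if i = j then 1 else 0) + w * X $$ (i, j))" "M \<in> carrier_mat 3 3"
  shows "\<phi> M = \<phi> (x \<cdot>\<^sub>m 1\<^sub>m 3) * \<psi>\<^sub>k (mat_trace (D * red X))"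
proof -
  have "M = (x \<cdot>\<^sub>m 1\<^sub>m 3) * (1\<^sub>m 3 + w \<cdot>\<^sub>m X)"
    using mult_smult_assoc_mat[of "1\<^sub>m 3" 3 3 "1\<^sub>m 3 + w \<cdot>\<^sub>m X" 3 x] X M
    by (intro eq_matI) auto
  then show ?thesis
    using \<phi>_mult[OF scalar_in_centralizer[OF x] congruence_in_centralizer[OF D_carrier X]] \<phi>_congruence[OF X] by simp
qed

text \<open>By the shape of \<open>l = \<gamma> s n \<gamma>\<inverse>\<close>, the first column of its Levi component is a multiple of \<open>e\<^sub>0\<close>, so
commuting with \<open>D\<close> makes the component scalar modulo \<open>w\<close>; this is the condition \<open>s \<in> S\<close>. The Levi component is then a
scalar times a congruence matrix \<open>1 + w E\<close>, on which \<open>\<phi>\<close> is known. The diagonal entry of \<open>E\<close>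
contributes with the factor \<open>- \<kappa>\<close> through \<open>\<phi>\<close> and with the factor \<open>\<kappa>\<close> through \<open>\<chi>\<close>; the entry in the
top right corner accounts for \<open>\<psi>(n)\<close>, the one below the diagonal for the factor \<open>\<psi>\<close> of \<open>\<theta>(s)\<close>, and
the remaining one pairs with a zero of \<open>D\<close>.\<close>

lemma open_stabilizer_character:
  assumes l: "l \<in> L" and s: "s \<in> carrier (GL 2)" and n: "n \<in> unipotents"
    and eq: "l * cycle_mat = cycle_mat * diag_embed s * n"
  shows "s \<in> open_stabilizer \<and> \<alpha> l = open_character central s * unip_character n"
proof -
  obtain X where X: "X \<in> carrier_mat 2 2" "n = unip X" using n by (auto simp: unipotents_def)
  have sc: "s \<in> carrier_mat 2 2" using s by (simp add: carrier_GL)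
  have sd: "diag_embed s \<in> carrier_mat 4 4" and un: "unip X \<in> carrier_mat 4 4"
    using diag_embed_carrier[OF sc] unip_carrier[OF X(1)] .
  have F: "diag_embed s * unip X \<in> carrier_mat 4 4" using sd un by (rule mult_carrier_mat)
  define Z where "Z = s * X"
  have Z: "Z \<in> carrier_mat 2 2" unfolding Z_def using sc X(1) by (rule mult_carrier_mat)
  have Zij: "Z $$ (i, j) = s $$ (i, 0) * X $$ (0, j) + s $$ (i, 1) * X $$ (1, j)" if "i < 2" "j < 2" for i j
    unfolding Z_def by (rule mult_mat_2_index[OF sc X(1) that])
  have lQ: "l \<in> parabolic_31" and lJ: "levi l \<in> centralizer D" using LD[OF l] .
  note lp = parabolicD[OF lQ]
  have l_rot: "l = rotate_mat (diag_embed s * unip X)"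
  proof (rule cycle_mult_cancel[OF lp(2) rotate_mat_carrier])
    show "l * cycle_mat = rotate_mat (diag_embed s * unip X) * cycle_mat"
      unfolding rotate_mat_cycle[OF F] eq X(2) by (rule assoc_mult_mat[OF cycle_mat_carrier sd un])
  qed
  note entries = rotate_diag_unip_entries[OF sc X(1), folded l_rot Z_def]
  have s01: "s $$ (0, 1) = 0" and Z0: "Z $$ (0, 0) = 0" "Z $$ (0, 1) = 0"
    using entries lp by simp_all
  note su = open_stabilizer_entries(2,3)[OF s s01]
  have X0: "X $$ (0, 0) = 0" "X $$ (0, 1) = 0"
    using unit_cancel[OF su(1)] Zij[of 0 0] Zij[of 0 1] Z0 s01 by auto
  have scal: "red (levi l) = red (levi l) $$ (0, 0) \<cdot>\<^sub>m 1\<^sub>m 3"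
    by (rule whittaker_form_commutant_scalar[OF form]) (use centralizerD'[OF lJ] in \<open>auto simp: entries(1)\<close>)
  have red_entry: "r (levi l $$ (i, j)) = (if i = j then r (levi l $$ (0, 0)) else 0)" if "i < 3" "j < 3" for i j
    using arg_cong[OF scal, of "\<lambda>M. M $$ (i, j)"] that by (simp del: levi_carrier(2))
  have rs: "r (Z $$ (1, 0)) = r 0" "r (Z $$ (1, 1)) = r 0" "r (s $$ (0, 0)) = r (s $$ (1, 1))" "r (s $$ (1, 0)) = r 0"
    using red_entry[of 0 1] red_entry[of 0 2] red_entry[of 1 1] red_entry[of 2 1] by (simp_all add: entries(1))
  have sS: "s \<in> open_stabilizer" using s s01 rs by (simp add: open_stabilizer_def)
  define x where "x = s $$ (1, 1)"
  \<comment> \<open>From here on, \<open>x\<close> is the scalar and \<open>E\<close> the congruence part of the Levi component.\<close>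
  define v where "v = unit_inv x"
  have xv: "x * v = 1" unfolding v_def x_def by (rule unit_inv[OF su(2)])
  obtain y where y: "Z $$ (1, 0) = 0 + w * y" using rs(1) by (rule r_eqE)
  obtain z where z: "Z $$ (1, 1) = 0 + w * z" using rs(2) by (rule r_eqE)
  obtain a where a: "s $$ (0, 0) = x + w * a" unfolding x_def using rs(3) by (rule r_eqE)
  obtain g where g: "s $$ (1, 0) = 0 + w * g" using rs(4) by (rule r_eqE)
  have cancel: "x * (w * (b * v)) = w * b" for b
    using xv by (metis mult.assoc mult.commute mult_1)
  define E where "E = mat 3 3 (\<lambda>(i, j). if i = 0 \<and> j = 1 then y * v else if i = 0 \<and> j = 2 then z * v
     else if i = 1 \<and> j = 1 then a * v else if i = 2 \<and> j = 1 then g * v else 0)"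
  have E: "E \<in> carrier_mat 3 3" by (simp add: E_def)
  have "\<phi> (levi l) = \<phi> (x \<cdot>\<^sub>m 1\<^sub>m 3) * \<psi>\<^sub>k (mat_trace (D * red E))"
  proof (rule \<phi>_scalar_congruence[OF _ E])
    show "r x \<noteq> 0" using su by (simp add: x_def)
    fix i j :: nat assume "i < 3" "j < 3"
    then show "levi l $$ (i, j) = x * ((if i = j then 1 else 0) + w * E $$ (i, j))"
      unfolding less_3 by (elim disjE) (simp_all add: entries(1) E_def y[simplified] z[simplified] a g[simplified] s01[simplified] cancel distrib_left
        x_def[symmetric, simplified])
  qed simp
  also have "mat_trace (D * red E) = - \<kappa> * r (a * v) + r (g * v) + r (z * v)"
    using trace_D[of "red E"] E by (simp add: E_def)
  finally have \<phi>l: "\<phi> (levi l) = \<phi> (x \<cdot>\<^sub>m 1\<^sub>m 3) * \<psi>\<^sub>k (- \<kappa> * r (a * v) + r (g * v) + r (z * v))" .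
  have "l $$ (3, 3) = x * (1 + w * (a * v))"
    using entries(5) a cancel[of a] by (simp add: distrib_left)
  then have "\<chi> (l $$ (3, 3)) = \<chi> x * \<psi>\<^sub>k (\<kappa> * r (a * v))"
    using \<chi>_mult[of x "1 + w * (a * v)"] \<chi>_congruence[of "a * v"] su(2) r_w_mult[of "a * v"]
    by (simp add: x_def r.hom_add del: r_w_mult)
  then have "\<alpha> l = central x * (\<psi>\<^sub>k (\<kappa> * r (a * v)) * \<psi>\<^sub>k (- \<kappa> * r (a * v) + r (g * v) + r (z * v)))"
    unfolding \<alpha>_def \<phi>l central_def using su(2) by (simp add: x_def)
  also have "\<dots> = central x * (\<psi>\<^sub>k (r (g * v)) * \<psi>\<^sub>k (r (z * v)))"
    unfolding \<psi>\<^sub>k_add[symmetric] by simp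
  also have "\<psi>\<^sub>k (r (g * v)) = \<psi> (s $$ (1, 0) * v)"
    unfolding \<psi>\<^sub>k_r g by (simp add: mult.assoc)
  also have "\<psi>\<^sub>k (r (z * v)) = \<psi> (X $$ (1, 1))"
  proof -
    have "Z $$ (1, 1) = x * X $$ (1, 1)" using Zij[of 1 1] X0 by (simp add: x_def)
    then have wz: "w * z = x * X $$ (1, 1)" using z by simp
    have "w * (z * v) = (w * z) * v" by (simp only: mult.assoc)
    also have "\<dots> = X $$ (1, 1) * (x * v)" unfolding wz by (simp only: mult_ac)
    also have "\<dots> = X $$ (1, 1)" using xv by simp
    finally have "w * (z * v) = X $$ (1, 1)" .
    then show ?thesis unfolding \<psi>\<^sub>k_r by simp
  qed
  also have "\<psi> (X $$ (1, 1)) = unip_character n"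
    unfolding X(2) unip_character_unip[OF X(1)] using X(1) X0 by (simp add: mat_trace_def numeral_2_eq_2)
  finally show ?thesis using sS by (simp add: open_character_def x_def v_def)
qed

lemma open_stabilizer_realized:
  assumes s: "s \<in> open_stabilizer"
  shows "s \<in> carrier (GL 2) \<and> (\<exists>l\<in>L. l * cycle_mat = cycle_mat * diag_embed s \<and> \<alpha> l = open_character central s)"
proof
  show sG: "s \<in> carrier (GL 2)" using s by (simp add: open_stabilizer_def)
  have sc: "s \<in> carrier_mat 2 2" using sG by (simp add: carrier_GL)
  have sd: "diag_embed s \<in> carrier_mat 4 4" using diag_embed_carrier[OF sc] .
  have s01: "s $$ (0, 1) = 0" and rs: "r (s $$ (0, 0)) = r (s $$ (1, 1))" "r (s $$ (1, 0)) = 0"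
    using s by (auto simp: open_stabilizer_def)
  define l where "l = rotate_mat (diag_embed s * unip (0\<^sub>m 2 2))"
  have l: "l = rotate_mat (diag_embed s)" using sd by (simp add: l_def unip_zero)
  have Z: "s * 0\<^sub>m 2 2 = 0\<^sub>m 2 2" using sc by simp
  note entries = rotate_diag_unip_entries[OF sc, of "0\<^sub>m 2 2", folded l_def, unfolded Z]
  have lG: "l \<in> carrier (GL 4)" unfolding l by (rule rotate_mat_GL[OF diag_embed_GL(1)[OF sG]])
  have lQ: "l \<in> parabolic_31"
    unfolding parabolic_31_iff less_3 using lG s01 entries by auto
  have "red (levi l) = red (s $$ (1, 1) \<cdot>\<^sub>m 1\<^sub>m 3)"
  proof (rule eq_matI)
    fix i j assume "i < dim_row (red (s $$ (1, 1) \<cdot>\<^sub>m 1\<^sub>m 3))" "j < dim_col (red (s $$ (1, 1) \<cdot>\<^sub>m 1\<^sub>m 3))"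
    then have "i < 3" "j < 3" by auto
    then show "red (levi l) $$ (i, j) = red (s $$ (1, 1) \<cdot>\<^sub>m 1\<^sub>m 3) $$ (i, j)"
      unfolding less_3 by (elim disjE) (simp_all add: entries(1) s01[simplified] rs[simplified])
  qed (auto simp: levi_def)
  moreover have "s $$ (1, 1) \<cdot>\<^sub>m 1\<^sub>m 3 \<in> centralizer D"
    using scalar_in_centralizer open_stabilizer_entries(3)[OF sG s01] by simp
  ultimately have "levi l \<in> centralizer D"
    using parabolicD(3)[OF lQ] D_carrier by (auto simp: centralizer_def)
  then have lL: "l \<in> L" using lQ by (simp add: L_def)
  have eq: "l * cycle_mat = cycle_mat * diag_embed s" unfolding l by (rule rotate_mat_cycle[OF sd])
  have one: "1\<^sub>m 4 \<in> unipotents" using subgroup.one_closed[OF subgroup_unipotents] by simp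
  have "unip_character (1\<^sub>m 4) = 1"
    using unip_character_unip[of "0\<^sub>m 2 2"] by (simp add: unip_zero mat_trace_def \<psi>_zero)
  then have "\<alpha> l = open_character central s"
    using open_stabilizer_character[OF lL sG one] eq right_mult_one_mat[OF mult_carrier_mat[OF cycle_mat_carrier sd]] by simp
  then show "\<exists>l\<in>L. l * cycle_mat = cycle_mat * diag_embed s \<and> \<alpha> l = open_character central s"
    using lL eq by blast
qed

section \<open>The support of Whittaker functions\<close>

text \<open>The alternative that Mackey's argument requires for representatives \<open>g\<close>: it lies in the open double coset,
or the functions in question vanish at it.\<close>

definition supported :: "'a mat \<Rightarrow> bool" where
  "supported g \<longleftrightarrow> (\<exists>l\<in>L. \<exists>h\<in>carrier (GL 2). \<exists>n\<in>unipotents. g = l * cycle_mat * diag_embed h * n) \<or>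
     (\<exists>l\<in>L. \<exists>n\<in>unipotents. l * g = g * n \<and> \<alpha> l \<noteq> unip_character n)"

text \<open>Let \<open>(a, b)\<close> be the last row of \<open>g\<close>, where \<open>a\<close> is divisible by \<open>w\<close>. For \<open>X = w y u b\<close> with a column \<open>u\<close>,
right multiplication by \<open>unip X\<close> adds multiples of \<open>w (0, b) = w (a, b)\<close> to the rows of \<open>g\<close>, which is
the same as left multiplication by an element of the unipotent radical of the parabolic subgroup. There
\<open>\<alpha>\<close> is trivial, but \<open>\<psi>(X) = \<psi>(w y)\<close> when \<open>b u = 1\<close>.\<close>

lemma degenerate_row_killed:
  assumes g: "g \<in> carrier (GL 4)" and a: "r (g $$ (3, 0)) = 0" "r (g $$ (3, 1)) = 0"
  shows "supported g"
proof -
  have gc: "g \<in> carrier_mat 4 4" using g by (simp add: carrier_GL)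
  have "\<not> (r (g $$ (3, 2)) = 0 \<and> r (g $$ (3, 3)) = 0)"
  proof
    assume b: "r (g $$ (3, 2)) = 0 \<and> r (g $$ (3, 3)) = 0"
    note g' = GL_inverse[OF g]
    have "r ((g * inv\<^bsub>GL 4\<^esub> g) $$ (3, 3)) = 0"
      using a b mult_mat_4_index[OF g'(1,2), of 3 3] by (simp add: r.hom_add r.hom_mult del: index_mult_mat(1))
    then show False using g' by simp
  qed
  then obtain u0 u1 where u: "g $$ (3, 2) * u0 + g $$ (3, 3) * u1 = 1"
  proof (cases "r (g $$ (3, 2)) = 0")
    case True
    then have "r (g $$ (3, 3)) \<noteq> 0" using \<open>\<not> (r (g $$ (3, 2)) = 0 \<and> r (g $$ (3, 3)) = 0)\<close> by simp
    then show ?thesis using that[of 0 "unit_inv (g $$ (3, 3))"] unit_inv by simp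
  next
    case False
    then show ?thesis using that[of "unit_inv (g $$ (3, 2))" 0] unit_inv by simp
  qed
  obtain y where y: "\<psi> (w * y) \<noteq> 1" using \<psi>_nontrivial by auto
  define X where "X = mat 2 2 (\<lambda>(i, j). w * y * (if i = 0 then u0 else u1) * g $$ (3, j + 2))"
  define c where "c i = w * y * (g $$ (i, 0) * u0 + g $$ (i, 1) * u1)" for i
  define l where "l = mat 4 4 (\<lambda>(i, j). (if i = j then 1 else 0) + (if j = 3 then c i else 0))"
  have X: "X \<in> carrier_mat 2 2" by (simp add: X_def)
  have l: "l \<in> carrier_mat 4 4" by (simp add: l_def)
  have w0: "w * g $$ (3, 0) = 0" "w * g $$ (3, 1) = 0"
    using w_mult_eq_iff[of "g $$ (3, 0)" 0] w_mult_eq_iff[of "g $$ (3, 1)" 0] a by simp_all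
  have w0': "w * (b * g $$ (3, 0)) = 0" "w * (b * g $$ (3, 1)) = 0" for b
    using w0 by (metis mult.left_commute mult_zero_right)+
  have c3: "c 3 = 0"
    unfolding c_def using w0'[of "y * u0"] w0'[of "y * u1"] by (simp add: algebra_simps)
  have levi: "levi l = 1\<^sub>m 3" by (auto simp: levi_def l_def intro!: eq_matI)
  have "red l = 1\<^sub>m 4"
    by (rule eq_matI) (auto simp: l_def c_def r.hom_add r.hom_mult r_w_mult[of 1, simplified])
  then have "l \<in> carrier (GL 4)" using l by (simp add: carrier_GL_iff del: r.hom_det)
  then have lQ: "l \<in> parabolic_31" by (auto simp: parabolic_31_iff l_def)
  have lL: "l \<in> L"
    using lQ levi subgroup.one_closed[OF subgroup_centralizer[OF D_carrier]] by (simp add: L_def)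
  have \<alpha>: "\<alpha> l = 1" using levi c3 by (simp add: \<alpha>_def \<phi>_one \<chi>_one l_def)
  have "l * g = g * unip X"
  proof (rule eq_matI)
    fix i j assume "i < dim_row (g * unip X)" "j < dim_col (g * unip X)"
    then have ij: "i < 4" "j < 4" using gc unip_carrier[OF X] by auto
    have lhs: "(l * g) $$ (i, j) = g $$ (i, j) + c i * g $$ (3, j)"
      unfolding mult_mat_4_index[OF l gc ij] using ij c3 unfolding less_4 by (elim disjE) (simp_all add: l_def)
    have rhs: "(g * unip X) $$ (i, j) = g $$ (i, j) + (if j < 2 then 0 else g $$ (i, 0) * X $$ (0, j - 2) + g $$ (i, 1) * X $$ (1, j - 2))"
      unfolding mult_mat_4_index[OF gc unip_carrier[OF X] ij]
      using ij(2) X unfolding less_4 by (elim disjE) (simp_all add: unip_def)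
    show "(l * g) $$ (i, j) = (g * unip X) $$ (i, j)"
      unfolding lhs rhs using ij(2) w0'[of "y * (g $$ (i, 0) * u0 + g $$ (i, 1) * u1)"] unfolding less_4
      by (elim disjE) (simp_all add: c_def X_def algebra_simps numeral_2_eq_2 numeral_3_eq_3)
  qed (use l gc X in \<open>auto simp: unip_def\<close>)
  moreover have "unip_character (unip X) \<noteq> 1"
  proof -
    have "mat_trace X = w * y * (g $$ (3, 2) * u0 + g $$ (3, 3) * u1)"
      using X by (simp add: mat_trace_def numeral_2_eq_2) (simp add: X_def algebra_simps numeral_2_eq_2 numeral_3_eq_3)
    then show ?thesis using y u by (simp add: unip_character_unip[OF X])
  qed
  ultimately show ?thesis
    unfolding supported_def using lL \<alpha> X by (intro disjI2 bexI[of _ l] bexI[of _ "unip X"]) (auto simp: unipotents_def)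
qed

text \<open>If the first half of the last row is primitive, \<open>GL\<^sub>2\<close> and \<open>N\<close> move the last row to that of \<open>\<gamma>\<close>.\<close>

lemma parabolic_cycle_decomposition:
  assumes g: "g \<in> carrier (GL 4)" and a: "r (g $$ (3, 0)) \<noteq> 0 \<or> r (g $$ (3, 1)) \<noteq> 0"
  shows "\<exists>q\<in>parabolic_31. \<exists>h\<in>carrier (GL 2). \<exists>n\<in>unipotents. g = q * cycle_mat * diag_embed h * n"
proof -
  interpret group "GL 4 :: 'a mat monoid" by (rule group_GL)
  have gc: "g \<in> carrier_mat 4 4" using g by (simp add: carrier_GL)
  \<comment> \<open>The row \<open>(c, d)\<close> completes the first half of the last row of \<open>g\<close> to an invertible matrix.\<close>
  obtain u0 u1 c d where u: "g $$ (3, 0) * u0 + g $$ (3, 1) * u1 = 1"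
    and cd: "r (g $$ (3, 0) * d - g $$ (3, 1) * c) \<noteq> 0"
  proof (cases "r (g $$ (3, 0)) = 0")
    case True
    then have "r (g $$ (3, 1)) \<noteq> 0" using a by simp
    then show ?thesis using that[of 0 "unit_inv (g $$ (3, 1))" 0 1] unit_inv by (simp add: r.hom_uminus)
  next
    case False
    then show ?thesis using that[of "unit_inv (g $$ (3, 0))" 0 1 0] unit_inv by simp
  qed
  define s where "s = mat 2 2 (\<lambda>(i, j). if i = 0 then g $$ (3, j) else if j = 0 then c else d)"
  define X where "X = mat 2 2 (\<lambda>(i, j). (if i = 0 then u0 else u1) * g $$ (3, j + 2))"
  have sc: "s \<in> carrier_mat 2 2" and X: "X \<in> carrier_mat 2 2" by (auto simp: s_def X_def)
  have s: "s \<in> carrier (GL 2)" unfolding GL_2_det[OF sc] using cd by (simp add: s_def)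
  have sd: "diag_embed s \<in> carrier_mat 4 4" and un: "unip X \<in> carrier_mat 4 4"
    using diag_embed_carrier[OF sc] unip_carrier[OF X] .
  have sX: "s * X \<in> carrier_mat 2 2" using sc X by (rule mult_carrier_mat)
  define M where "M = cycle_mat * (diag_embed s * unip X)"
  have M: "M \<in> carrier (GL 4)"
    unfolding M_def using cycle_mat_GL diag_embed_GL(1)[OF s] unip_GL(1)[OF X] m_closed by (metis mult_GL)
  note M' = GL_inverse[OF M]
  have Mrow: "M $$ (3, j) = g $$ (3, j)" if j: "j < 4" for j
  proof -
    have "M $$ (3, j) = (diag_embed s * unip X) $$ (0, j)"
      unfolding M_def using cycle_mult_index[OF mult_carrier_mat[OF sd un], of 3 j] j
      by (simp del: index_mult_mat(1))
    then have "M $$ (3, j) = four_block_mat s (s * X) (0\<^sub>m 2 2) s $$ (0, j)"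
      unfolding diag_unip[OF sc X] .
    moreover have "(s * X) $$ (0, k) = g $$ (3, k + 2)" if k: "k < 2" for k
    proof -
      have "(s * X) $$ (0, k) = (g $$ (3, 0) * u0 + g $$ (3, 1) * u1) * g $$ (3, k + 2)"
        unfolding mult_mat_2_index[OF sc X zero_less_numeral k] using k by (simp add: s_def X_def algebra_simps)
      then show ?thesis unfolding u by simp
    qed
    from this[of 0] this[of 1] have "(s * X) $$ (0, 0) = g $$ (3, 2)" "(s * X) $$ (0, 1) = g $$ (3, 3)"
      by (simp_all add: numeral_3_eq_3 numeral_2_eq_2)
    ultimately show ?thesis using j sc sX unfolding less_4
      by (elim disjE) (simp_all add: s_def)
  qed
  define q where "q = g * inv\<^bsub>GL 4\<^esub> M"
  have qM: "q * M = g" unfolding q_def by (rule GL_cancel(1)[OF M gc])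
  have qG: "q \<in> carrier (GL 4)" unfolding q_def using g M by (metis m_closed inv_closed mult_GL)
  have qc: "q \<in> carrier_mat 4 4" using qG by (simp add: carrier_GL)
  have "q $$ (3, j) = 0" if j: "j < 3" for j
  proof -
    have j4: "j < 4" using j by simp
    have "q $$ (3, j) = (M * inv\<^bsub>GL 4\<^esub> M) $$ (3, j)"
      unfolding q_def mult_mat_4_index[OF gc M'(2) _ j4, of 3, simplified] mult_mat_4_index[OF M'(1,2) _ j4, of 3, simplified]
      using Mrow[of 0] Mrow[of 1] Mrow[of 2] Mrow[of 3] by simp
    then show ?thesis unfolding M'(3) using j by simp
  qed
  then have "q \<in> parabolic_31" unfolding parabolic_31_iff using qG by simp
  moreover have "g = q * cycle_mat * diag_embed s * unip X"
    unfolding qM[symmetric] M_def by (rule assoc_four_mat[OF qc cycle_mat_carrier sd un])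
  ultimately show ?thesis using s X unfolding unipotents_def by blast
qed

text \<open>Because the commutant of \<open>D\<close> is transitive on nonzero vectors over \<open>k\<close>, an element of the
centralizer can be chosen whose first column is exactly that of \<open>h\<close>.\<close>

lemma centralizer_decomposition:
  assumes h: "h \<in> carrier (GL 3)"
  shows "\<exists>j\<in>centralizer D. \<exists>m\<in>carrier (GL 3). h = j * m \<and> m $$ (0, 0) = 1 \<and> m $$ (1, 0) = 0 \<and> m $$ (2, 0) = 0"
proof -
  interpret group "GL 3 :: 'a mat monoid" by (rule group_GL)
  have hc: "h \<in> carrier_mat 3 3" and det: "det (red h) \<noteq> 0"
    using h by (auto simp: carrier_GL_iff simp del: r.hom_det)
  define v where "v = col (red h) 0"
  have v: "v \<in> carrier_vec 3" unfolding v_def using hc by (intro carrier_vecI) simp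
  have "v \<noteq> 0\<^sub>v 3"
  proof
    assume "v = 0\<^sub>v 3"
    moreover have "red h *\<^sub>v unit_vec 3 0 = v"
      unfolding v_def using hc by (intro eq_vecI) auto
    ultimately show False
      using det_0_iff_vec_prod_zero_field[of "red h" 3] hc det unit_vec_carrier[of 3 0] by (metis map_carrier_mat unit_vec_nonzero zero_less_numeral)
  qed
  then obtain j0 where j0: "j0 \<in> carrier_mat 3 3" "det j0 \<noteq> 0" "j0 * D = D * j0" "col j0 0 = v"
    using whittaker_form_commutant_transitive[OF form irr v] by blast
  obtain j1 where j1: "j1 \<in> carrier_mat 3 3" "red j1 = j0" using lift_mat[OF j0(1)] .
  define j where "j = mat 3 3 (\<lambda>(a, b). if b = 0 then h $$ (a, 0) else j1 $$ (a, b))"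
  have jc: "j \<in> carrier_mat 3 3" by (simp add: j_def)
  have "red j = j0"
  proof (rule eq_matI)
    fix a b assume "a < dim_row j0" "b < dim_col j0"
    then have ab: "a < 3" "b < 3" using j0 by auto
    have "j0 $$ (a, 0) = r (h $$ (a, 0))"
      using arg_cong[OF j0(4), of "\<lambda>x. x $ a"] ab j0(1) hc by (simp add: v_def)
    moreover have "j0 $$ (a, b) = r (j1 $$ (a, b))" using j1 ab by auto
    ultimately show "red j $$ (a, b) = j0 $$ (a, b)" using ab by (auto simp: j_def)
  qed (use j0 in \<open>auto simp: j_def\<close>)
  then have jG: "j \<in> carrier (GL 3)" and jJ: "j \<in> centralizer D"
    using jc j0 D_carrier by (auto simp: carrier_GL_iff centralizer_def simp del: r.hom_det)
  note j' = GL_inverse[OF jG]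
  define m where "m = inv\<^bsub>GL 3\<^esub> j * h"
  have mG: "m \<in> carrier (GL 3)" unfolding m_def using h jG by (metis m_closed inv_closed mult_GL)
  have "h = j * m" unfolding m_def using GL_cancel(4)[OF jG hc] by simp
  moreover have "m $$ (i, 0) = 1\<^sub>m 3 $$ (i, 0)" if i: "i < 3" for i
  proof -
    have "m $$ (i, 0) = (inv\<^bsub>GL 3\<^esub> j * j) $$ (i, 0)"
      unfolding m_def mult_mat_3_index[OF j'(2) hc i zero_less_numeral] mult_mat_3_index[OF j'(2) jc i zero_less_numeral]
      by (simp add: j_def)
    then show ?thesis using j' by simp
  qed
  from this[of 0] this[of 1] this[of 2] have "m $$ (0, 0) = 1" "m $$ (1, 0) = 0" "m $$ (2, 0) = 0" by simp_all
  ultimately show ?thesis using jJ mG by blast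
qed

text \<open>For \<open>A = 1 + w E\<close>, with \<open>E\<close> concentrated in the row \<open>(0, y\<^sub>1, y\<^sub>2)\<close>, moving \<open>A\<close> past \<open>m \<gamma>\<close> gives an
element of \<open>N\<close>. Its character is \<open>\<psi>(w (y\<^sub>1 m\<^sub>1\<^sub>2 + y\<^sub>2 m\<^sub>2\<^sub>2))\<close>, whereas \<open>\<alpha>(A) = \<psi>(w y\<^sub>2)\<close> by the shape
of \<open>D\<close>. These agree for all \<open>y\<^sub>1, y\<^sub>2\<close> only if \<open>m\<^sub>1\<^sub>2\<close> and \<open>m\<^sub>2\<^sub>2\<close> reduce to zero and one.\<close>

lemma supported_unless_second_column:
  assumes m: "m \<in> carrier (GL 3)" and col: "m $$ (0, 0) = 1" "m $$ (1, 0) = 0" "m $$ (2, 0) = 0"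
    and not: "\<not> supported (levi_embed m * cycle_mat)"
  shows "r (m $$ (1, 2)) = 0 \<and> r (m $$ (2, 2)) = 1"
proof -
  have mc: "m \<in> carrier_mat 3 3" using m by (simp add: carrier_GL)
  have lm: "levi_embed m \<in> carrier_mat 4 4" using levi_embed_carrier[OF mc] .
  have key: "\<psi>\<^sub>k (r y2) = \<psi>\<^sub>k (r y1 * r (m $$ (1, 2)) + r y2 * r (m $$ (2, 2)))" for y1 y2
  proof -
    define E where "E = mat 3 3 (\<lambda>(i, j). if i = 0 \<and> j = 1 then y1 else if i = 0 \<and> j = 2 then y2 else 0)"
    define A where "A = 1\<^sub>m 3 + w \<cdot>\<^sub>m E"
    define x where "x j = w * (y1 * m $$ (1, j) + y2 * m $$ (2, j))" for j
    define X where "X = mat 2 2 (\<lambda>(i, j). if i = 0 then 0 else x (j + 1))"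
    define B where "B = mat 3 3 (\<lambda>(i, j). if i = 0 \<and> j \<noteq> 0 then x j else if i = j then 1 else 0)"
    have E: "E \<in> carrier_mat 3 3" and X: "X \<in> carrier_mat 2 2" and B: "B \<in> carrier_mat 3 3"
      by (auto simp: E_def X_def B_def)
    have A: "A \<in> carrier_mat 3 3" using E by (simp add: A_def)
    have AJ: "A \<in> centralizer D" unfolding A_def by (rule congruence_in_centralizer[OF D_carrier E])
    have AQ: "levi_embed A \<in> parabolic_31" by (rule levi_embed_parabolic[OF centralizerD'(1)[OF AJ]])
    have lL: "levi_embed A \<in> L" using AQ AJ levi_embed_index(1)[OF A] by (simp add: L_def)
    have "A * m = m * B"
    proof (rule eq_matI)
      fix i j assume "i < dim_row (m * B)" "j < dim_col (m * B)"
      then have ij: "i < 3" "j < 3" using mc B by auto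
      show "(A * m) $$ (i, j) = (m * B) $$ (i, j)"
        unfolding mult_mat_3_index[OF A mc ij] mult_mat_3_index[OF mc B ij]
        using ij unfolding less_3
        by (elim disjE) (simp_all add: A_def E_def B_def x_def col col[simplified] algebra_simps)
    qed (use A B mc in auto)
    have rot: "rotate_mat (unip X) = levi_embed B"
    proof (rule eq_matI)
      fix i j assume "i < dim_row (levi_embed B)" "j < dim_col (levi_embed B)"
      then have "i < 4" "j < 4" using levi_embed_carrier[OF B] by auto
      then show "rotate_mat (unip X) $$ (i, j) = levi_embed B $$ (i, j)"
        unfolding less_4 by (elim disjE) (simp_all add: rotate_mat_def unip_def levi_embed_def B_def X_def numeral_2_eq_2[symmetric])
    qed (use levi_embed_carrier[OF B] in \<open>auto simp: rotate_mat_def\<close>)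
    have eq: "levi_embed A * (levi_embed m * cycle_mat) = (levi_embed m * cycle_mat) * unip X"
    proof -
      have "levi_embed A * (levi_embed m * cycle_mat) = levi_embed (A * m) * cycle_mat"
        unfolding levi_embed_mult[OF A mc, symmetric]
        by (rule assoc_mult_mat[OF levi_embed_carrier[OF A] lm cycle_mat_carrier, symmetric])
      also have "\<dots> = levi_embed m * levi_embed B * cycle_mat"
        unfolding \<open>A * m = m * B\<close> levi_embed_mult[OF mc B] ..
      also have "\<dots> = levi_embed m * (cycle_mat * unip X)"
        unfolding rotate_mat_cycle[OF unip_carrier[OF X], symmetric] rot
        by (rule assoc_mult_mat[OF lm levi_embed_carrier[OF B] cycle_mat_carrier])
      also have "\<dots> = (levi_embed m * cycle_mat) * unip X"
        by (rule assoc_mult_mat[OF lm cycle_mat_carrier unip_carrier[OF X], symmetric])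
      finally show ?thesis .
    qed
    have "\<alpha> (levi_embed A) = \<psi>\<^sub>k (mat_trace (D * red E))"
      unfolding \<alpha>_def levi_embed_index(1,2)[OF A] using \<phi>_congruence[OF E] by (simp add: \<chi>_one A_def)
    also have "mat_trace (D * red E) = r y2"
      using trace_D[of "red E"] E by (simp add: E_def)
    finally have \<alpha>: "\<alpha> (levi_embed A) = \<psi>\<^sub>k (r y2)" .
    have "unip_character (unip X) = \<psi> (x 2)"
      unfolding unip_character_unip[OF X] by (simp add: X_def mat_trace_def numeral_2_eq_2)
    also have "\<dots> = \<psi>\<^sub>k (r y1 * r (m $$ (1, 2)) + r y2 * r (m $$ (2, 2)))"
      unfolding x_def \<psi>\<^sub>k_r[symmetric] by (simp add: r.hom_add r.hom_mult)
    finally show ?thesis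
      using not lL X eq \<alpha> unfolding supported_def unipotents_def by fastforce
  qed
  have "r (m $$ (1, 2)) = 0"
  proof (rule \<psi>\<^sub>k_nondegenerate)
    fix t obtain y where "r y = t" using lift .
    then show "\<psi>\<^sub>k (r (m $$ (1, 2)) * t) = \<psi>\<^sub>k (0 * t)" using key[of 0 y] by (simp add: mult.commute)
  qed
  moreover have "r (m $$ (2, 2)) = 1"
  proof (rule \<psi>\<^sub>k_nondegenerate)
    fix t obtain y where "r y = t" using lift .
    then show "\<psi>\<^sub>k (r (m $$ (2, 2)) * t) = \<psi>\<^sub>k (1 * t)" using key[of y 0] by (simp add: mult.commute)
  qed
  ultimately show ?thesis by simp
qed

text \<open>The reduction of such an \<open>m\<close> is that of the Levi component of \<open>\<gamma> b n \<gamma>\<inverse>\<close> for suitable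
\<open>b \<in> GL\<^sub>2\<close> and \<open>n \<in> N\<close>, and the quotient of the two, being trivial modulo \<open>w\<close>, lies in \<open>L\<close>.\<close>

lemma supported_second_column:
  assumes m: "m \<in> carrier (GL 3)" and col: "m $$ (0, 0) = 1" "m $$ (1, 0) = 0" "m $$ (2, 0) = 0"
    and col2: "r (m $$ (1, 2)) = 0" "r (m $$ (2, 2)) = 1"
  shows "supported (levi_embed m * cycle_mat)"
proof -
  interpret group "GL 4 :: 'a mat monoid" by (rule group_GL)
  note m' = GL_inverse[OF m]
  have mc: "m \<in> carrier_mat 3 3" using m' by simp
  have lm: "levi_embed m \<in> carrier_mat 4 4" using levi_embed_carrier[OF mc] .
  have m11: "r (m $$ (1, 1)) \<noteq> 0"
  proof
    assume "r (m $$ (1, 1)) = 0"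
    then have "r ((m * inv\<^bsub>GL 3\<^esub> m) $$ (1, 1)) = 0"
      using col col2 by (subst mult_mat_3_index[OF m'(1,2)]) (simp_all add: r.hom_add r.hom_mult)
    then show False using m' by simp
  qed
  define b where "b = mat 2 2 (\<lambda>(i, j). if j = 0 then m $$ (i + 1, 1) else if i = 0 then 0 else 1)"
  define X where "X = mat 2 2 (\<lambda>(i, j). if i = 0 then 0 else m $$ (0, j + 1))"
  have bc: "b \<in> carrier_mat 2 2" and X: "X \<in> carrier_mat 2 2" by (auto simp: b_def X_def)
  have b: "b \<in> carrier (GL 2)" unfolding GL_2_det[OF bc] using m11 by (simp add: b_def)
  have bd: "diag_embed b \<in> carrier_mat 4 4" and un: "unip X \<in> carrier_mat 4 4"
    using diag_embed_carrier[OF bc] unip_carrier[OF X] .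
  have F: "diag_embed b * unip X \<in> carrier_mat 4 4" using bd un by (rule mult_carrier_mat)
  define Q where "Q = rotate_mat (diag_embed b * unip X)"
  note entries = rotate_diag_unip_entries[OF bc X, folded Q_def]
  have Z: "(b * X) $$ (i, j) = (if i = 0 then 0 else m $$ (0, j + 1))" if "i < 2" "j < 2" for i j
    unfolding mult_mat_2_index[OF bc X that] using that by (auto simp: b_def X_def)
  have Z1: "(b * X) $$ (Suc 0, 0) = m $$ (0, Suc 0)" "(b * X) $$ (Suc 0, Suc 0) = m $$ (0, 2)"
    using Z[of 1 0] Z[of 1 1] by (simp_all add: numeral_2_eq_2)
  have bij: "b $$ (0, 0) = m $$ (Suc 0, Suc 0)" "b $$ (0, Suc 0) = 0" "b $$ (Suc 0, 0) = m $$ (2, Suc 0)" "b $$ (Suc 0, Suc 0) = 1"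
    by (simp_all add: b_def numeral_2_eq_2)
  have "diag_embed b * unip X \<in> carrier (GL 4)"
    using diag_embed_GL(1)[OF b] unip_GL(1)[OF X] m_closed by (metis mult_GL)
  then have QG: "Q \<in> carrier (GL 4)" unfolding Q_def by (rule rotate_mat_GL)
  have QQ: "Q \<in> parabolic_31"
    unfolding parabolic_31_iff less_3 using QG entries Z by (auto simp: b_def)
  have levi_Q: "red (levi Q) = red m"
  proof (rule eq_matI)
    fix i j assume "i < dim_row (red m)" "j < dim_col (red m)"
    then have ij: "i < 3" "j < 3" using mc by auto
    have "red (levi Q) $$ (i, j) = r (levi Q $$ (i, j))" "red m $$ (i, j) = r (m $$ (i, j))"
      using ij mc by (auto simp del: levi_carrier(2))
    moreover have "r (levi Q $$ (i, j)) = r (m $$ (i, j))"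
      using ij unfolding less_3
      by (elim disjE) (simp_all add: entries(1) Z1 bij col col[simplified] col2 col2[simplified] numeral_2_eq_2[symmetric] del: index_mult_mat(1))
    ultimately show "red (levi Q) $$ (i, j) = red m $$ (i, j)" by simp
  qed (use mc in auto)
  define l where "l = levi_embed m * inv\<^bsub>GL 4\<^esub> Q"
  have lQ: "l * Q = levi_embed m" unfolding l_def by (rule GL_cancel(1)[OF QG lm])
  have lP: "l \<in> parabolic_31"
    unfolding l_def using subgroup.m_closed[OF subgroup_parabolic levi_embed_parabolic[OF m] subgroup.m_inv_closed[OF subgroup_parabolic QQ]]
    by simp
  have "levi l * levi Q = m" using parabolic_mult(2)[OF lP QQ] lQ levi_embed_index(1)[OF mc] by simp
  then have "red (levi l) * red m = red m" using red_mult[of "levi l" 3 3 "levi Q" 3] levi_Q by simp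
  then have "red (levi l) * red m * red (inv\<^bsub>GL 3\<^esub> m) = red m * red (inv\<^bsub>GL 3\<^esub> m)" by simp
  moreover have mm: "red m * red (inv\<^bsub>GL 3\<^esub> m) = 1\<^sub>m 3" using red_mult[OF m'(1,2)] m'(3) by (simp add: red_one)
  moreover have "red (levi l) * red m * red (inv\<^bsub>GL 3\<^esub> m) = red (levi l) * (red m * red (inv\<^bsub>GL 3\<^esub> m))"
    by (rule assoc_mult_mat[of _ 3 3 _ 3 _ 3]) (use m' in auto)
  ultimately have "red (levi l) = 1\<^sub>m 3" by simp
  then have "levi l \<in> centralizer D"
    using parabolicD(3)[OF lP] D_carrier by (simp add: centralizer_def)
  then have lL: "l \<in> L" using lP by (simp add: L_def)
  have lc: "l \<in> carrier_mat 4 4" using parabolicD(2)[OF lP] .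
  have Qc: "Q \<in> carrier_mat 4 4" using parabolicD(2)[OF QQ] .
  have "levi_embed m * cycle_mat = l * (Q * cycle_mat)"
    unfolding lQ[symmetric] by (rule assoc_mult_mat[OF lc Qc cycle_mat_carrier])
  also have "\<dots> = l * (cycle_mat * (diag_embed b * unip X))" unfolding Q_def rotate_mat_cycle[OF F] ..
  also have "\<dots> = l * cycle_mat * diag_embed b * unip X"
    by (rule assoc_four_mat[OF lc cycle_mat_carrier bd un])
  finally show ?thesis unfolding supported_def unipotents_def using lL b X by blast
qed

lemma supported_all:
  assumes g: "g \<in> carrier (GL 4)"
  shows "\<exists>l\<in>L. \<exists>x\<in>carrier (GL 4). \<exists>h\<in>carrier (GL 2). \<exists>n\<in>unipotents. g = l * x * diag_embed h * n \<and> supported x"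
proof (cases "r (g $$ (3, 0)) = 0 \<and> r (g $$ (3, 1)) = 0")
  case True
  have "1\<^sub>m 2 \<in> carrier (GL 2)" "1\<^sub>m 4 \<in> L" "1\<^sub>m 4 \<in> unipotents"
    using subgroup.one_closed[OF subgroup_L] subgroup.one_closed[OF subgroup_unipotents] by (auto simp: carrier_GL)
  moreover have "g = 1\<^sub>m 4 * g * diag_embed (1\<^sub>m 2) * 1\<^sub>m 4"
    using GL_inverse(1)[OF g] by (simp add: diag_embed_one)
  ultimately show ?thesis using degenerate_row_killed[OF g] True g by blast
next
  case False
  interpret group "GL 4 :: 'a mat monoid" by (rule group_GL)
  obtain q h n where q: "q \<in> parabolic_31" and h: "h \<in> carrier (GL 2)" and n: "n \<in> unipotents"
    and gq: "g = q * cycle_mat * diag_embed h * n"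
    using parabolic_cycle_decomposition[OF g] False by blast
  obtain j m where j: "j \<in> centralizer D" and m: "m \<in> carrier (GL 3)" and jm: "levi q = j * m"
    and col: "m $$ (0, 0) = 1" "m $$ (1, 0) = 0" "m $$ (2, 0) = 0"
    using centralizer_decomposition[OF parabolicD(3)[OF q]] by blast
  have mc: "m \<in> carrier_mat 3 3" using m by (simp add: carrier_GL)
  have lm: "levi_embed m \<in> parabolic_31" by (rule levi_embed_parabolic[OF m])
  define l where "l = q * inv\<^bsub>GL 4\<^esub> (levi_embed m)"
  have lP: "l \<in> parabolic_31"
    unfolding l_def using subgroup.m_closed[OF subgroup_parabolic q subgroup.m_inv_closed[OF subgroup_parabolic lm]] by simp
  have lq: "l * levi_embed m = q"
    unfolding l_def by (rule GL_cancel(1)[OF parabolicD(1)[OF lm] parabolicD(2)[OF q]])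
  have "levi l * m = j * m"
    using parabolic_mult(2)[OF lP lm] lq jm levi_embed_index(1)[OF mc] by simp
  then have "levi l * m * inv\<^bsub>GL 3\<^esub> m = j * m * inv\<^bsub>GL 3\<^esub> m" by simp
  then have "levi l = j"
    unfolding GL_cancel(2)[OF m levi_carrier(1)] GL_cancel(2)[OF m centralizerD'(2)[OF j]] .
  then have lL: "l \<in> L" using lP j by (simp add: L_def)
  have "supported (levi_embed m * cycle_mat)"
    using supported_unless_second_column[OF m col] supported_second_column[OF m col] by blast
  moreover have "levi_embed m * cycle_mat \<in> carrier (GL 4)"
    using levi_embed_GL[OF m] cycle_mat_GL m_closed by (metis mult_GL)
  moreover have "g = l * (levi_embed m * cycle_mat) * diag_embed h * n"
    unfolding gq lq[symmetric]
    using assoc_mult_mat[OF parabolicD(2)[OF lP] levi_embed_carrier[OF mc] cycle_mat_carrier] by simp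
  ultimately show ?thesis using lL h n by blast
qed

section \<open>The Whittaker space as an induced representation\<close>

lemma whittaker_induced_carrier:
  "carrier (rep_space (whittaker_rep \<psi> (induced_rep (GL 4) L (character_rep \<alpha>)))) = {W \<in> carrier (GL 4) \<rightarrow>\<^sub>E UNIV.
      (\<forall>l\<in>L. \<forall>g\<in>carrier (GL 4). W (l \<otimes>\<^bsub>GL 4\<^esub> g) = \<alpha> l * W g) \<and>
      (\<forall>g\<in>carrier (GL 4). \<forall>n\<in>unipotents. W (g \<otimes>\<^bsub>GL 4\<^esub> n) = unip_character n * W g)}"
proof -
    have "(\<lambda>x\<in>carrier (GL 4). W (x * unip X)) = (\<lambda>x\<in>carrier (GL 4). \<psi> (mat_trace X) * W x) \<longleftrightarrow>
        (\<forall>g\<in>carrier (GL 4). W (g * unip X) = \<psi> (mat_trace X) * W g)" for W :: "'a mat \<Rightarrow> complex" and X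
      by (auto simp: fun_eq_iff restrict_def)
    then show ?thesis
      unfolding whittaker_rep_def
      by (auto simp: induced_rep_character_simps unip_def[symmetric] unipotents_def unip_character_unip)
qed

lemma rep_closed_whittaker_induced:
  "rep_closed (GL 2) (whittaker_rep \<psi> (induced_rep (GL 4) L (character_rep \<alpha>)))"
    (is "rep_closed _ ?W")
proof -
  interpret group "GL 4 :: 'a mat monoid" by (rule group_GL)
  interpret G2: group "GL 2 :: 'a mat monoid" by (rule group_GL)
  note Lc = subgroup.mem_carrier[OF subgroup_L] and Nc = subgroup.mem_carrier[OF subgroup_unipotents]
  have mc: "x * y \<in> carrier (GL 4)" if "x \<in> carrier (GL 4)" "y \<in> carrier (GL 4)" for x y :: "'a mat"
    using m_closed[OF that] by simp
  have act: "W (g * n * diag_embed h) = unip_character n * W (g * diag_embed h)"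
    if W: "\<forall>g\<in>carrier (GL 4). \<forall>n\<in>unipotents. W (g * n) = unip_character n * W g"
      and g: "g \<in> carrier (GL 4)" and n: "n \<in> unipotents" and h: "h \<in> carrier (GL 2)"
    for W :: "'a mat \<Rightarrow> complex" and g n h
  proof -
    have hi: "inv\<^bsub>GL 2\<^esub> h \<in> carrier (GL 2)" using h by simp
    define d where "d = diag_embed h"
    have d: "d \<in> carrier (GL 4)" and di: "inv\<^bsub>GL 4\<^esub> d = diag_embed (inv\<^bsub>GL 2\<^esub> h)"
      using diag_embed_GL[OF h] by (simp_all add: d_def)
    define n' where "n' = inv\<^bsub>GL 4\<^esub> d * n * d"
    have n': "n' \<in> unipotents" "unip_character n' = unip_character n"
      using unip_character_conjugate[OF hi n] d unfolding n'_def di[symmetric] by simp_all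
    have c: "g \<in> carrier_mat 4 4" "n \<in> carrier_mat 4 4" "d \<in> carrier_mat 4 4" "inv\<^bsub>GL 4\<^esub> d \<in> carrier_mat 4 4"
      using g Nc[OF n] GL_inverse[OF d] by (auto simp: carrier_GL)
    have nd: "n * d \<in> carrier_mat 4 4" using c by (rule_tac mult_carrier_mat)
    have "g * d * n' = g * (d * (inv\<^bsub>GL 4\<^esub> d * (n * d)))"
      unfolding n'_def using c by (simp add: assoc_mult_mat[of _ 4 4 _ 4 _ 4] mult_carrier_mat[of _ 4 4 _ 4])
    also have "\<dots> = g * n * d" unfolding GL_cancel(4)[OF d nd] using c by simp
    finally have "g * n * d = g * d * n'" ..
    then show ?thesis using W mc[OF g d] n' by (simp add: d_def)
  qed
  have carrier_act: "(\<lambda>x\<in>carrier (GL 4). W (x * diag_embed h)) \<in> carrier (rep_space ?W)"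
    if W: "W \<in> carrier (rep_space ?W)" and h: "h \<in> carrier (GL 2)" for W h
  proof -
    note dh = diag_embed_GL(1)[OF h]
    have "W (l * g * diag_embed h) = \<alpha> l * W (g * diag_embed h)" if "l \<in> L" "g \<in> carrier (GL 4)" for l g
    proof -
      have "l * g * diag_embed h = l * (g * diag_embed h)"
        using m_assoc[OF Lc[OF that(1)] that(2) dh] by simp
      then show ?thesis using W that mc[OF that(2) dh] unfolding whittaker_induced_carrier by simp
    qed
    then show ?thesis
      using W act[of W, OF _ _ _ h] Lc Nc mc unfolding whittaker_induced_carrier by simp
  qed
  have "rep_act ?W h W = (\<lambda>x\<in>carrier (GL 4). W (x * diag_embed h))" for h W
    by (simp add: whittaker_rep_def induced_rep_character_simps diag_embed_def)
  moreover have "(\<lambda>x\<in>carrier (GL 4). W x + W' x) \<in> carrier (rep_space ?W)"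
    if "W \<in> carrier (rep_space ?W)"
      "W' \<in> carrier (rep_space ?W)" for W W'
    using that Lc Nc mc unfolding whittaker_induced_carrier by (simp add: distrib_left)
  moreover have "(\<lambda>x\<in>carrier (GL 4). c * W x) \<in> carrier (rep_space ?W)"
    if "W \<in> carrier (rep_space ?W)" for c W
    using that Lc Nc mc unfolding whittaker_induced_carrier by simp
  ultimately show ?thesis
    unfolding rep_closed_def using carrier_act
    by (simp add: whittaker_rep_def induced_rep_character_simps)
qed

proposition whittaker_induced_from_centralizer:
  "equivalent_reps (GL 2) (whittaker_rep \<psi> (induced_rep (GL 4) L (character_rep \<alpha>)))
     (induced_rep (GL 2) open_stabilizer (character_rep (open_character central)))"
    (is "equivalent_reps _ ?A ?B")
proof -
  interpret group "GL 4 :: 'a mat monoid" by (rule group_GL)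
  have dc: "diag_embed h \<in> carrier (GL 4)" if "h \<in> carrier (GL 2)" for h :: "'a mat" using diag_embed_GL(1)[OF that] .
  have bij: "bij_betw (\<lambda>W. \<lambda>h\<in>carrier (GL 2). W (cycle_mat \<otimes>\<^bsub>GL 4\<^esub> diag_embed h))
      (carrier (rep_space ?A)) (carrier (rep_space ?B))"
    unfolding whittaker_induced_carrier induced_rep_character_simps(1)
  proof (rule mackey_single_double_coset[OF group_GL subgroup_L subgroup_unipotents cycle_mat_GL])
    show "(diag_embed :: 'a mat \<Rightarrow> 'a mat) \<in> hom (GL 2) (GL 4)"
      unfolding hom_def using dc by (auto simp: diag_embed_mult GL_inverse(1))
    show "\<alpha> \<one>\<^bsub>GL 4\<^esub> = 1" using \<alpha>_one by simp
    show "unip_character \<one>\<^bsub>GL 4\<^esub> = 1"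
      using unip_character_unip[of "0\<^sub>m 2 2"] by (simp add: unip_zero mat_trace_def \<psi>_zero)
    show "\<exists>l\<in>L. \<exists>x\<in>carrier (GL 4). \<exists>h\<in>carrier (GL 2). \<exists>n\<in>unipotents.
        g = l \<otimes>\<^bsub>GL 4\<^esub> x \<otimes>\<^bsub>GL 4\<^esub> diag_embed h \<otimes>\<^bsub>GL 4\<^esub> n \<and>
        ((\<exists>l\<in>L. \<exists>h\<in>carrier (GL 2). \<exists>n\<in>unipotents. x = l \<otimes>\<^bsub>GL 4\<^esub> cycle_mat \<otimes>\<^bsub>GL 4\<^esub> diag_embed h \<otimes>\<^bsub>GL 4\<^esub> n) \<or>
         (\<exists>l\<in>L. \<exists>n\<in>unipotents. l \<otimes>\<^bsub>GL 4\<^esub> x = x \<otimes>\<^bsub>GL 4\<^esub> n \<and> \<alpha> l \<noteq> unip_character n))"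
      if "g \<in> carrier (GL 4)" for g
      using supported_all[OF that] unfolding supported_def mult_GL .
    show "diag_embed h \<otimes>\<^bsub>GL 4\<^esub> n \<otimes>\<^bsub>GL 4\<^esub> inv\<^bsub>GL 4\<^esub> diag_embed h \<in> unipotents \<and>
        unip_character (diag_embed h \<otimes>\<^bsub>GL 4\<^esub> n \<otimes>\<^bsub>GL 4\<^esub> inv\<^bsub>GL 4\<^esub> diag_embed h) = unip_character n"
      if "h \<in> carrier (GL 2)" "n \<in> unipotents" for h n
      unfolding mult_GL by (rule unip_character_conjugate[OF that])
    show "\<alpha> (l \<otimes>\<^bsub>GL 4\<^esub> l') = \<alpha> l * \<alpha> l'" if "l \<in> L" "l' \<in> L" for l l'
      unfolding mult_GL by (rule \<alpha>_mult[OF that])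
    show "unip_character (n \<otimes>\<^bsub>GL 4\<^esub> n') = unip_character n * unip_character n'"
      if "n \<in> unipotents" "n' \<in> unipotents" for n n'
      unfolding mult_GL by (rule unip_character_mult[OF that])
    show "s \<in> carrier (GL 2) \<and> (\<exists>l\<in>L. l \<otimes>\<^bsub>GL 4\<^esub> cycle_mat = cycle_mat \<otimes>\<^bsub>GL 4\<^esub> diag_embed s \<and>
        \<alpha> l = open_character central s)" if "s \<in> open_stabilizer" for s
      unfolding mult_GL by (rule open_stabilizer_realized[OF that])
    show "s \<in> open_stabilizer \<and> \<alpha> l = open_character central s * unip_character n"
      if "l \<in> L" "s \<in> carrier (GL 2)" "n \<in> unipotents"
        "l \<otimes>\<^bsub>GL 4\<^esub> cycle_mat = cycle_mat \<otimes>\<^bsub>GL 4\<^esub> diag_embed s \<otimes>\<^bsub>GL 4\<^esub> n" for l s n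
      by (rule open_stabilizer_character[OF that[unfolded mult_GL]])
  qed
  have gl2: "x * h \<in> carrier (GL 2)" if "x \<in> carrier (GL 2)" "h \<in> carrier (GL 2)" for x h :: "'a mat"
    using monoid.m_closed[OF group.is_monoid[OF group_GL] that] by simp
  have gl4: "cycle_mat * diag_embed x \<in> carrier (GL 4)" if "x \<in> carrier (GL 2)" for x :: "'a mat"
    using m_closed[OF cycle_mat_GL dc[OF that]] by simp
  have act: "cycle_mat * diag_embed x * diag_embed h = cycle_mat * diag_embed (x * h)"
    if "x \<in> carrier (GL 2)" "h \<in> carrier (GL 2)" for x h :: "'a mat"
    unfolding diag_embed_mult[OF GL_inverse(1)[OF that(1)] GL_inverse(1)[OF that(2)], symmetric]
    by (rule assoc_mult_mat[OF cycle_mat_carrier diag_embed_carrier[OF GL_inverse(1)[OF that(1)]]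
          diag_embed_carrier[OF GL_inverse(1)[OF that(2)]]])
  show ?thesis
  proof (rule equivalent_repsI[OF bij])
    fix h :: "'a mat" and v assume "h \<in> carrier (GL 2)"
    then show "(\<lambda>x\<in>carrier (GL 2). rep_act ?A h v (cycle_mat \<otimes>\<^bsub>GL 4\<^esub> diag_embed x)) =
        rep_act ?B h (\<lambda>x\<in>carrier (GL 2). v (cycle_mat \<otimes>\<^bsub>GL 4\<^esub> diag_embed x))"
      by (auto simp: whittaker_rep_def induced_rep_character_simps fun_eq_iff diag_embed_def[symmetric] gl2 gl4 act)
  qed (auto simp: whittaker_rep_def induced_rep_character_simps fun_eq_iff gl4)
qed

end

section \<open>Strongly cuspidal representations in Whittaker form\<close>

context length_two_ring
begin

text \<open>Conjugation of the inducing data by a lift of the base change matrix.\<close>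

lemma strongly_cuspidal_whittaker_form:
  assumes "strongly_cuspidal 3 w r \<psi> \<rho>"
  obtains D \<phi> where "whittaker_form d D" "irreducible (char_poly D)"
    "\<And>g h. g \<in> centralizer D \<Longrightarrow> h \<in> centralizer D \<Longrightarrow> \<phi> (g * h) = \<phi> g * \<phi> h"
    "\<And>X. X \<in> carrier_mat 3 3 \<Longrightarrow> \<phi> (1\<^sub>m 3 + w \<cdot>\<^sub>m X) = \<psi>\<^sub>k (mat_trace (D * red X))"
    "equivalent_reps (GL 3) \<rho> (induced_rep (GL 3) (centralizer D) (character_rep \<phi>))"
proof -
  interpret group "GL 3 :: 'a mat monoid" by (rule group_GL)
  obtain C \<phi>\<^sub>0 where C: "C \<in> carrier_mat 3 3" and irr: "irreducible (char_poly C)"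
    and \<phi>\<^sub>0: "linear_character ((GL 3)\<lparr>carrier := inertia_group 3 w r \<psi> C\<rparr>) \<phi>\<^sub>0"
      "\<forall>k\<in>congruence_subgroup 3 w. \<phi>\<^sub>0 k = congruence_character 3 w r \<psi> C k"
    and eq: "equivalent_reps (GL 3) \<rho> (induced_rep (GL 3) (inertia_group 3 w r \<psi> C) (character_rep \<phi>\<^sub>0))"
    using assms unfolding strongly_cuspidal_def by auto
  note inertia = inertia_group_eq_centralizer[OF C]
  note CD = centralizerD[OF C]
  obtain P D where P: "P \<in> carrier_mat 3 3" "det P \<noteq> 0" and form: "whittaker_form d D"
    and PD: "P * D = C * P" and irrD: "irreducible (char_poly D)"
    using whittaker_form_exists[OF C irr] .
  have D: "D \<in> carrier_mat 3 3" using form by (simp add: whittaker_form_def)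
  obtain x where x: "x \<in> carrier_mat 3 3" "red x = P" using lift_mat[OF P(1)] .
  then have xG: "x \<in> carrier (GL 3)" using P by (auto simp: carrier_GL_iff simp del: r.hom_det)
  note x' = GL_inverse[OF xG]
  \<comment> \<open>The inverse of \<open>P\<close>.\<close>
  define R where "R = red (inv\<^bsub>GL 3\<^esub> x)"
  have R: "R \<in> carrier_mat 3 3" using x' by (simp add: R_def)
  have PR: "P * R = 1\<^sub>m 3" "R * P = 1\<^sub>m 3"
    using red_mult[OF x'(1,2)] red_mult[OF x'(2,1)] x' x by (simp_all add: R_def red_one)
  have conj: "red (x * h * inv\<^bsub>GL 3\<^esub> x) = P * red h * R" if h: "h \<in> carrier_mat 3 3" for h
    using red_mult[OF mult_carrier_mat[OF x'(1) h] x'(2)] red_mult[OF x'(1) h] x by (simp add: R_def)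
  note assoc = assoc_mult_mat[of _ 3 3 _ 3 _ 3]
  note closed = mult_carrier_mat[of _ 3 3 _ 3]
  have RC: "R * C = D * R"
  proof -
    have "R * C = R * C * (P * R)" using PR R C by (simp add: closed)
    also have "\<dots> = R * (C * P) * R" using P R C by (simp add: assoc closed)
    also have "\<dots> = (R * P) * D * R" unfolding PD[symmetric] using P R D by (simp add: assoc closed)
    finally show ?thesis using PR D by simp
  qed
  have cent: "x * h * inv\<^bsub>GL 3\<^esub> x \<in> centralizer C \<longleftrightarrow> h \<in> centralizer D" if h: "h \<in> carrier (GL 3)" for h
  proof -
    have hc: "h \<in> carrier_mat 3 3" and H: "red h \<in> carrier_mat 3 3" using h by (auto simp: carrier_GL)
    have G: "x * h * inv\<^bsub>GL 3\<^esub> x \<in> carrier (GL 3)"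
      using m_closed[OF m_closed[OF xG h] inv_closed[OF xG]] by simp
    have "P * red h * R * C = C * (P * red h * R) \<longleftrightarrow> red h * D = D * red h"
    proof
      assume *: "red h * D = D * red h"
      have "P * red h * R * C = P * (red h * D) * R" using P R C D H RC by (simp add: assoc closed)
      also have "\<dots> = (P * D) * red h * R" unfolding * using P R D H by (simp add: assoc closed)
      also have "\<dots> = C * (P * red h * R)" unfolding PD using P R C H by (simp add: assoc closed)
      finally show "P * red h * R * C = C * (P * red h * R)" .
    next
      assume *: "P * red h * R * C = C * (P * red h * R)"
      have "red h * D = (R * P) * (red h * D) * (R * P)" using PR D H by (simp add: closed)
      also have "\<dots> = R * (P * red h * (D * R)) * P" using P R D H by (simp add: assoc closed)
      also have "\<dots> = R * (P * red h * R * C) * P" unfolding RC[symmetric] using P R C H by (simp add: assoc closed)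
      also have "\<dots> = (R * C) * P * red h * (R * P)" unfolding * using P R C H by (simp add: assoc closed)
      also have "\<dots> = D * (R * P) * red h * (R * P)" unfolding RC using P R D H by (simp add: assoc closed)
      also have "\<dots> = D * red h" using PR D H by (simp add: closed)
      finally show "red h * D = D * red h" .
    qed
    then show ?thesis using G h C D conj[OF hc] by (simp add: centralizer_def)
  qed
  define \<phi> where "\<phi> h = \<phi>\<^sub>0 (x * h * inv\<^bsub>GL 3\<^esub> x)" for h
  have H: "{h \<in> carrier (GL 3). x \<otimes>\<^bsub>GL 3\<^esub> h \<otimes>\<^bsub>GL 3\<^esub> inv\<^bsub>GL 3\<^esub> x \<in> centralizer C} = centralizer D"
    using cent centralizerD[OF D] by auto
  show ?thesis
  proof (rule that[OF form irrD])
    fix g h assume "g \<in> centralizer D" "h \<in> centralizer D"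
    then have gh: "g \<in> carrier (GL 3)" "h \<in> carrier (GL 3)"
      "x * g * inv\<^bsub>GL 3\<^esub> x \<in> centralizer C" "x * h * inv\<^bsub>GL 3\<^esub> x \<in> centralizer C"
      using cent centralizerD[OF D] by auto
    have ghc: "g \<in> carrier_mat 3 3" "h \<in> carrier_mat 3 3" using gh by (auto simp: carrier_GL)
    have "(x * g * inv\<^bsub>GL 3\<^esub> x) * (x * h * inv\<^bsub>GL 3\<^esub> x) = x * g * (inv\<^bsub>GL 3\<^esub> x * (x * (h * inv\<^bsub>GL 3\<^esub> x)))"
      using x' ghc by (simp add: assoc closed)
    also have "\<dots> = x * (g * h) * inv\<^bsub>GL 3\<^esub> x"
      unfolding GL_cancel(3)[OF xG mult_carrier_mat[OF ghc(2) x'(2)]] using x' ghc by (simp add: assoc closed)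
    finally have eq: "(x * g * inv\<^bsub>GL 3\<^esub> x) * (x * h * inv\<^bsub>GL 3\<^esub> x) = x * (g * h) * inv\<^bsub>GL 3\<^esub> x" .
    have "\<phi>\<^sub>0 (a * b) = \<phi>\<^sub>0 a * \<phi>\<^sub>0 b" if "a \<in> centralizer C" "b \<in> centralizer C" for a b
      using \<phi>\<^sub>0(1) that unfolding linear_character_def hom_def inertia by (auto simp: units_of_def)
    from this[OF gh(3,4)] show "\<phi> (g * h) = \<phi> g * \<phi> h"
      unfolding \<phi>_def eq .
  next
    fix X :: "'a mat" assume X: "X \<in> carrier_mat 3 3"
    have Y: "x * X * inv\<^bsub>GL 3\<^esub> x \<in> carrier_mat 3 3" using x' X by (simp add: closed)
    have rX: "red X \<in> carrier_mat 3 3" using X by simp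
    have "\<phi> (1\<^sub>m 3 + w \<cdot>\<^sub>m X) = \<phi>\<^sub>0 (1\<^sub>m 3 + w \<cdot>\<^sub>m (x * X * inv\<^bsub>GL 3\<^esub> x))"
      unfolding \<phi>_def conjugate_congruence[OF xG X] ..
    also have "\<dots> = \<psi>\<^sub>k (mat_trace (C * (P * red X * R)))"
      using \<phi>\<^sub>0(2) Y congruence_character_eq[OF Y, of C] conj[OF X] by (auto simp: congruence_subgroup_def)
    also have "mat_trace (C * (P * red X * R)) = mat_trace ((C * P * red X) * R)"
      using C P R rX by (simp add: assoc closed)
    also have "\<dots> = mat_trace (R * (C * P * red X))"
      by (rule mat_trace_comm[of _ 3 3]) (use C P R rX in \<open>simp_all add: closed\<close>)
    also have "R * (C * P * red X) = (R * P) * D * red X"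
      unfolding PD[symmetric] using P R D rX by (simp add: assoc closed)
    also have "\<dots> = D * red X" using PR D by simp
    finally show "\<phi> (1\<^sub>m 3 + w \<cdot>\<^sub>m X) = \<psi>\<^sub>k (mat_trace (D * red X))" .
  next
    have "equivalent_reps (GL 3) (induced_rep (GL 3) (centralizer C) (character_rep \<phi>\<^sub>0))
       (induced_rep (GL 3) (centralizer D) (character_rep \<phi>))"
      using conjugate_induced_character[OF xG, of "centralizer C" \<phi>\<^sub>0] CD
      unfolding H by (auto simp: \<phi>_def[abs_def])
    then show "equivalent_reps (GL 3) \<rho> (induced_rep (GL 3) (centralizer D) (character_rep \<phi>))"
      using equivalent_reps_trans eq unfolding inertia by blast
  qed
qed

end

section \<open>Finiteness of the residue field\<close>

lemma (in module) linear_functional_lincomb: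
  assumes lin: "\<And>u v. u \<in> carrier M \<Longrightarrow> v \<in> carrier M \<Longrightarrow> f (u \<oplus>\<^bsub>M\<^esub> v) = f u + (f v :: 'z::comm_monoid_add)"
    and zero: "f \<zero>\<^bsub>M\<^esub> = 0"
    and A: "finite A" "A \<subseteq> carrier M" "a \<in> A \<rightarrow> carrier R"
  shows "f (lincomb a A) = (\<Sum>v\<in>A. f (a v \<odot>\<^bsub>M\<^esub> v))"
  using A
proof (induction A)
  case empty
  then show ?case by (simp add: lincomb_def zero)
next
  case (insert v A)
  have "lincomb a (insert v A) = a v \<odot>\<^bsub>M\<^esub> v \<oplus>\<^bsub>M\<^esub> lincomb a A"
    unfolding lincomb_def using insert by (subst finsum_insert) (auto simp: Pi_iff subset_iff)
  then show ?case using insert lin[of "a v \<odot>\<^bsub>M\<^esub> v" "lincomb a A"] by (auto simp: Pi_iff)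
qed

text \<open>A family with a biorthogonal family of functionals is linearly independent.\<close>

lemma finite_biorthogonal_family:
  fixes V :: "(complex, 'v) module" and ev :: "'i \<Rightarrow> 'v \<Rightarrow> complex" and b :: "'i \<Rightarrow> 'v"
  assumes V: "vectorspace class_ring V" "vectorspace.fin_dim class_ring V"
    and add: "\<And>i u v. u \<in> carrier V \<Longrightarrow> v \<in> carrier V \<Longrightarrow> ev i (u \<oplus>\<^bsub>V\<^esub> v) = ev i u + ev i v"
    and smult: "\<And>i c v. v \<in> carrier V \<Longrightarrow> ev i (c \<odot>\<^bsub>V\<^esub> v) = c * ev i v"
    and b: "\<And>i. b i \<in> carrier V" "\<And>i j. ev i (b j) = (if i = j then 1 else 0)"
  shows "finite (UNIV :: 'i set)"
proof (rule ccontr)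
  assume inf: "infinite (UNIV :: 'i set)"
  interpret V: vectorspace class_ring V by fact
  define d where "d = V.dim"
  obtain F :: "'i set" where F: "finite F" "card F = Suc d"
    using infinite_arbitrarily_large[OF inf] by blast
  have inj: "inj_on b F" using b(2) by (intro inj_onI) (metis zero_neq_one)
  have zero: "ev i \<zero>\<^bsub>V\<^esub> = 0" for i using add[of "\<zero>\<^bsub>V\<^esub>" "\<zero>\<^bsub>V\<^esub>" i] by simp
  have "V.lin_indpt (b ` F)"
  proof
    assume "V.lin_dep (b ` F)"
    then obtain A a v where A: "finite A" "A \<subseteq> b ` F" "a \<in> A \<rightarrow> UNIV" "V.lincomb a A = \<zero>\<^bsub>V\<^esub>" "v \<in> A" "a v \<noteq> 0"
      unfolding V.lin_dep_def by (auto simp: class_ring_simps)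
    obtain i where i: "i \<in> F" "v = b i" using A by auto
    have Ac: "A \<subseteq> carrier V" using A(2) b(1) by auto
    have "0 = (\<Sum>u\<in>A. ev i (a u \<odot>\<^bsub>V\<^esub> u))"
      using V.linear_functional_lincomb[of "ev i" A a] add zero A Ac by auto
    also have "\<dots> = (\<Sum>u\<in>A. if u = v then a v else 0)"
    proof (rule sum.cong[OF refl])
      fix u assume "u \<in> A"
      then obtain j where "j \<in> F" "u = b j" using A by auto
      then show "ev i (a u \<odot>\<^bsub>V\<^esub> u) = (if u = v then a v else 0)"
        using inj i by (auto simp: smult b inj_on_eq_iff)
    qed
    also have "\<dots> = a v" using A by simp
    finally show False using A by simp
  qed
  then have "card (b ` F) \<le> V.dim"
    using V.li_le_dim(2)[OF V(2), of "b ` F"] b(1) by auto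
  then show False using card_image[OF inj] F by (simp add: d_def)
qed

context length_two_ring
begin

text \<open>The functions supported on the cosets of the unipotent matrices with one entry \<open>t s\<close>, for \<open>s\<close> in the
residue field, are biorthogonal to the evaluations at these matrices: two of them in the same coset
would differ by an element of the centralizer of \<open>D\<close> that fixes \<open>e\<^sub>0\<close>, which is trivial modulo \<open>w\<close>.\<close>

lemma residue_field_finite:
  fixes \<rho> :: "('a mat, 'v) repr"
  assumes rep: "is_representation (GL 3) \<rho>" and cusp: "strongly_cuspidal 3 w r \<psi> \<rho>"
  shows "finite (UNIV :: 'k set)"
proof -
  interpret group "GL 3 :: 'a mat monoid" by (rule group_GL)
  obtain D \<phi> where form: "whittaker_form 0 D" and irr: "irreducible (char_poly D)"
    and mult: "\<And>g h. g \<in> centralizer D \<Longrightarrow> h \<in> centralizer D \<Longrightarrow> \<phi> (g * h) = \<phi> g * \<phi> h"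
    and cong: "\<And>X. X \<in> carrier_mat 3 3 \<Longrightarrow> \<phi> (1\<^sub>m 3 + w \<cdot>\<^sub>m X) = \<psi>\<^sub>k (mat_trace (D * red X))"
    and eq: "equivalent_reps (GL 3) \<rho> (induced_rep (GL 3) (centralizer D) (character_rep \<phi>))"
    using strongly_cuspidal_whittaker_form[OF cusp, where d = 0] by blast
  have D: "D \<in> carrier_mat 3 3" using form by (simp add: whittaker_form_def)
  note J = subgroup_centralizer[OF D]
  have \<phi>1: "\<phi> (1\<^sub>m 3) = 1"
  proof -
    have "1\<^sub>m 3 + w \<cdot>\<^sub>m 0\<^sub>m 3 3 = 1\<^sub>m 3" by (intro eq_matI) auto
    moreover have "red (0\<^sub>m 3 3) = 0\<^sub>m 3 3" by (intro eq_matI) auto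
    ultimately show ?thesis using cong[of "0\<^sub>m 3 3"] D by (simp add: mat_trace_3)
  qed
  define t :: "'k \<Rightarrow> 'a" where "t s = (SOME y. r y = s)" for s
  have t: "r (t s) = s" for s unfolding t_def by (rule someI_ex) (metis lift)
  define x where "x a = mat 3 3 (\<lambda>(i, j). if i = j then 1 else if i = 0 \<and> j = 1 then a else 0)" for a :: 'a
  have xc: "x a \<in> carrier_mat 3 3" for a by (simp add: x_def)
  have xx: "x a * x b = x (a + b)" for a b
  proof (rule eq_matI)
    fix i j assume "i < dim_row (x (a + b))" "j < dim_col (x (a + b))"
    then have ij: "i < 3" "j < 3" by (auto simp: x_def)
    show "(x a * x b) $$ (i, j) = x (a + b) $$ (i, j)"
      unfolding mult_mat_3_index[OF xc xc ij] using ij unfolding less_3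
      by (elim disjE) (simp_all add: x_def)
  qed (auto simp: x_def)
  have x0: "x 0 = 1\<^sub>m 3" by (auto simp: x_def intro!: eq_matI)
  have xG: "x a \<in> carrier (GL 3)" and xi: "inv\<^bsub>GL 3\<^esub> (x a) = x (- a)" for a
    using inv_GL[OF xc xc, of a "- a"] by (simp_all add: xx x0)
  have xJ: "r a = 0" if a: "x a \<in> centralizer D" for a
  proof -
    have "red (x a) = red (x a) $$ (0, 0) \<cdot>\<^sub>m 1\<^sub>m 3"
      by (rule whittaker_form_commutant_scalar[OF form]) (use centralizerD[OF D a] in \<open>auto simp: x_def\<close>)
    from arg_cong[OF this, of "\<lambda>M. M $$ (0, 1)"] show ?thesis by (simp add: x_def)
  qed
  let ?I = "induced_rep (GL 3) (centralizer D) (character_rep \<phi>)"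
  obtain T where T0: "is_equivalence (GL 3) \<rho> ?I T" using eq unfolding equivalent_reps_iff ..
  note T = is_equivalenceD[OF T0]
  define f where "f s = (\<lambda>g\<in>carrier (GL 3). if g \<otimes>\<^bsub>GL 3\<^esub> inv\<^bsub>GL 3\<^esub> (x (t s)) \<in> centralizer D
      then rep_act (character_rep \<phi>) (g \<otimes>\<^bsub>GL 3\<^esub> inv\<^bsub>GL 3\<^esub> (x (t s))) 1 else 0)" for s
  have f: "f s \<in> carrier (rep_space ?I)" for s
    unfolding f_def by (rule induced_rep_delta[OF J xG]) (auto simp: character_rep_def mult)
  define b where "b s = inv_into (carrier (rep_space \<rho>)) T (f s)" for s
  have b: "b s \<in> carrier (rep_space \<rho>)" "T (b s) = f s" for s
    unfolding b_def using bij_betw_apply[OF bij_betw_inv_into[OF T(1)] f] bij_betw_inv_into_right[OF T(1) f] by auto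
  show ?thesis
  proof (rule finite_biorthogonal_family[where V = "rep_space \<rho>" and ev = "\<lambda>s v. T v (x (t s))" and b = b])
    show "vectorspace class_ring (rep_space \<rho>)" "vectorspace.fin_dim class_ring (rep_space \<rho>)"
      using rep unfolding is_representation_def by auto
    show "T (u \<oplus>\<^bsub>rep_space \<rho>\<^esub> v) (x (t s)) = T u (x (t s)) + T v (x (t s))"
      if "u \<in> carrier (rep_space \<rho>)" "v \<in> carrier (rep_space \<rho>)" for s u v
      using T(2)[OF that] xG by (simp add: induced_rep_character_simps)
    show "T (c \<odot>\<^bsub>rep_space \<rho>\<^esub> v) (x (t s)) = c * T v (x (t s))"
      if "v \<in> carrier (rep_space \<rho>)" for s c v
      using T(3)[OF that] xG by (simp add: induced_rep_character_simps)
    show "b s \<in> carrier (rep_space \<rho>)" for s by (rule b(1))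
    show "T (b s') (x (t s)) = (if s = s' then 1 else 0)" for s s'
    proof (cases "s = s'")
      case True
      then show ?thesis
        using xG subgroup.one_closed[OF J] by (simp add: b f_def xi xx x0 character_rep_def \<phi>1)
    next
      case False
      have "x (t s - t s') \<notin> centralizer D"
        using xJ[of "t s - t s'"] False by (auto simp: r.hom_minus t)
      then show ?thesis using xG False by (simp add: b f_def xi xx)
    qed
  qed
qed

section \<open>Whittaker spaces and central characters\<close>

lemma scalar_GL:
  assumes "r x \<noteq> 0" shows "x \<cdot>\<^sub>m 1\<^sub>m n \<in> carrier (GL n)" "x \<cdot>\<^sub>m 1\<^sub>m n \<in> group_center (GL n)"
proof -
  show G: "x \<cdot>\<^sub>m 1\<^sub>m n \<in> carrier (GL n)"
    using assms by (simp add: carrier_GL_iff r.hom_mult r.hom_power)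
  show "x \<cdot>\<^sub>m 1\<^sub>m n \<in> group_center (GL n)"
    unfolding group_center_def using G scalar_central[of _ n x] by (auto simp: carrier_GL)
qed

lemma linear_character_units:
  assumes "linear_character (units_of class_ring) \<chi>" "r x \<noteq> 0" "r y \<noteq> 0"
  shows "\<chi> (x * y) = \<chi> x * \<chi> y"
proof -
  have "x \<in> carrier (units_of class_ring)" if "r x \<noteq> 0" for x
    using unit_inv[OF that] unfolding units_of_def Units_def by (auto simp: mult.commute)
  then show ?thesis
    using assms unfolding linear_character_def hom_def by (auto simp: units_of_def)
qed

lemma rep_closed_parabolic_induction:
  fixes \<rho> :: "('a mat, 'v) repr"
  assumes "is_representation (GL 3) \<rho>"
  shows "rep_closed (GL 4) (parabolic_induction \<rho> \<chi>)"
  unfolding parabolic_induction_def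
proof (rule group.rep_closed_induced[OF group_GL])
  interpret V: vectorspace class_ring "rep_space \<rho>" using assms by (simp add: is_representation_def)
  show "(parabolic_31 :: 'a mat set) \<subseteq> carrier (GL 4)" using subgroup.subset[OF subgroup_parabolic] .
  show "u \<oplus>\<^bsub>rep_space (inflated_rep \<rho> \<chi>)\<^esub> v \<in> carrier (rep_space (inflated_rep \<rho> \<chi>))"
    if "u \<in> carrier (rep_space (inflated_rep \<rho> \<chi>))" "v \<in> carrier (rep_space (inflated_rep \<rho> \<chi>))" for u v
    using that by (simp add: inflated_rep_def)
  show "c \<odot>\<^bsub>rep_space (inflated_rep \<rho> \<chi>)\<^esub> v \<in> carrier (rep_space (inflated_rep \<rho> \<chi>))"
    if "v \<in> carrier (rep_space (inflated_rep \<rho> \<chi>))" for c v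
    using that by (simp add: inflated_rep_def)
  fix q :: "'a mat" assume "q \<in> parabolic_31"
  then have "rep_act \<rho> (levi q) \<in> module_hom class_ring (rep_space \<rho>) (rep_space \<rho>)"
    using assms parabolicD(3) by (simp add: is_representation_def)
  then show "rep_act (inflated_rep \<rho> \<chi>) q \<in> module_hom class_ring (rep_space (inflated_rep \<rho> \<chi>)) (rep_space (inflated_rep \<rho> \<chi>))"
    unfolding module_hom_def inflated_rep_def levi_def[symmetric]
    by (auto simp: Pi_iff V.smult_r_distr V.smult_assoc1[symmetric, simplified] mult.commute)
qed

text \<open>The Whittaker space in terms of the central character. That \<open>\<alpha>\<close> agrees with \<open>\<omega>\<close> on scalar
matrices is seen on the function supported on \<open>L\<close>.\<close>

lemma whittaker_parabolic_induction:
  fixes \<rho> :: "('a mat, 'v) repr"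
  assumes cusp: "strongly_cuspidal 3 w r \<psi> \<rho>" and \<chi>: "linear_character (units_of class_ring) \<chi>"
    and central: "central_character (GL 4) (parabolic_induction \<rho> \<chi>) \<omega>"
  defines "\<tau> \<equiv> induced_rep (GL 2) open_stabilizer
      (character_rep (open_character (\<lambda>x. if r x = 0 then 0 else \<omega> (x \<cdot>\<^sub>m 1\<^sub>m 4))))"
  shows "equivalent_reps (GL 2) (whittaker_rep \<psi> (parabolic_induction \<rho> \<chi>)) \<tau>"
    and "equivalent_reps (GL 2) \<tau> (whittaker_rep \<psi> (parabolic_induction \<rho> \<chi>))"
proof -
  interpret G4: group "GL 4 :: 'a mat monoid" by (rule group_GL)
  have rep: "is_representation (GL 3) \<rho>" using cusp by (simp add: strongly_cuspidal_def)
  obtain \<kappa> where \<kappa>: "\<forall>x. \<chi> (1 + w * x) = \<psi>\<^sub>k (\<kappa> * r x)"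
    using units_character_duality[OF residue_field_finite[OF rep cusp] \<chi>] by auto
  obtain D \<phi> where D: "whittaker_form (- \<kappa>) D" "irreducible (char_poly D)"
    "\<And>g h. g \<in> centralizer D \<Longrightarrow> h \<in> centralizer D \<Longrightarrow> \<phi> (g * h) = \<phi> g * \<phi> h"
    "\<And>X. X \<in> carrier_mat 3 3 \<Longrightarrow> \<phi> (1\<^sub>m 3 + w \<cdot>\<^sub>m X) = \<psi>\<^sub>k (mat_trace (D * red X))"
    and eq: "equivalent_reps (GL 3) \<rho> (induced_rep (GL 3) (centralizer D) (character_rep \<phi>))"
    using strongly_cuspidal_whittaker_form[OF cusp, where d = "- \<kappa>"] by blast
  interpret cuspidal_datum w r \<psi> D \<phi> \<chi> \<kappa>
    by unfold_locales (use D \<kappa> linear_character_units[OF \<chi>] in auto)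
  let ?P = "parabolic_induction \<rho> \<chi>" and ?I = "induced_rep (GL 4) L (character_rep \<alpha>)"
  have stages: "equivalent_reps (GL 4) ?P ?I"
    unfolding parabolic_induction_def L_def \<alpha>_def
  proof (rule induction_in_stages[OF group_GL group_GL subgroup_parabolic, where e = levi_embed])
    show "levi (q \<otimes>\<^bsub>GL 4\<^esub> q') = levi q \<otimes>\<^bsub>GL 3\<^esub> levi q'" if "q \<in> parabolic_31" "q' \<in> parabolic_31" for q q' :: "'a mat"
      using parabolic_mult[OF that] by simp
    show "levi q \<in> carrier (GL 3)" if "q \<in> parabolic_31" for q :: "'a mat" using parabolicD[OF that] by simp
    show "levi_embed (m \<otimes>\<^bsub>GL 3\<^esub> m') = levi_embed m \<otimes>\<^bsub>GL 4\<^esub> levi_embed m'"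
      if "m \<in> carrier (GL 3)" "m' \<in> carrier (GL 3)" for m m' :: "'a mat"
      using that by (simp add: levi_embed_mult carrier_GL)
    show "levi_embed m \<in> parabolic_31" if "m \<in> carrier (GL 3)" for m :: "'a mat" by (rule levi_embed_parabolic[OF that])
    show "levi (levi_embed m) = m" "\<chi> (levi_embed m $$ (3, 3)) = 1" if "m \<in> carrier (GL 3)" for m :: "'a mat"
      using levi_embed_index(1,2)[OF GL_inverse(1)[OF that]] by (simp_all add: \<chi>_one)
    show "\<chi> ((q \<otimes>\<^bsub>GL 4\<^esub> q') $$ (3, 3)) = \<chi> (q $$ (3, 3)) * \<chi> (q' $$ (3, 3))"
      if "q \<in> parabolic_31" "q' \<in> parabolic_31" for q q' :: "'a mat"
      using parabolic_mult(3)[OF that] \<chi>_mult[OF parabolicD(4)[OF that(1)] parabolicD(4)[OF that(2)]] by simp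
    show "centralizer D \<subseteq> carrier (GL 3)" using centralizerD' by auto
    show "\<one>\<^bsub>GL 3\<^esub> \<in> centralizer D" using subgroup.one_closed[OF subgroup_centralizer[OF D_carrier]] .
    show "\<phi> \<one>\<^bsub>GL 3\<^esub> = 1" using \<phi>_one by simp
    show "rep_space (inflated_rep \<rho> \<chi>) = rep_space \<rho>" by (simp add: inflated_rep_def)
    show "rep_act (inflated_rep \<rho> \<chi>) q v = \<chi> (q $$ (3, 3)) \<odot>\<^bsub>rep_space \<rho>\<^esub> rep_act \<rho> (levi q) v" for q v
      by (simp add: inflated_rep_def levi_def)
    show "rep_closed (GL 3) \<rho>" by (rule is_representation_closed[OF rep])
  qed (rule eq)
  have Pc: "rep_closed (GL 4) ?P" by (rule rep_closed_parabolic_induction[OF rep])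
  have Ic: "rep_closed (GL 4) ?I"
    by (rule G4.rep_closed_induced_character) (use subgroup.subset[OF subgroup_L] in simp)
  have unip': "four_block_mat (1\<^sub>m 2) X (0\<^sub>m 2 2) (1\<^sub>m 2) \<in> carrier (GL 4)" if "X \<in> carrier_mat 2 2" for X :: "'a mat"
    using unip_GL(1)[OF that] by (simp add: unip_def)
  have diag': "four_block_mat g (0\<^sub>m 2 2) (0\<^sub>m 2 2) g \<in> carrier (GL 4)" if "g \<in> carrier (GL 2)" for g :: "'a mat"
    using diag_embed_GL(1)[OF that] by (simp add: diag_embed_def)
  have "central = (\<lambda>x. if r x = 0 then 0 else \<omega> (x \<cdot>\<^sub>m 1\<^sub>m 4))"
  proof
    fix x show "central x = (if r x = 0 then 0 else \<omega> (x \<cdot>\<^sub>m 1\<^sub>m 4))"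
    proof (cases "r x = 0")
      case False
      define z where "z = x \<cdot>\<^sub>m 1\<^sub>m 4"
      have z: "z \<in> carrier (GL 4)" "z \<in> group_center (GL 4)" using scalar_GL[OF False] by (simp_all add: z_def)
      have levi_z: "levi z = x \<cdot>\<^sub>m 1\<^sub>m 3" by (auto simp: z_def levi_def intro!: eq_matI)
      have zL: "z \<in> L"
        unfolding L_def parabolic_31_iff using z(1) levi_z scalar_in_centralizer[OF False] by (auto simp: z_def)
      define W where "W = (\<lambda>g\<in>carrier (GL 4). if g \<otimes>\<^bsub>GL 4\<^esub> inv\<^bsub>GL 4\<^esub> \<one>\<^bsub>GL 4\<^esub> \<in> L
          then rep_act (character_rep \<alpha>) (g \<otimes>\<^bsub>GL 4\<^esub> inv\<^bsub>GL 4\<^esub> \<one>\<^bsub>GL 4\<^esub>) 1 else 0)"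
      have W: "W \<in> carrier (rep_space ?I)"
        unfolding W_def by (rule G4.induced_rep_delta[OF subgroup_L G4.one_closed]) (auto simp: character_rep_def \<alpha>_mult)
      have one: "inv\<^bsub>GL 4\<^esub> (1\<^sub>m 4) = (1\<^sub>m 4 :: 'a mat)" using G4.inv_one by simp
      have W1: "W (1\<^sub>m 4) = 1" "W z = \<alpha> z"
        using z(1) zL GL_inverse(1)[OF z(1)] subgroup.one_closed[OF subgroup_L] G4.one_closed
        by (simp_all add: W_def one character_rep_def \<alpha>_one)
      obtain T where T0: "is_equivalence (GL 4) ?P ?I T" using stages unfolding equivalent_reps_iff ..
      note T = is_equivalenceD[OF T0]
      obtain f where f: "f \<in> carrier (rep_space ?P)" "T f = W"
        using bij_betw_imp_surj_on[OF T(1)] W by (metis imageE)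
      have "rep_act ?I z W = T (rep_act ?P z f)" using T(4)[OF z(1) f(1)] f by simp
      also have "rep_act ?P z f = \<omega> z \<odot>\<^bsub>rep_space ?P\<^esub> f"
        using central z(2) f(1) unfolding central_character_def by blast
      also have "T \<dots> = \<omega> z \<odot>\<^bsub>rep_space ?I\<^esub> W" using T(3)[OF f(1)] f by simp
      finally have "rep_act ?I z W (1\<^sub>m 4) = (\<omega> z \<odot>\<^bsub>rep_space ?I\<^esub> W) (1\<^sub>m 4)" by simp
      then have "\<alpha> z = \<omega> z"
        using G4.one_closed GL_inverse(1)[OF z(1)] W1 by (simp add: induced_rep_character_simps)
      then show ?thesis using False by (simp add: central_def \<alpha>_def levi_z) (simp add: z_def)
    qed (simp add: central_def)
  qed
  then have \<tau>: "\<tau> = induced_rep (GL 2) open_stabilizer (character_rep (open_character central))"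
    by (simp add: \<tau>_def)
  show "equivalent_reps (GL 2) (whittaker_rep \<psi> ?P) \<tau>"
    unfolding \<tau>
    by (rule equivalent_reps_trans[OF whittaker_rep_equivalent[OF stages Pc unip' diag'] whittaker_induced_from_centralizer])
  show "equivalent_reps (GL 2) \<tau> (whittaker_rep \<psi> ?P)"
    unfolding \<tau>
    by (rule equivalent_reps_trans[OF equivalent_reps_sym[OF whittaker_induced_from_centralizer rep_closed_whittaker_induced]
          whittaker_rep_equivalent[OF equivalent_reps_sym[OF stages Pc] Ic unip' diag']])
qed

end

text \<open>The additive character is nontrivial on the multiples of the image of \<open>\<pi>\<close>, so \<open>\<pi>\<close> is not zero. In a
domain, \<open>\<pi> y \<in> (\<pi>\<^sup>2)\<close> then gives \<open>y \<in> (\<pi>)\<close>, which computes the annihilator.\<close>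

lemma length_two_quotient:
  fixes \<O> :: "'f::field ring" and red :: "'f \<Rightarrow> 'a::comm_ring_1" and res :: "'a \<Rightarrow> 'k::field"
  assumes \<O>: "\<O> = class_ring\<lparr>carrier := S\<rparr>" and unif: "uniformizer \<O> \<pi>"
    and red: "quotient_map \<O> (PIdl\<^bsub>\<O>\<^esub> (\<pi> * \<pi>)) (class_ring :: 'a ring) red"
    and res: "quotient_map (class_ring :: 'a ring) (PIdl\<^bsub>class_ring\<^esub> (red \<pi>)) (class_ring :: 'k ring) res"
    and \<psi>: "additive_character \<psi>" "\<exists>x. \<psi> (red \<pi> * x) \<noteq> 1"
  shows "length_two_ring (red \<pi>) res \<psi>"
proof -
  have "maximalideal (PIdl\<^bsub>\<O>\<^esub> \<pi>) \<O>" and \<pi>: "\<pi> \<in> carrier \<O>" using unif by (simp_all add: uniformizer_def)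
  then interpret maximalideal "PIdl\<^bsub>\<O>\<^esub> \<pi>" \<O> by simp
  have S: "carrier \<O> = S" by (simp add: \<O>)
  have ops: "x \<otimes>\<^bsub>\<O>\<^esub> y = x * y" "x \<oplus>\<^bsub>\<O>\<^esub> y = x + y" "\<one>\<^bsub>\<O>\<^esub> = 1" "\<zero>\<^bsub>\<O>\<^esub> = 0" for x y
    by (simp_all add: \<O>)
  have red_hom: "red (x * y) = red x * red y" "red (x + y) = red x + red y" if "x \<in> S" "y \<in> S" for x y
    using red that unfolding quotient_map_def Ring.ring_hom_def by (auto simp: S ops)
  have red_ker: "red x = 0 \<longleftrightarrow> (\<exists>z\<in>S. x = z * (\<pi> * \<pi>))" if "x \<in> S" for x
  proof -
    have "x \<in> a_kernel \<O> (class_ring :: 'a ring) red \<longleftrightarrow> x \<in> PIdl\<^bsub>\<O>\<^esub> (\<pi> * \<pi>)"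
      using red by (simp add: quotient_map_def)
    then show ?thesis using that by (auto simp: a_kernel_def' cgenideal_def S ops)
  qed
  have red_surj: "\<exists>x\<in>S. red x = y" for y
    using red unfolding quotient_map_def S by (metis (no_types, lifting) UNIV_I image_iff partial_object.select_convs(1))
  have res_hom: "res (x * y) = res x * res y" "res (x + y) = res x + res y" "res 1 = 1" for x y
    using res unfolding quotient_map_def Ring.ring_hom_def by auto
  have res_ker: "res x = 0 \<longleftrightarrow> red \<pi> dvd x" for x
  proof -
    have "x \<in> a_kernel (class_ring :: 'a ring) (class_ring :: 'k ring) res \<longleftrightarrow> x \<in> PIdl\<^bsub>class_ring\<^esub> (red \<pi>)"
      using res by (simp add: quotient_map_def)
    then show ?thesis by (auto simp: a_kernel_def' cgenideal_def dvd_def mult.commute)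
  qed
  have \<psi>_add: "\<psi> (x + y) = \<psi> x * \<psi> y" for x y
    using \<psi>(1) unfolding additive_character_def linear_character_def hom_def by (auto simp: units_of_def)
  have "\<exists>u. u * \<psi> x = 1" for x
    using \<psi>(1) unfolding additive_character_def linear_character_def hom_def by (auto simp: units_of_def Units_def Pi_iff)
  then have \<psi>_nz: "\<psi> x \<noteq> 0" for x by (metis mult_zero_right zero_neq_one)
  have \<psi>0: "\<psi> 0 = 1" using \<psi>_add[of 0 0] \<psi>_nz[of 0] by simp
  have zS: "0 \<in> S" using zero_closed by (simp add: S ops)
  have oneS: "1 \<in> S" using one_closed by (simp add: S ops)
  have "red 0 = 0" using red_hom(2)[OF zS zS] by simp
  then have \<pi>0: "\<pi> \<noteq> 0" using \<psi>(2) \<psi>0 by auto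
  have \<pi>S: "\<pi> \<in> S" using \<pi> by (simp add: S)
  have \<pi>\<pi>: "\<pi> * \<pi> \<in> S" using m_closed[OF \<pi> \<pi>] by (simp add: S ops)
  show ?thesis
  proof
    show "res 0 = 0" by (simp add: res_ker)
    show "surj res" using res by (simp add: quotient_map_def)
    show "red \<pi> * red \<pi> = 0"
      using red_ker[OF \<pi>\<pi>] oneS red_hom(1)[OF \<pi>S \<pi>S] by (metis mult_1)
    show "res x = 0" if "red \<pi> * x = 0" for x
    proof -
      obtain y where y: "y \<in> S" "red y = x" using red_surj by auto
      have yc: "\<pi> * y \<in> S" using m_closed[OF \<pi>, of y] y by (simp add: S ops)
      have "red (\<pi> * y) = 0" using red_hom(1)[OF \<pi>S y(1)] y that by simp
      then obtain z where z: "z \<in> S" "\<pi> * y = z * (\<pi> * \<pi>)" using red_ker[OF yc] by auto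
      then have "y = \<pi> * z" using \<pi>0 by (simp add: mult.commute mult.left_commute)
      then have "x = red \<pi> * red z" using red_hom(1)[OF \<pi>S z(1)] y by simp
      then show ?thesis using res_ker by simp
    qed
  qed (use res_hom res_ker \<psi>_add \<psi>0 \<psi>(2) in auto)
qed

theorem corollary1p6:
  fixes p :: nat and A :: "(nat \<Rightarrow> int) ring" and \<iota> :: "(nat \<Rightarrow> int) \<Rightarrow> 'f::field"
    and \<O> :: "'f ring" and \<pi> :: 'f
    and red :: "'f \<Rightarrow> 'a::comm_ring_1"
    and res :: "'a \<Rightarrow> 'k::field"
    and \<psi>\<^sub>0 :: "'a \<Rightarrow> complex"
    and \<rho>\<^sub>1 :: "('a mat, 'v) repr" and \<rho>\<^sub>2 :: "('a mat, 'w) repr"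
    and \<chi>\<^sub>1 \<chi>\<^sub>2 :: "'a \<Rightarrow> complex"
    and \<omega> :: "'a mat \<Rightarrow> complex"
  assumes "unramified_extension p A \<iota>" and "odd p"
    and "\<O> = integral_closure (\<iota> ` carrier A)"
    and "uniformizer \<O> \<pi>"
    and "quotient_map \<O> (PIdl\<^bsub>\<O>\<^esub> (\<pi> * \<pi>)) (class_ring :: 'a ring) red"
    and "quotient_map (class_ring :: 'a ring) (PIdl\<^bsub>class_ring\<^esub> (red \<pi>)) (class_ring :: 'k ring) res"
    and "additive_character \<psi>\<^sub>0" and "\<exists>x. \<psi>\<^sub>0 (red \<pi> * x) \<noteq> 1"
    and "strongly_cuspidal 3 (red \<pi>) res \<psi>\<^sub>0 \<rho>\<^sub>1"
    and "strongly_cuspidal 3 (red \<pi>) res \<psi>\<^sub>0 \<rho>\<^sub>2"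
    and "linear_character (units_of class_ring) \<chi>\<^sub>1"
    and "linear_character (units_of class_ring) \<chi>\<^sub>2"
    and "central_character (GL 4) (parabolic_induction \<rho>\<^sub>1 \<chi>\<^sub>1) \<omega>"
    and "central_character (GL 4) (parabolic_induction \<rho>\<^sub>2 \<chi>\<^sub>2) \<omega>"
  shows "equivalent_reps (GL 2)
    (whittaker_rep \<psi>\<^sub>0 (parabolic_induction \<rho>\<^sub>1 \<chi>\<^sub>1))
    (whittaker_rep \<psi>\<^sub>0 (parabolic_induction \<rho>\<^sub>2 \<chi>\<^sub>2))"
proof -
  interpret length_two_ring "red \<pi>" res \<psi>\<^sub>0
    using length_two_quotient[OF _ assms(4-8)] assms(3) unfolding integral_closure_def by blast
  show ?thesis
    by (rule equivalent_reps_trans[OF whittaker_parabolic_induction(1)[OF assms(9,11,13)]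
          whittaker_parabolic_induction(2)[OF assms(10,12,14)]])
qed

end
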